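(* Let $n\ge1$, let $\mathcal{E},\mathcal{E}_*$ be Hilbert spaces and let $\Theta\in H^\infty_{\mathcal{B}(\mathcal{E},\mathcal{E}_* )}(\mathbb{D}^n)$ be an inner function. Then there exist a Hilbert space $\mathcal{H}$, a Beurling tuple $T\in\mathbb{S}_n^B(\mathcal{H})$, a Hilbert space $\mathcal{F}$, and unitary operators $\sigma:\mathcal{E}\to\boldsymbol{\mathcal{D}}_T\oplus\mathcal{F}$ and $\sigma_*:\mathcal{E}_*\to\mathcal{D}_{T^*}\oplus\mathcal{F}$ such that $$\Theta(z)=\sigma_*^*\begin{bmatrix}\Theta_T(z)&0\\0&I_{\mathcal{F}}\end{bmatrix}\sigma\qquad\text{for all }z\in\mathbb{D}^n,$$ where $\Theta_T$ is the characteristic function of $T$.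
   Context: Hilbert spaces are complex and separable, and the zero Hilbert space is allowed; $I_n=\{1,\dots,n\}$. $H^\infty_{\mathcal{B}(\mathcal{E},\mathcal{E}_* )}(\mathbb{D}^n)$ is the space of bounded $\mathcal{B}(\mathcal{E},\mathcal{E}_* )$-valued analytic functions on $\mathbb{D}^n$; $\Theta$ in it is inner if its boundary values satisfy $\Theta(z)^*\Theta(z)=I_{\mathcal{E}}$ for a.e. $z\in\mathbb{T}^n$. For a contraction $X$, $D_X=(I-X^*X)^{1/2}$; $X\in C_{\cdot0}$ means $X^{*m}\to0$ strongly. For a commuting $n$-tuple of contractions $T$ on $\mathcal{H}$ let $\mathbb{S}_n^{-1}(T,T^* )=\sum_{k\in\{0,1\}^n}(-1)^{|k|}T^kT^{*k}$, $T^k=T_1^{k_1}\cdots T_n^{k_n}$, $T^{*k}=T_1^{*k_1}\cdots T_n^{*k_n}$, $|k|=\sum_ik_i$. $T$ is a Szegő tuple if $\mathbb{S}_n^{-1}(T,T^* )\ge0$ and all $T_i\in C_{\cdot0}$; it is a Beurling tuple, $T\in\mathbb{S}_n^B(\mathcal{H})$, if moreover $D_{T_i}D_{T_j}=0$ for all $i\ne j$. $D_{T^*}=(\mathbb{S}_n^{-1}(T,T^* ))^{1/2}$, $\mathcal{D}_{T^*}=\overline{\mathrm{ran}}\,D_{T^*}$. With $\Delta_X(A)=XAX^*$ and $[A,B]=AB-BA$, set $D_{j,T}^2=\prod_{k\in I_n\setminus\{j\}}(I-\Delta_{T_k})(D_{T_j}^2)$ and, for $i\ne j$, $\delta_{ij}(T)=\prod_{k\in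 I_n\setminus\{i,j\}}(I-\Delta_{T_k})([T_j,T_i^*])$ (products are compositions, empty product = identity). $\boldsymbol{D}_T^2$ is the operator on $\mathcal{H}^n$ with $(j,j)$ entry $D_{j,T}^2$ and $(i,j)$ entry $\delta_{ij}(T)$, $i\neq j$; it is non-negative for Beurling tuples, $\boldsymbol{D}_T$ is its non-negative square root and $\boldsymbol{\mathcal{D}}_T=\overline{\mathrm{ran}}\,\boldsymbol{D}_T\subseteq\mathcal{H}^n$. The characteristic function of a Beurling tuple $T$ is the (well-defined, inner) analytic function $\Theta_T:\mathbb{D}^n\to\mathcal{B}(\boldsymbol{\mathcal{D}}_T,\mathcal{D}_{T^*})$ determined by $$\Theta_T(w)\boldsymbol{D}_T\tilde h=D_{T^*}\prod_{k=1}^n(I_{\mathcal{H}}-w_kT_k^* )^{-1}\sum_{j=1}^n(w_jI_{\mathcal{H}}-T_j)\prod_{i\in I_n\setminus\{j\}}(I_{\mathcal{H}}-w_iT_i^* )h_j$$ for $w\in\mathbb{D}^n$, $\tilde h=(h_1,\dots,h_n)^t\in\mathcal{H}^n$. *)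

theory Defs
  imports "HOL-Analysis.Analysis"
begin

section \<open>Complex Hilbert spaces\<close>

text \<open>
  The underlying real inner product (hence the norm and the topology) is the real part of the
  complex one. The complex inner product is linear in the first argument. Separability is not
  part of the class; it is the sort \<open>polish_space\<close>. Nothing excludes the zero space.
\<close>

class complex_hilbert = real_inner + complete_space +
  fixes scaleC :: "complex \<Rightarrow> 'a \<Rightarrow> 'a" (infixr "*\<^sub>C" 75)
    and cinner :: "'a \<Rightarrow> 'a \<Rightarrow> complex"
  assumes scaleC_add_right: "a *\<^sub>C (x + y) = a *\<^sub>C x + a *\<^sub>C y"
    and scaleC_add_left: "(a + b) *\<^sub>C x = a *\<^sub>C x + b *\<^sub>C x"
    and scaleC_scaleC: "a *\<^sub>C (b *\<^sub>C x) = (a * b) *\<^sub>C x"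
    and scaleR_scaleC: "r *\<^sub>R x = complex_of_real r *\<^sub>C x"
    and cinner_commute: "cinner x y = cnj (cinner y x)"
    and cinner_add_left: "cinner (x + y) z = cinner x z + cinner y z"
    and cinner_scaleC_left: "cinner (a *\<^sub>C x) y = a * cinner x y"
    and Re_cinner: "Re (cinner x y) = inner x y"

instance complex_hilbert \<subseteq> banach ..

instantiation prod :: (complex_hilbert, complex_hilbert) complex_hilbert
begin

definition scaleC_prod :: "complex \<Rightarrow> 'a \<times> 'b \<Rightarrow> 'a \<times> 'b"
  where "scaleC_prod a x = (a *\<^sub>C fst x, a *\<^sub>C snd x)"

definition cinner_prod :: "'a \<times> 'b \<Rightarrow> 'a \<times> 'b \<Rightarrow> complex"
  where "cinner_prod x y = cinner (fst x) (fst y) + cinner (snd x) (snd y)"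

instance
proof
  fix x y :: "'a \<times> 'b"
  show "cinner x y = cnj (cinner y x)"
    unfolding cinner_prod_def by (simp flip: cinner_commute)
qed (auto simp: scaleC_prod_def cinner_prod_def scaleC_add_right scaleC_add_left scaleC_scaleC
      scaleR_scaleC cinner_add_left cinner_scaleC_left Re_cinner inner_prod_def algebra_simps
      scaleR_prod_def)

end

instantiation vec :: (complex_hilbert, finite) complex_hilbert
begin

definition scaleC_vec :: "complex \<Rightarrow> 'a ^ 'b \<Rightarrow> 'a ^ 'b"
  where "scaleC_vec a x = (\<chi> i. a *\<^sub>C (x $ i))"

definition cinner_vec :: "'a ^ 'b \<Rightarrow> 'a ^ 'b \<Rightarrow> complex"
  where "cinner_vec x y = (\<Sum>i\<in>UNIV. cinner (x $ i) (y $ i))"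

instance
proof
  fix x y :: "'a ^ 'b"
  show "cinner x y = cnj (cinner y x)"
    unfolding cinner_vec_def by (simp flip: cinner_commute)
qed (auto simp: scaleC_vec_def cinner_vec_def scaleC_add_right scaleC_add_left scaleC_scaleC
      scaleR_scaleC cinner_add_left cinner_scaleC_left Re_cinner inner_vec_def vec_eq_iff
      sum.distrib sum_distrib_left)

end


section \<open>The sequence space\<close>

text \<open>
  Every separable complex Hilbert space is unitarily equivalent to a closed subspace of
  \<open>ell2\<close>, so quantifying existentially over separable Hilbert spaces amounts to
  quantifying over closed subspaces of \<open>ell2\<close>.
\<close>

typedef ell2 = "{f :: nat \<Rightarrow> complex. summable (\<lambda>n. (cmod (f n))\<^sup>2)}"
  morphisms ell2_nth Abs_ell2
  by (intro exI[of _ "\<lambda>_. 0"]) simp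

setup_lifting type_definition_ell2

lemma ell2_summable_add:
  fixes f g :: "nat \<Rightarrow> complex"
  assumes "summable (\<lambda>n. (cmod (f n))\<^sup>2)" "summable (\<lambda>n. (cmod (g n))\<^sup>2)"
  shows "summable (\<lambda>n. (cmod (f n + g n))\<^sup>2)"
proof (rule summable_comparison_test')
  show "summable (\<lambda>n. 2 * (cmod (f n))\<^sup>2 + 2 * (cmod (g n))\<^sup>2)"
    using assms by (intro summable_add summable_mult)
  show "norm ((cmod (f n + g n))\<^sup>2) \<le> 2 * (cmod (f n))\<^sup>2 + 2 * (cmod (g n))\<^sup>2" for n
  proof -
    have "(cmod (f n + g n))\<^sup>2 \<le> (cmod (f n) + cmod (g n))\<^sup>2"
      by (intro power_mono norm_triangle_ineq) auto
    also have "\<dots> \<le> 2 * (cmod (f n))\<^sup>2 + 2 * (cmod (g n))\<^sup>2"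
      using zero_le_power2[of "cmod (f n) - cmod (g n)"]
      by (simp add: power2_eq_square algebra_simps)
    finally show ?thesis by simp
  qed
qed

lemma ell2_summable_scale:
  fixes f :: "nat \<Rightarrow> complex"
  assumes "summable (\<lambda>n. (cmod (f n))\<^sup>2)"
  shows "summable (\<lambda>n. (cmod (a * f n))\<^sup>2)"
  using summable_mult[OF assms, of "(cmod a)\<^sup>2"] by (simp add: norm_mult power_mult_distrib)

lemma ell2_summable_cinner:
  fixes f g :: "nat \<Rightarrow> complex"
  assumes "summable (\<lambda>n. (cmod (f n))\<^sup>2)" "summable (\<lambda>n. (cmod (g n))\<^sup>2)"
  shows "summable (\<lambda>n. f n * cnj (g n))"
proof (rule summable_comparison_test')
  show "summable (\<lambda>n. (cmod (f n))\<^sup>2 + (cmod (g n))\<^sup>2)"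
    using assms by (intro summable_add)
  show "norm (f n * cnj (g n)) \<le> (cmod (f n))\<^sup>2 + (cmod (g n))\<^sup>2" for n
  proof -
    have "2 * (cmod (f n) * cmod (g n)) \<le> (cmod (f n))\<^sup>2 + (cmod (g n))\<^sup>2"
      using zero_le_power2[of "cmod (f n) - cmod (g n)"]
      by (simp add: power2_eq_square algebra_simps)
    moreover have "0 \<le> cmod (f n) * cmod (g n)" by simp
    ultimately show ?thesis unfolding norm_mult complex_mod_cnj by linarith
  qed
qed

instantiation ell2 :: real_inner
begin

lift_definition zero_ell2 :: ell2 is "\<lambda>_. 0" by simp
lift_definition plus_ell2 :: "ell2 \<Rightarrow> ell2 \<Rightarrow> ell2" is "\<lambda>f g n. f n + g n"
  by (rule ell2_summable_add)
lift_definition uminus_ell2 :: "ell2 \<Rightarrow> ell2" is "\<lambda>f n. - f n" by simp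
lift_definition minus_ell2 :: "ell2 \<Rightarrow> ell2 \<Rightarrow> ell2" is "\<lambda>f g n. f n - g n"
  subgoal for f g using ell2_summable_add[of f "\<lambda>n. - g n"] by simp
  done
lift_definition scaleR_ell2 :: "real \<Rightarrow> ell2 \<Rightarrow> ell2" is "\<lambda>r f n. complex_of_real r * f n"
  by (rule ell2_summable_scale)
definition inner_ell2 :: "ell2 \<Rightarrow> ell2 \<Rightarrow> real"
  where "inner_ell2 x y = Re (\<Sum>n. ell2_nth x n * cnj (ell2_nth y n))"
definition norm_ell2 :: "ell2 \<Rightarrow> real" where "norm_ell2 x = sqrt (inner x x)"
definition dist_ell2 :: "ell2 \<Rightarrow> ell2 \<Rightarrow> real" where "dist_ell2 x y = norm (x - y)"
definition sgn_ell2 :: "ell2 \<Rightarrow> ell2" where "sgn_ell2 x = inverse (norm x) *\<^sub>R x"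
definition uniformity_ell2 :: "(ell2 \<times> ell2) filter"
  where "uniformity_ell2 = (INF e\<in>{0 <..}. principal {(x, y). dist x y < e})"
definition open_ell2 :: "ell2 set \<Rightarrow> bool"
  where "open_ell2 U \<longleftrightarrow> (\<forall>x\<in>U. eventually (\<lambda>(x', y). x' = x \<longrightarrow> y \<in> U) uniformity)"

lemma summable_ell2: "summable (\<lambda>n. (cmod (ell2_nth x n))\<^sup>2)"
  using ell2_nth[of x] by simp

lemma summable_cinner_ell2: "summable (\<lambda>n. ell2_nth x n * cnj (ell2_nth y n))"
  by (intro ell2_summable_cinner summable_ell2)

lemma inner_ell2_same: "inner x x = (\<Sum>n. (cmod (ell2_nth x n))\<^sup>2)" for x :: ell2
proof -
  have "Re (a * cnj a) = (cmod a)\<^sup>2" for a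
    unfolding cmod_power2 by (simp add: power2_eq_square)
  moreover have "(\<lambda>n. Re (ell2_nth x n * cnj (ell2_nth x n))) sums Re (\<Sum>n. ell2_nth x n * cnj (ell2_nth x n))"
    by (intro sums_Re summable_sums summable_cinner_ell2)
  ultimately show ?thesis
    unfolding inner_ell2_def by (simp only: sums_iff)
qed

instance
proof
  fix x y z :: ell2 and r s :: real
  show "x + y + z = x + (y + z)" by transfer (simp add: add.assoc)
  show "x + y = y + x" by transfer (simp add: add.commute)
  show "0 + x = x" by transfer simp
  show "- x + x = 0" by transfer simp
  show "x - y = x + - y" by transfer simp
  show "r *\<^sub>R (x + y) = r *\<^sub>R x + r *\<^sub>R y" by transfer (simp add: distrib_left)
  show "(r + s) *\<^sub>R x = r *\<^sub>R x + s *\<^sub>R x" by transfer (simp add: distrib_right)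
  show "r *\<^sub>R s *\<^sub>R x = (r * s) *\<^sub>R x" by transfer (simp add: mult.assoc)
  show "1 *\<^sub>R x = x" by transfer simp
  show "dist x y = norm (x - y)" by (rule dist_ell2_def)
  show "sgn x = inverse (norm x) *\<^sub>R x" by (rule sgn_ell2_def)
  show "uniformity = (INF e\<in>{0 <..}. principal {(x::ell2, y). dist x y < e})"
    by (rule uniformity_ell2_def)
  show "open U \<longleftrightarrow> (\<forall>x\<in>U. eventually (\<lambda>(x', y). x' = x \<longrightarrow> y \<in> U) uniformity)" for U :: "ell2 set"
    by (rule open_ell2_def)
  show "inner x y = inner y x"
  proof -
    have "(\<Sum>n. ell2_nth x n * cnj (ell2_nth y n)) = cnj (\<Sum>n. ell2_nth y n * cnj (ell2_nth x n))"
      using sums_cnj[THEN iffD2, OF summable_sums[OF summable_cinner_ell2[of y x]]]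
      by (simp add: sums_iff mult.commute)
    then show ?thesis by (simp add: inner_ell2_def)
  qed
  show "inner (x + y) z = inner x z + inner y z"
    unfolding inner_ell2_def plus_ell2.rep_eq distrib_right
    by (simp add: suminf_add[symmetric] summable_cinner_ell2)
  show "inner (r *\<^sub>R x) y = r * inner x y"
    unfolding inner_ell2_def scaleR_ell2.rep_eq mult.assoc
    by (simp add: suminf_mult summable_cinner_ell2)
  show "0 \<le> inner x x"
    unfolding inner_ell2_same by (intro suminf_nonneg summable_ell2) auto
  show "inner x x = 0 \<longleftrightarrow> x = 0"
  proof -
    have "inner x x = 0 \<longleftrightarrow> (\<forall>n. ell2_nth x n = 0)"
      unfolding inner_ell2_same by (subst suminf_eq_zero_iff[OF summable_ell2]) auto
    also have "\<dots> \<longleftrightarrow> x = 0" by transfer auto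
    finally show ?thesis .
  qed
  show "norm x = sqrt (inner x x)" by (rule norm_ell2_def)
qed

end

lemma norm_ell2_sq: "(norm x)\<^sup>2 = (\<Sum>n. (cmod (ell2_nth x n))\<^sup>2)" for x :: ell2
  by (simp flip: inner_ell2_same power2_norm_eq_inner)

lemma sum_le_norm_ell2_sq: "(\<Sum>n<N. (cmod (ell2_nth x n))\<^sup>2) \<le> (norm x)\<^sup>2" for x :: ell2
  unfolding norm_ell2_sq by (intro sum_le_suminf summable_ell2) auto

lemma norm_ell2_nth_le: "cmod (ell2_nth x n) \<le> norm x" for x :: ell2
proof (rule power2_le_imp_le)
  have "(cmod (ell2_nth x n))\<^sup>2 \<le> (\<Sum>k<Suc n. (cmod (ell2_nth x k))\<^sup>2)"
    by (rule member_le_sum) auto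
  also have "\<dots> \<le> (norm x)\<^sup>2" by (rule sum_le_norm_ell2_sq)
  finally show "(cmod (ell2_nth x n))\<^sup>2 \<le> (norm x)\<^sup>2" .
qed simp

instance ell2 :: complete_space
proof
  fix X :: "nat \<Rightarrow> ell2" assume X: "Cauchy X"
  have "Cauchy (\<lambda>m. ell2_nth (X m) n)" for n
  proof (rule metric_CauchyI)
    fix e :: real assume "0 < e"
    then obtain M where M: "dist (X m) (X k) < e" if "m \<ge> M" "k \<ge> M" for m k
      using X unfolding Cauchy_def by blast
    show "\<exists>M. \<forall>m\<ge>M. \<forall>k\<ge>M. dist (ell2_nth (X m) n) (ell2_nth (X k) n) < e"
    proof (intro exI allI impI)
      fix m k assume mk: "m \<ge> M" "k \<ge> M"
      have "dist (ell2_nth (X m) n) (ell2_nth (X k) n) \<le> dist (X m) (X k)"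
        using norm_ell2_nth_le[of "X m - X k" n] by (simp add: dist_norm minus_ell2.rep_eq)
      with M[OF mk] show "dist (ell2_nth (X m) n) (ell2_nth (X k) n) < e" by simp
    qed
  qed
  then have "\<forall>n. \<exists>l. (\<lambda>m. ell2_nth (X m) n) \<longlonglongrightarrow> l"
    by (simp add: Cauchy_convergent_iff convergent_def)
  then obtain f where f: "\<And>n. (\<lambda>m. ell2_nth (X m) n) \<longlonglongrightarrow> f n" by metis
  have bound: "\<exists>M. \<forall>m\<ge>M. \<forall>N. (\<Sum>n<N. (cmod (ell2_nth (X m) n - f n))\<^sup>2) \<le> e\<^sup>2" if e: "0 < e" for e
  proof -
    obtain M where M: "dist (X m) (X k) < e" if "m \<ge> M" "k \<ge> M" for m k
      using X e unfolding Cauchy_def by blast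
    show ?thesis
    proof (intro exI allI impI)
      fix m N assume m: "m \<ge> M"
      show "(\<Sum>n<N. (cmod (ell2_nth (X m) n - f n))\<^sup>2) \<le> e\<^sup>2"
      proof (rule LIMSEQ_le_const2)
        show "(\<lambda>k. \<Sum>n<N. (cmod (ell2_nth (X m) n - ell2_nth (X k) n))\<^sup>2)
              \<longlonglongrightarrow> (\<Sum>n<N. (cmod (ell2_nth (X m) n - f n))\<^sup>2)"
          by (intro tendsto_intros f)
        show "\<exists>K. \<forall>k\<ge>K. (\<Sum>n<N. (cmod (ell2_nth (X m) n - ell2_nth (X k) n))\<^sup>2) \<le> e\<^sup>2"
        proof (intro exI allI impI)
          fix k assume k: "k \<ge> M"
          have "(\<Sum>n<N. (cmod (ell2_nth (X m) n - ell2_nth (X k) n))\<^sup>2) \<le> (dist (X m) (X k))\<^sup>2"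
            using sum_le_norm_ell2_sq[of "X m - X k" N] by (simp add: dist_norm minus_ell2.rep_eq)
          also have "\<dots> \<le> e\<^sup>2" using M[OF m k] by (intro power_mono) auto
          finally show "(\<Sum>n<N. (cmod (ell2_nth (X m) n - ell2_nth (X k) n))\<^sup>2) \<le> e\<^sup>2" .
        qed
      qed
    qed
  qed
  have summ: "summable (\<lambda>n. (cmod (ell2_nth (X m) n - f n))\<^sup>2)"
    if "\<And>N. (\<Sum>n<N. (cmod (ell2_nth (X m) n - f n))\<^sup>2) \<le> e\<^sup>2" for m e
    by (rule summableI_nonneg_bounded[OF _ that]) auto
  have "summable (\<lambda>n. (cmod (f n))\<^sup>2)"
  proof -
    obtain M where "\<And>N. (\<Sum>n<N. (cmod (ell2_nth (X M) n - f n))\<^sup>2) \<le> 1\<^sup>2"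
      using bound[of 1] by auto
    from summ[OF this] have "summable (\<lambda>n. (cmod (- (ell2_nth (X M) n - f n)))\<^sup>2)"
      by (simp only: norm_minus_cancel)
    from ell2_summable_add[OF summable_ell2[of "X M"] this] show ?thesis by simp
  qed
  then have L: "ell2_nth (Abs_ell2 f) = f" by (simp add: Abs_ell2_inverse)
  have "X \<longlonglongrightarrow> Abs_ell2 f"
  proof (rule metric_LIMSEQ_I)
    fix e :: real assume e: "0 < e"
    obtain M where M: "\<And>m N. m \<ge> M \<Longrightarrow> (\<Sum>n<N. (cmod (ell2_nth (X m) n - f n))\<^sup>2) \<le> (e / 2)\<^sup>2"
      using bound[of "e / 2"] e by auto
    show "\<exists>M. \<forall>m\<ge>M. dist (X m) (Abs_ell2 f) < e"
    proof (intro exI allI impI)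
      fix m assume m: "m \<ge> M"
      have "(norm (X m - Abs_ell2 f))\<^sup>2 \<le> (e / 2)\<^sup>2"
        unfolding norm_ell2_sq minus_ell2.rep_eq L
        by (intro suminf_le_const summ[OF M[OF m]] M[OF m])
      then have "norm (X m - Abs_ell2 f) \<le> e / 2"
        by (rule power2_le_imp_le) (use e in simp)
      with e show "dist (X m) (Abs_ell2 f) < e" by (simp add: dist_norm)
    qed
  qed
  then show "convergent X" by (rule convergentI)
qed

instantiation ell2 :: complex_hilbert
begin

lift_definition scaleC_ell2 :: "complex \<Rightarrow> ell2 \<Rightarrow> ell2" is "\<lambda>a f n. a * f n"
  by (rule ell2_summable_scale)

definition cinner_ell2 :: "ell2 \<Rightarrow> ell2 \<Rightarrow> complex"
  where "cinner_ell2 x y = (\<Sum>n. ell2_nth x n * cnj (ell2_nth y n))"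

instance
proof
  fix a b :: complex and r :: real and x y z :: ell2
  show "a *\<^sub>C (x + y) = a *\<^sub>C x + a *\<^sub>C y" by transfer (simp add: distrib_left)
  show "(a + b) *\<^sub>C x = a *\<^sub>C x + b *\<^sub>C x" by transfer (simp add: distrib_right)
  show "a *\<^sub>C (b *\<^sub>C x) = (a * b) *\<^sub>C x" by transfer (simp add: mult.assoc)
  show "r *\<^sub>R x = complex_of_real r *\<^sub>C x" by transfer simp
  show "cinner x y = cnj (cinner y x)"
    using sums_cnj[THEN iffD2, OF summable_sums[OF summable_cinner_ell2[of y x]]]
    by (simp add: cinner_ell2_def sums_iff mult.commute)
  show "cinner (x + y) z = cinner x z + cinner y z"
    unfolding cinner_ell2_def plus_ell2.rep_eq distrib_right
    by (simp add: suminf_add[symmetric] summable_cinner_ell2)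
  show "cinner (a *\<^sub>C x) y = a * cinner x y"
    unfolding cinner_ell2_def scaleC_ell2.rep_eq mult.assoc
    by (simp add: suminf_mult summable_cinner_ell2)
  show "Re (cinner x y) = inner x y" by (simp add: cinner_ell2_def inner_ell2_def)
qed

end

lemma ell2_dense:
  "\<exists>D :: ell2 set. countable D \<and> (\<forall>x. \<forall>e>0. \<exists>d\<in>D. dist d x < e)"
proof -
  obtain C :: "complex set" where C: "countable C" "\<And>X. open X \<Longrightarrow> X \<noteq> {} \<Longrightarrow> \<exists>d\<in>C. d \<in> X"
    using countable_dense_setE by blast
  define s where "s l = (\<lambda>n. if n < length l then l ! n else (0::complex))" for l
  have s: "ell2_nth (Abs_ell2 (s l)) = s l" for l
  proof -
    have "summable (\<lambda>n. (cmod (s l n))\<^sup>2)"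
      by (rule summable_finite[of "{..<length l}"]) (auto simp: s_def)
    then show ?thesis by (simp add: Abs_ell2_inverse)
  qed
  have "\<exists>d\<in>(\<lambda>l. Abs_ell2 (s l)) ` lists C. dist d x < e" if e: "0 < e" for x e
  proof -
    obtain N where N: "norm (\<Sum>n. (cmod (ell2_nth x (n + N)))\<^sup>2) < e\<^sup>2 / 2"
      using suminf_exist_split[OF _ summable_ell2[of x], of "e\<^sup>2 / 2"] e by (auto simp: Groups.add_ac)
    define r where "r = sqrt (e\<^sup>2 / (2 * (real N + 1)))"
    have r: "0 < r" "r\<^sup>2 = e\<^sup>2 / (2 * (real N + 1))" using e by (auto simp: r_def)
    have "\<exists>c\<in>C. dist (ell2_nth x n) c < r" for n
      using C(2)[of "ball (ell2_nth x n) r"] r by auto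
    then obtain c where c: "\<And>n. c n \<in> C" "\<And>n. dist (ell2_nth x n) (c n) < r" by metis
    define l where "l = map c [0..<N]"
    have l: "s l n = (if n < N then c n else 0)" for n by (simp add: s_def l_def)
    let ?g = "\<lambda>n. (cmod (ell2_nth (Abs_ell2 (s l) - x) n))\<^sup>2"
    have "(norm (Abs_ell2 (s l) - x))\<^sup>2 = (\<Sum>n. ?g (n + N)) + (\<Sum>n<N. ?g n)"
      unfolding norm_ell2_sq by (rule suminf_split_initial_segment[OF summable_ell2])
    also have "(\<Sum>n. ?g (n + N)) < e\<^sup>2 / 2"
      using N by (simp add: minus_ell2.rep_eq s l)
    also have "(\<Sum>n<N. ?g n) \<le> (\<Sum>n<N. r\<^sup>2)"
    proof (intro sum_mono)
      fix n assume "n \<in> {..<N}"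
      then have "?g n = (dist (ell2_nth x n) (c n))\<^sup>2"
        by (simp add: minus_ell2.rep_eq s l dist_norm norm_minus_commute)
      also have "\<dots> \<le> r\<^sup>2" using c(2)[of n] by (intro power_mono) auto
      finally show "?g n \<le> r\<^sup>2" .
    qed
    also have "(\<Sum>n<N. r\<^sup>2) \<le> e\<^sup>2 / 2"
      using e by (simp add: r(2) field_simps)
    finally have "(norm (Abs_ell2 (s l) - x))\<^sup>2 < e\<^sup>2" by simp
    then have "norm (Abs_ell2 (s l) - x) < e"
      using e by (auto intro: power2_less_imp_less)
    moreover have "l \<in> lists C" using c(1) by (auto simp: l_def)
    ultimately show ?thesis by (auto simp: dist_norm)
  qed
  moreover have "countable ((\<lambda>l. Abs_ell2 (s l)) ` lists C)"
    by (intro countable_image countable_lists C)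
  ultimately show ?thesis by blast
qed

instance ell2 :: polish_space
proof
  obtain D :: "ell2 set" where D: "countable D" "\<And>x e. e > 0 \<Longrightarrow> \<exists>d\<in>D. dist d x < e"
    using ell2_dense by blast
  let ?B = "(\<lambda>(d, k). ball d (1 / real (Suc k))) ` (D \<times> (UNIV :: nat set))"
  have "topological_basis ?B"
  proof (rule topological_basisI)
    fix U and x :: ell2 assume "open U" "x \<in> U"
    then obtain e where e: "0 < e" "ball x e \<subseteq> U" by (auto simp: open_contains_ball)
    obtain k where k: "1 / real (Suc k) < e / 2"
      using e(1) nat_approx_posE[of "e / 2"] by auto
    obtain d where d: "d \<in> D" "dist d x < 1 / real (Suc k)" using D(2)[of "1 / real (Suc k)" x] by auto
    have "ball d (1 / real (Suc k)) \<subseteq> ball x e"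
    proof
      fix y assume "y \<in> ball d (1 / real (Suc k))"
      then show "y \<in> ball x e"
        using dist_triangle[of x y d] d(2) k by (simp add: dist_commute)
    qed
    then show "\<exists>B'\<in>?B. x \<in> B' \<and> B' \<subseteq> U"
      using d e(2) by (intro bexI[of _ "ball d (1 / real (Suc k))"]) auto
  qed auto
  moreover have "countable ?B" by (intro countable_image countable_SIGMA D) auto
  ultimately show "\<exists>B :: ell2 set set. countable B \<and> open = generate_topology B"
    using topological_basis_imp_subbasis by blast
qed


section \<open>Operators between closed subspaces\<close>

text \<open>
  A Hilbert space sitting inside a larger one is given by its carrier, a closed complex subspace.
  Operators are functions on the ambient type; only their values on the domain carrier matter.
\<close>

definition hilbert_carrier :: "'a::complex_hilbert set \<Rightarrow> bool"
  where "hilbert_carrier H \<longleftrightarrow>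
    0 \<in> H \<and> (\<forall>x\<in>H. \<forall>y\<in>H. x + y \<in> H) \<and> (\<forall>c. \<forall>x\<in>H. c *\<^sub>C x \<in> H) \<and> closed H"

definition bounded_op ::
    "'a::complex_hilbert set \<Rightarrow> 'b::complex_hilbert set \<Rightarrow> ('a \<Rightarrow> 'b) \<Rightarrow> bool"
  where "bounded_op A B X \<longleftrightarrow>
    (\<forall>x\<in>A. X x \<in> B) \<and> (\<forall>x\<in>A. \<forall>y\<in>A. X (x + y) = X x + X y) \<and>
    (\<forall>c. \<forall>x\<in>A. X (c *\<^sub>C x) = c *\<^sub>C X x) \<and> (\<exists>K. \<forall>x\<in>A. norm (X x) \<le> K * norm x)"

definition contraction_op :: "'a::complex_hilbert set \<Rightarrow> ('a \<Rightarrow> 'a) \<Rightarrow> bool"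
  where "contraction_op H X \<longleftrightarrow> bounded_op H H X \<and> (\<forall>x\<in>H. norm (X x) \<le> norm x)"

text \<open>
  The adjoint of an operator with domain \<open>A\<close>: by the Riesz theorem, for \<open>X\<close> a bounded operator from
  \<open>A\<close> to \<open>B\<close>, it is determined on \<open>B\<close>.
\<close>

definition adj ::
    "'a::complex_hilbert set \<Rightarrow> ('a \<Rightarrow> 'b::complex_hilbert) \<Rightarrow> 'b \<Rightarrow> 'a"
  where "adj A X y = (THE x. x \<in> A \<and> (\<forall>u\<in>A. cinner (X u) y = cinner u x))"

definition unitary_op ::
    "'a::complex_hilbert set \<Rightarrow> 'b::complex_hilbert set \<Rightarrow> ('a \<Rightarrow> 'b) \<Rightarrow> bool"
  where "unitary_op A B U \<longleftrightarrow>
    bounded_op A B U \<and> (\<forall>x\<in>A. adj A U (U x) = x) \<and> (\<forall>y\<in>B. U (adj A U y) = y)"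

definition nonneg_op :: "'a::complex_hilbert set \<Rightarrow> ('a \<Rightarrow> 'a) \<Rightarrow> bool"
  where "nonneg_op H P \<longleftrightarrow> bounded_op H H P \<and> (\<forall>x\<in>H. cinner (P x) x \<in> \<real>\<^sub>\<ge>\<^sub>0)"

text \<open>The square root of a non-negative operator on \<open>H\<close>; its values on \<open>H\<close> are unique.\<close>

definition op_sqrt :: "'a::complex_hilbert set \<Rightarrow> ('a \<Rightarrow> 'a) \<Rightarrow> 'a \<Rightarrow> 'a"
  where "op_sqrt H P = (SOME R. nonneg_op H R \<and> (\<forall>x\<in>H. R (R x) = P x))"

definition defect :: "'a::complex_hilbert set \<Rightarrow> ('a \<Rightarrow> 'a) \<Rightarrow> 'a \<Rightarrow> 'a"
  where "defect H X = op_sqrt H (\<lambda>x. x - adj H X (X x))"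

definition C_dot_0 :: "'a::complex_hilbert set \<Rightarrow> ('a \<Rightarrow> 'a) \<Rightarrow> bool"
  where "C_dot_0 H X \<longleftrightarrow> (\<forall>x\<in>H. (\<lambda>m. ((adj H X) ^^ m) x) \<longlonglongrightarrow> 0)"

text \<open>
  Tuples are indexed by a nonempty finite linearly ordered type, in the role of
  \<open>{1, \<dots>, n}\<close>; the order fixes the order of composition in products of operators, which is
  immaterial for commuting factors.
\<close>

definition comp_prod :: "'n::linorder set \<Rightarrow> ('n \<Rightarrow> 'b \<Rightarrow> 'b) \<Rightarrow> 'b \<Rightarrow> 'b"
  where "comp_prod S A = foldr (\<lambda>k B. A k \<circ> B) (sorted_list_of_set S) id"


section \<open>Beurling tuples\<close>

definition szego_inv ::
    "'a::complex_hilbert set \<Rightarrow> ('n::{finite,linorder} \<Rightarrow> 'a \<Rightarrow> 'a) \<Rightarrow> 'a \<Rightarrow> 'a"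
  where "szego_inv H T x =
    (\<Sum>k | range k \<subseteq> {0, 1 :: nat}. (-1) ^ (\<Sum>i\<in>UNIV. k i) *\<^sub>R
       comp_prod UNIV (\<lambda>i. T i ^^ k i) (comp_prod UNIV (\<lambda>i. adj H (T i) ^^ k i) x))"

definition commuting_contractions ::
    "'a::complex_hilbert set \<Rightarrow> ('n::{finite,linorder} \<Rightarrow> 'a \<Rightarrow> 'a) \<Rightarrow> bool"
  where "commuting_contractions H T \<longleftrightarrow>
    (\<forall>i. contraction_op H (T i)) \<and> (\<forall>i j. \<forall>x\<in>H. T i (T j x) = T j (T i x))"

definition szego_tuple ::
    "'a::complex_hilbert set \<Rightarrow> ('n::{finite,linorder} \<Rightarrow> 'a \<Rightarrow> 'a) \<Rightarrow> bool"
  where "szego_tuple H T \<longleftrightarrow>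
    commuting_contractions H T \<and> nonneg_op H (szego_inv H T) \<and> (\<forall>i. C_dot_0 H (T i))"

definition beurling_tuple ::
    "'a::complex_hilbert set \<Rightarrow> ('n::{finite,linorder} \<Rightarrow> 'a \<Rightarrow> 'a) \<Rightarrow> bool"
  where "beurling_tuple H T \<longleftrightarrow>
    szego_tuple H T \<and> (\<forall>i j. i \<noteq> j \<longrightarrow> (\<forall>x\<in>H. defect H (T i) (defect H (T j) x) = 0))"


section \<open>Defect spaces and the characteristic function\<close>

definition defect_star ::
    "'a::complex_hilbert set \<Rightarrow> ('n::{finite,linorder} \<Rightarrow> 'a \<Rightarrow> 'a) \<Rightarrow> 'a \<Rightarrow> 'a"
  where "defect_star H T = op_sqrt H (szego_inv H T)"

definition defect_star_space ::
    "'a::complex_hilbert set \<Rightarrow> ('n::{finite,linorder} \<Rightarrow> 'a \<Rightarrow> 'a) \<Rightarrow> 'a set"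
  where "defect_star_space H T = closure (defect_star H T ` H)"

definition Delta :: "'a::complex_hilbert set \<Rightarrow> ('a \<Rightarrow> 'a) \<Rightarrow> ('a \<Rightarrow> 'a) \<Rightarrow> 'a \<Rightarrow> 'a"
  where "Delta H X A x = X (A (adj H X x))"

definition defect_diag_sq ::
    "'a::complex_hilbert set \<Rightarrow> ('n::{finite,linorder} \<Rightarrow> 'a \<Rightarrow> 'a) \<Rightarrow> 'n \<Rightarrow> 'a \<Rightarrow> 'a"
  where "defect_diag_sq H T j =
    comp_prod (UNIV - {j}) (\<lambda>k A x. A x - Delta H (T k) A x)
      (\<lambda>x. defect H (T j) (defect H (T j) x))"

definition defect_cross ::
    "'a::complex_hilbert set \<Rightarrow> ('n::{finite,linorder} \<Rightarrow> 'a \<Rightarrow> 'a) \<Rightarrow> 'n \<Rightarrow> 'n \<Rightarrow> 'a \<Rightarrow> 'a"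
  where "defect_cross H T i j =
    comp_prod (UNIV - {i, j}) (\<lambda>k A x. A x - Delta H (T k) A x)
      (\<lambda>x. T j (adj H (T i) x) - adj H (T i) (T j x))"

definition power_carrier :: "'a set \<Rightarrow> ('a ^ 'n) set"
  where "power_carrier H = {h. \<forall>i. h $ i \<in> H}"

definition big_defect_sq ::
    "'a::complex_hilbert set \<Rightarrow> ('n::{finite,linorder} \<Rightarrow> 'a \<Rightarrow> 'a) \<Rightarrow> ('a, 'n) vec \<Rightarrow> ('a, 'n) vec"
  where "big_defect_sq H T h =
    (\<chi> i. \<Sum>j\<in>UNIV. (if i = j then defect_diag_sq H T j else defect_cross H T i j) (h $ j))"

definition big_defect ::
    "'a::complex_hilbert set \<Rightarrow> ('n::{finite,linorder} \<Rightarrow> 'a \<Rightarrow> 'a) \<Rightarrow> ('a, 'n) vec \<Rightarrow> ('a, 'n) vec"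
  where "big_defect H T = op_sqrt (power_carrier H) (big_defect_sq H T)"

definition big_defect_space ::
    "'a::complex_hilbert set \<Rightarrow> ('n::{finite,linorder} \<Rightarrow> 'a \<Rightarrow> 'a) \<Rightarrow> ('a, 'n) vec set"
  where "big_defect_space H T = closure (big_defect H T ` power_carrier H)"

text \<open>
  For a Beurling tuple and \<open>w\<close> in the polydisc there is exactly one bounded operator (up to its
  values off the domain) with the property below: the range of \<open>big_defect H T\<close> is dense.
\<close>

definition char_fun ::
    "'a::complex_hilbert set \<Rightarrow> ('n::{finite,linorder} \<Rightarrow> 'a \<Rightarrow> 'a) \<Rightarrow> (complex, 'n) vec \<Rightarrow> ('a, 'n) vec \<Rightarrow> 'a"
  where "char_fun H T w =
    (SOME Q. bounded_op (big_defect_space H T) (defect_star_space H T) Q \<and>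
      (\<forall>h\<in>power_carrier H. Q (big_defect H T h) =
        defect_star H T
          (comp_prod UNIV (\<lambda>k. inv_into H (\<lambda>x. x - (w $ k) *\<^sub>C adj H (T k) x))
            (\<Sum>j\<in>UNIV. (\<lambda>x. (w $ j) *\<^sub>C x - T j x)
              (comp_prod (UNIV - {j}) (\<lambda>i x. x - (w $ i) *\<^sub>C adj H (T i) x) (h $ j))))))"


section \<open>Inner functions on the polydisc\<close>

definition polydisc :: "(complex ^ 'n) set"
  where "polydisc = {z. \<forall>i. cmod (z $ i) < 1}"

definition torus_measure :: "(complex ^ 'n) measure"
  where "torus_measure =
    distr (restrict_space lborel {t :: real ^ 'n. \<forall>i. 0 \<le> t $ i \<and> t $ i < 2 * pi}) borel
      (\<lambda>t. \<chi> i. cis (t $ i))"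

text \<open>
  The type \<open>'e \<Rightarrow>\<^sub>L 'f\<close> consists of real linear operators, so complex linearity is required
  explicitly. Analyticity is complex Frechet differentiability in the operator norm; the last
  conjunct says that the derivative \<open>D\<close> is complex linear.
\<close>

definition H_infty ::
    "(complex ^ 'n \<Rightarrow> 'e::complex_hilbert \<Rightarrow>\<^sub>L 'f::complex_hilbert) \<Rightarrow> bool"
  where "H_infty \<Theta> \<longleftrightarrow>
    (\<forall>z\<in>polydisc. bounded_op UNIV UNIV (blinfun_apply (\<Theta> z))) \<and>
    (\<exists>M. \<forall>z\<in>polydisc. norm (\<Theta> z) \<le> M) \<and>
    (\<forall>z\<in>polydisc. \<exists>D. (\<Theta> has_derivative D) (at z) \<and>
       (\<forall>c v x. blinfun_apply (D (c *s v)) x = c *\<^sub>C blinfun_apply (D v) x))"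

text \<open>
  Boundary values are radial limits in the strong operator topology; for \<open>H_infty \<Theta>\<close> between
  separable spaces they exist almost everywhere by Fatou's theorem.
\<close>

definition boundary_value ::
    "(complex ^ 'n \<Rightarrow> 'e::complex_hilbert \<Rightarrow>\<^sub>L 'f::complex_hilbert) \<Rightarrow> complex ^ 'n \<Rightarrow> 'e \<Rightarrow> 'f"
  where "boundary_value \<Theta> \<zeta> x = Lim (at_left 1) (\<lambda>r::real. blinfun_apply (\<Theta> (r *\<^sub>R \<zeta>)) x)"

definition inner_function ::
    "(complex ^ 'n \<Rightarrow> 'e::complex_hilbert \<Rightarrow>\<^sub>L 'f::complex_hilbert) \<Rightarrow> bool"
  where "inner_function \<Theta> \<longleftrightarrow> H_infty \<Theta> \<and>
    (AE \<zeta> in torus_measure.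
      (\<forall>x. \<exists>y. ((\<lambda>r::real. blinfun_apply (\<Theta> (r *\<^sub>R \<zeta>)) x) \<longlongrightarrow> y) (at_left 1)) \<and>
      (\<forall>x. adj UNIV (boundary_value \<Theta> \<zeta>) (boundary_value \<Theta> \<zeta> x) = x))"

end

theory Submission
  imports Defs "HOL-Complex_Analysis.Complex_Analysis"
begin

no_notation fps_nth (infixl \<open>$\<close> 75)

text \<open>
  Let \<open>M\<close> be multiplication by \<open>\<Theta>\<close> from the Hardy space of \<open>E\<close> to that of \<open>E\<^sub>*\<close>; it is an
  isometry because \<open>\<Theta>\<close> is inner, by Parseval's identity on tori of radius \<open>r\<close> and \<open>r \<rightarrow> 1\<close>. Let
  \<open>H\<close> be the orthogonal complement of its range and \<open>T\<^sub>i\<close> the compression of multiplication by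
  \<open>z\<^sub>i\<close> to \<open>H\<close>. With \<open>B\<^sub>j h = M\<^sup>* (z\<^sub>j h)\<close> one finds \<open>D\<^sup>2 = B\<^sub>j\<^sup>* B\<^sub>j\<close> for the defect operator of
  \<open>T\<^sub>j\<close>, \<open>[T\<^sub>j, T\<^sub>i\<^sup>*] = B\<^sub>i\<^sup>* B\<^sub>j\<close>, and \<open>B\<^sub>i B\<^sub>j\<^sup>* = 0\<close> on the functions independent of \<open>z\<^sub>j\<close>. Hence the
  joint defect operator squares to \<open>C\<^sup>* C\<close> with \<open>C h = \<Sum>\<^sub>j (B\<^sub>j h\<^sub>j)(0)\<close>, which identifies the
  joint defect space with the closure of the range of \<open>C\<close> in \<open>E\<close>; its complement \<open>F\<close> consists of the
  vectors \<open>e\<close> for which \<open>\<Theta>(z) e\<close> is constant. In the same way evaluation at \<open>0\<close> identifies the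
  other defect space with the complement of \<open>\<Theta> F\<close> in \<open>E\<^sub>*\<close>, and the formula that determines the
  characteristic function becomes \<open>\<Theta>(z) C h\<close>.
\<close>

section \<open>Complex Hilbert spaces\<close>

text \<open>Both Hardy spaces are cut out of one ambient space by projections, so \<open>M\<close>
  is only a partial isometry there and two projections stand for the two identity operators. Square
  roots and the characteristic function are given by arbitrary choices. They stay tractable because
  any square root of \<open>C\<^sup>* C\<close> has the Gram form of \<open>C\<close>, hence is
  unitarily equivalent to \<open>C\<close> between the closures of the ranges; no square root is
  ever computed. The summand \<open>F\<close> is forced: the tuple depends only on the range of
  \<open>M\<close>, and a block of constant values of \<Theta> leaves no trace in either defect
  space. The long products in the definitions collapse for two reasons. Double commutativity turns
  the products of \<open>I - \<Delta>\<close> into products of the commuting projections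
  \<open>I - Z\<^sub>i Z\<^sub>i\<^sup>*\<close>. Evaluation at \<open>z\<close> replaces
  \<open>Z\<^sub>i\<close> by \<open>z\<^sub>i\<close>, so under it the factors
  \<open>I - z\<^sub>i Z\<^sub>i\<^sup>*\<close> may be exchanged for the same projections, whose
  full product is the projection onto the constants.\<close>

lemma cinner_add_right: "cinner x (y + z) = cinner x y + cinner x z"
  by (metis cinner_add_left cinner_commute complex_cnj_add)

lemma cinner_scaleC_right: "cinner x (a *\<^sub>C y) = cnj a * cinner x y"
  by (metis cinner_commute cinner_scaleC_left complex_cnj_mult)

lemma scaleC_one [simp]: "1 *\<^sub>C x = x"
  by (metis of_real_1 scaleR_scaleC scaleR_one)

lemma cinner_scaleR_left: "cinner (r *\<^sub>R x) y = r *\<^sub>R cinner x y"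
  by (simp add: scaleR_scaleC cinner_scaleC_left scaleR_conv_of_real)

lemma cinner_scaleR_right: "cinner x (r *\<^sub>R y) = r *\<^sub>R cinner x y"
  by (simp add: scaleR_scaleC cinner_scaleC_right scaleR_conv_of_real)

lemma cinner_self: "cinner x x = complex_of_real ((norm x)\<^sup>2)"
proof -
  have "Im (cinner x x) = 0"
    using arg_cong[OF cinner_commute[of x x], of Im] by simp
  then show ?thesis
    by (simp add: complex_eq_iff Re_cinner power2_norm_eq_inner)
qed

lemma Re_cinner_self: "Re (cinner x x) = (norm x)\<^sup>2"
  by (simp add: cinner_self)

lemma cinner_cauchy_schwarz: "cmod (cinner x y) \<le> norm x * norm y"
proof (cases "cinner x y = 0")
  case False
  \<comment> \<open>A unimodular factor that turns the inner product into its modulus, so that the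
    real Cauchy-Schwarz inequality applies.\<close>
  define a where "a = cnj (cinner x y) / cmod (cinner x y)"
  have a: "cmod a = 1" using False by (simp add: a_def norm_divide)
  have nrm: "norm (a *\<^sub>C x) = norm x"
  proof -
    have "(norm (a *\<^sub>C x))\<^sup>2 = (norm x)\<^sup>2"
    proof -
      have "cinner (a *\<^sub>C x) (a *\<^sub>C x) = cinner x x"
        using a complex_norm_square[of a] by (simp add: cinner_scaleC_left cinner_scaleC_right mult.assoc[symmetric] mult.commute)
      then show ?thesis by (metis Re_cinner_self)
    qed
    then show ?thesis by simp
  qed
  have "cinner (a *\<^sub>C x) y = cmod (cinner x y)"
  proof -
    have "cinner (a *\<^sub>C x) y = cinner x y * cnj (cinner x y) / cmod (cinner x y)"
      unfolding cinner_scaleC_left a_def by (simp add: mult.commute)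
    also have "\<dots> = complex_of_real ((cmod (cinner x y))\<^sup>2) / complex_of_real (cmod (cinner x y))"
      by (simp only: complex_norm_square)
    also have "\<dots> = cmod (cinner x y)"
      using False by (simp add: power2_eq_square)
    finally show ?thesis .
  qed
  then have "cmod (cinner x y) = inner (a *\<^sub>C x) y"
    by (metis Re_complex_of_real Re_cinner)
  also have "\<dots> \<le> norm x * norm y"
    using norm_cauchy_schwarz[of "a *\<^sub>C x" y] nrm by simp
  finally show ?thesis .
qed simp

lemma mult_cnj_eq_norm: "z * cnj z = (complex_of_real (cmod z))\<^sup>2" "cnj z * z = (complex_of_real (cmod z))\<^sup>2"
  using complex_norm_square[of z] by (simp_all add: mult.commute)

lemma norm_scaleC: "norm (a *\<^sub>C x) = cmod a * norm x"
proof -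
  have "(norm (a *\<^sub>C x))\<^sup>2 = (cmod a * norm x)\<^sup>2"
  proof -
    have "cinner (a *\<^sub>C x) (a *\<^sub>C x) = of_real ((cmod a)\<^sup>2) * cinner x x"
      unfolding cinner_scaleC_left cinner_scaleC_right complex_norm_square by (simp only: mult_ac)
    then have "Re (cinner (a *\<^sub>C x) (a *\<^sub>C x)) = Re (of_real ((cmod a)\<^sup>2) * of_real ((norm x)\<^sup>2))"
      by (simp only: cinner_self)
    then show ?thesis by (simp only: Re_cinner_self flip: of_real_mult) (simp add: power_mult_distrib)
  qed
  then show ?thesis by simp
qed

text \<open>Conjugate linearity is linearity over the reals, so the theory of real bounded bilinear
  maps supplies limits, sums and continuity of complex inner products.\<close>

lemma bounded_bilinear_cinner: "bounded_bilinear cinner"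
proof
  show "\<exists>K. \<forall>a b. norm (cinner a b) \<le> norm a * norm b * K"
    by (intro exI[of _ 1]) (simp add: cinner_cauchy_schwarz)
qed (simp_all add: cinner_add_left cinner_add_right cinner_scaleR_left cinner_scaleR_right)

lemma bounded_bilinear_scaleC: "bounded_bilinear scaleC"
proof
  show "\<exists>K. \<forall>(a::complex) (b::'a). norm (a *\<^sub>C b) \<le> norm a * norm b * K"
    by (intro exI[of _ 1]) (simp add: norm_scaleC)
  show "(r *\<^sub>R a) *\<^sub>C b = r *\<^sub>R (a *\<^sub>C b)" for r a and b :: 'a
    by (simp add: scaleR_scaleC scaleC_scaleC scaleR_conv_of_real)
  show "a *\<^sub>C (r *\<^sub>R b) = r *\<^sub>R (a *\<^sub>C b)" for r a and b :: 'a
    by (simp add: scaleR_scaleC scaleC_scaleC mult.commute)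
qed (simp_all add: scaleC_add_left scaleC_add_right)

interpretation cinner: bounded_bilinear cinner by (rule bounded_bilinear_cinner)
interpretation scaleC: bounded_bilinear scaleC by (rule bounded_bilinear_scaleC)

lemmas cinner_diff_left = cinner.diff_left
lemmas cinner_diff_right = cinner.diff_right

lemma cinner_eq_0_norm: "cinner x x = 0 \<longleftrightarrow> x = 0"
  by (simp add: cinner_self)

lemma cinner_ext_left:
  assumes "\<And>u. cinner x u = cinner y u"
  shows "x = y"
  using assms[of "x - y"] cinner_eq_0_norm[of "x - y"] by (simp add: cinner_diff_left)

lemma scaleC_minus_one: "(-1) *\<^sub>C x = - x"
  using scaleC.minus_left[of 1 x] by simp

lemma norm_eqI_cinner: "cinner x x = cinner y y \<Longrightarrow> norm x = norm y"
  by (metis Re_cinner_self norm_ge_zero power2_eq_iff_nonneg)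

section \<open>Closed complex subspaces\<close>

lemma hilbert_carrierD:
  assumes "hilbert_carrier H"
  shows "0 \<in> H" "x \<in> H \<Longrightarrow> y \<in> H \<Longrightarrow> x + y \<in> H" "x \<in> H \<Longrightarrow> c *\<^sub>C x \<in> H" "closed H"
    "x \<in> H \<Longrightarrow> y \<in> H \<Longrightarrow> x - y \<in> H" "x \<in> H \<Longrightarrow> r *\<^sub>R x \<in> H" "x \<in> H \<Longrightarrow> - x \<in> H"
proof -
  show 0: "0 \<in> H" "x \<in> H \<Longrightarrow> y \<in> H \<Longrightarrow> x + y \<in> H" "x \<in> H \<Longrightarrow> c *\<^sub>C x \<in> H" "closed H" for x y c
    using assms unfolding hilbert_carrier_def by auto
  show "x \<in> H \<Longrightarrow> - x \<in> H" for x using 0(3)[of x "-1"] by (simp add: scaleC_minus_one)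
  then show "x \<in> H \<Longrightarrow> y \<in> H \<Longrightarrow> x - y \<in> H" using 0(2)[of x "- y"] by simp
  show "x \<in> H \<Longrightarrow> r *\<^sub>R x \<in> H" using 0(3) by (simp add: scaleR_scaleC)
qed

lemma hilbert_carrier_sum:
  assumes "hilbert_carrier H" "\<And>i. i \<in> I \<Longrightarrow> f i \<in> H"
  shows "sum f I \<in> H"
  using assms(2) by (induction I rule: infinite_finite_induct) (auto intro: hilbert_carrierD[OF assms(1)])

lemma hilbert_carrier_UNIV: "hilbert_carrier UNIV"
  by (simp add: hilbert_carrier_def)

lemma hilbert_carrier_closure:
  assumes "0 \<in> A" "\<And>x y. x \<in> A \<Longrightarrow> y \<in> A \<Longrightarrow> x + y \<in> A" "\<And>c x. x \<in> A \<Longrightarrow> c *\<^sub>C x \<in> A"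
  shows "hilbert_carrier (closure A)"
  unfolding hilbert_carrier_def
proof (intro conjI ballI allI)
  show "0 \<in> closure A" using assms(1) closure_subset by auto
  show "x + y \<in> closure A" if xy: "x \<in> closure A" "y \<in> closure A" for x y
  proof -
    obtain f g where "\<And>n. f n \<in> A" "f \<longlonglongrightarrow> x" "\<And>n. g n \<in> A" "g \<longlonglongrightarrow> y"
      using xy unfolding closure_sequential by blast
    then show ?thesis unfolding closure_sequential
      by (intro exI[of _ "\<lambda>n. f n + g n"]) (auto intro: assms tendsto_add)
  qed
  show "c *\<^sub>C x \<in> closure A" if x: "x \<in> closure A" for c x
  proof -
    obtain f where "\<And>n. f n \<in> A" "f \<longlonglongrightarrow> x"
      using x unfolding closure_sequential by blast
    then show ?thesis unfolding closure_sequential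
      by (intro exI[of _ "\<lambda>n. c *\<^sub>C f n"]) (auto intro: assms scaleC.tendsto)
  qed
qed auto

lemma hilbert_carrier_closure_image:
  assumes "hilbert_carrier H" "bounded_op H B X"
  shows "hilbert_carrier (closure (X ` H))"
proof (rule hilbert_carrier_closure)
  show "0 \<in> X ` H"
    using assms hilbert_carrierD(1)[OF assms(1)] unfolding bounded_op_def
    by (metis imageI scaleC.zero_left)
  show "x + y \<in> X ` H" if "x \<in> X ` H" "y \<in> X ` H" for x y
    using that assms hilbert_carrierD(2)[OF assms(1)] unfolding bounded_op_def
    by (smt (verit) imageE imageI)
  show "c *\<^sub>C x \<in> X ` H" if "x \<in> X ` H" for c x
    using that assms hilbert_carrierD(3)[OF assms(1)] unfolding bounded_op_def
    by (smt (verit) imageE imageI)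
qed

lemma hilbert_carrier_power: "hilbert_carrier H \<Longrightarrow> hilbert_carrier (power_carrier H :: ('a::complex_hilbert ^ 'n::finite) set)"
proof -
  assume H: "hilbert_carrier H"
  have "power_carrier H = (\<Inter>i. (\<lambda>h :: 'a ^ 'n. h $ i) -` H)"
    unfolding power_carrier_def by auto
  moreover have "closed (\<Inter>i. (\<lambda>h :: 'a ^ 'n. h $ i) -` H)"
    by (intro closed_INT ballI closed_vimage hilbert_carrierD(4)[OF H] continuous_intros)
  ultimately have "closed (power_carrier H :: ('a ^ 'n) set)" by simp
  then show ?thesis
    using hilbert_carrierD[OF H] unfolding hilbert_carrier_def
    by (auto simp: power_carrier_def scaleC_vec_def)
qed

section \<open>Orthogonal projection and the Riesz theorem\<close>

lemma projection_exists:
  assumes S: "hilbert_carrier (S :: 'a::complex_hilbert set)"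
  obtains p where "p \<in> S" "\<And>s. s \<in> S \<Longrightarrow> cinner (x - p) s = 0"
proof -
  define d where "d = infdist x S"
  have ne: "S \<noteq> {}" using hilbert_carrierD(1)[OF S] by auto
  have "\<exists>s\<in>S. dist x s < d + 1 / real (Suc n)" for n
  proof -
    have "infdist x S < d + 1 / real (Suc n)" by (simp add: d_def)
    then show ?thesis
      unfolding infdist_def using ne by (auto simp: cINF_less_iff)
  qed
  then obtain s where s: "\<And>n. s n \<in> S" "\<And>n. dist x (s n) < d + 1 / real (Suc n)" by metis
  have d0: "0 \<le> d" by (simp add: d_def infdist_nonneg)
  have dle: "d \<le> dist x y" if "y \<in> S" for y using that by (simp add: d_def infdist_le)
  \<comment> \<open>The parallelogram law. The midpoint of two points of \<open>S\<close> lies in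
    \<open>S\<close> and is at distance at least \<open>d\<close> from \<open>x\<close>, so two near
    minimisers are close to each other.\<close>
  have par: "(norm (u - v))\<^sup>2 = 2 * (norm u)\<^sup>2 + 2 * (norm v)\<^sup>2 - (norm (u + v))\<^sup>2" for u v :: 'a
    by (simp add: power2_norm_eq_inner inner_add_left inner_add_right inner_diff_left inner_diff_right inner_commute)
  have lim: "(\<lambda>n. 4 * (d + 1 / real (Suc n))\<^sup>2 - 4 * d\<^sup>2) \<longlonglongrightarrow> 4 * (d + 0)\<^sup>2 - 4 * d\<^sup>2"
    by (intro tendsto_intros LIMSEQ_Suc lim_1_over_n)
  have "Cauchy s"
  proof (rule metric_CauchyI)
    fix e :: real assume e: "0 < e"
    have "\<forall>\<^sub>F n in sequentially. 4 * (d + 1 / real (Suc n))\<^sup>2 - 4 * d\<^sup>2 < e\<^sup>2"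
      using order_tendstoD(2)[OF lim, of "e\<^sup>2"] e by simp
    then obtain N where N: "4 * (d + 1 / real (Suc N))\<^sup>2 - 4 * d\<^sup>2 < e\<^sup>2"
      by (auto simp: eventually_sequentially)
    show "\<exists>M. \<forall>m\<ge>M. \<forall>n\<ge>M. dist (s m) (s n) < e"
    proof (intro exI allI impI)
      fix m n assume mn: "N \<le> m" "N \<le> n"
      let ?b = "d + 1 / real (Suc N)"
      have b: "norm (x - s k) \<le> ?b" if "N \<le> k" for k
      proof -
        have "1 / real (Suc k) \<le> 1 / real (Suc N)" using that by (simp add: field_simps)
        then show ?thesis using s(2)[of k] by (simp add: dist_norm)
      qed
      have mid: "(1/2) *\<^sub>R (s m + s n) \<in> S"
        using s(1) by (intro hilbert_carrierD[OF S])
      have "x - s m + (x - s n) = 2 *\<^sub>R (x - (1/2) *\<^sub>R (s m + s n))"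
        by (simp add: algebra_simps scaleR_2)
      then have "2 * d \<le> norm (x - s m + (x - s n))"
        using dle[OF mid] by (simp add: dist_norm)
      then have "(2 * d)\<^sup>2 \<le> (norm (x - s m + (x - s n)))\<^sup>2"
        using d0 by (intro power_mono) auto
      moreover have "(norm (x - s m))\<^sup>2 \<le> ?b\<^sup>2" "(norm (x - s n))\<^sup>2 \<le> ?b\<^sup>2"
        using b mn by (auto intro!: power_mono)
      ultimately have "(norm (s n - s m))\<^sup>2 \<le> 4 * ?b\<^sup>2 - 4 * d\<^sup>2"
        using par[of "x - s m" "x - s n"] by (simp add: power_mult_distrib)
      also have "\<dots> < e\<^sup>2" by (rule N)
      finally have "norm (s n - s m) < e" using e by (auto intro: power2_less_imp_less)
      then show "dist (s m) (s n) < e" by (simp add: dist_norm norm_minus_commute)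
    qed
  qed
  then obtain p where p: "s \<longlonglongrightarrow> p" by (auto simp: Cauchy_convergent_iff convergent_def)
  have pS: "p \<in> S" using closed_sequentially[OF hilbert_carrierD(4)[OF S] _ p] s(1) by blast
  have "norm (x - p) \<le> d"
  proof -
    have "(\<lambda>n. d + 1 / real (Suc n)) \<longlonglongrightarrow> d + 0"
      by (intro tendsto_intros LIMSEQ_Suc lim_1_over_n)
    moreover have "(\<lambda>n. dist x (s n)) \<longlonglongrightarrow> dist x p" by (intro tendsto_intros p)
    ultimately show ?thesis
      using LIMSEQ_le[of "\<lambda>n. dist x (s n)" "dist x p" "\<lambda>n. d + 1 / real (Suc n)" "d + 0"] s(2)
      by (simp add: dist_norm less_imp_le)
  qed
  then have min: "norm (x - p) \<le> norm (x - y)" if "y \<in> S" for y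
    using dle[OF that] by (simp add: dist_norm)
  have "cinner (x - p) y = 0" if y: "y \<in> S" for y
  proof (rule ccontr)
    assume nz: "cinner (x - p) y \<noteq> 0"
    then have y0: "0 < (norm y)\<^sup>2" by (auto simp: cinner.zero_right)
    \<comment> \<open>The component of \<open>x - p\<close> along \<open>y\<close>; adding it to
      \<open>p\<close> would lower the squared distance by |<x - p, y>|^2 / |y|^2.\<close>
    define c where "c = cinner (x - p) y / of_real ((norm y)\<^sup>2)"
    have "p + c *\<^sub>C y \<in> S" using pS y by (intro hilbert_carrierD[OF S])
    then have le: "(norm (x - p))\<^sup>2 \<le> (norm (x - (p + c *\<^sub>C y)))\<^sup>2" by (intro power_mono min) auto
    have "cinner (x - (p + c *\<^sub>C y)) (x - (p + c *\<^sub>C y)) =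
      cinner (x - p) (x - p) - c * cinner y (x - p) - cnj c * cinner (x - p) y + c * cnj c * cinner y y"
      by (simp add: cinner_diff_left cinner_diff_right cinner_add_left cinner_add_right
          cinner_scaleC_left cinner_scaleC_right algebra_simps)
    moreover have "c * cinner y (x - p) = of_real ((cmod (cinner (x - p) y))\<^sup>2 / (norm y)\<^sup>2)"
      unfolding c_def by (subst cinner_commute[of y]) (simp add: mult_cnj_eq_norm)
    moreover have "cnj c * cinner (x - p) y = of_real ((cmod (cinner (x - p) y))\<^sup>2 / (norm y)\<^sup>2)"
      unfolding c_def by (simp add: mult_cnj_eq_norm)
    moreover have "c * cnj c * cinner y y = of_real ((cmod (cinner (x - p) y))\<^sup>2 / (norm y)\<^sup>2)"
    proof -
      have "c * cnj c * cinner y y = of_real ((cmod c)\<^sup>2 * (norm y)\<^sup>2)"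
        by (simp add: cinner_self complex_norm_square[symmetric])
      also have "(cmod c)\<^sup>2 * (norm y)\<^sup>2 = (cmod (cinner (x - p) y))\<^sup>2 / (norm y)\<^sup>2"
        using y0 by (simp add: c_def norm_divide norm_power power_divide power2_eq_square norm_mult)
      finally show ?thesis .
    qed
    ultimately have "cinner (x - (p + c *\<^sub>C y)) (x - (p + c *\<^sub>C y)) =
      cinner (x - p) (x - p) - of_real ((cmod (cinner (x - p) y))\<^sup>2 / (norm y)\<^sup>2)" by simp
    then have "(norm (x - (p + c *\<^sub>C y)))\<^sup>2 = (norm (x - p))\<^sup>2 - (cmod (cinner (x - p) y))\<^sup>2 / (norm y)\<^sup>2"
      unfolding cinner_self by (metis of_real_diff of_real_eq_iff)
    with le y0 nz show False by (simp add: divide_le_0_iff)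
  qed
  with pS show ?thesis by (rule that)
qed

lemma riesz:
  fixes \<phi> :: "'a::complex_hilbert \<Rightarrow> complex"
  assumes add: "\<And>x y. \<phi> (x + y) = \<phi> x + \<phi> y"
    and scale: "\<And>c x. \<phi> (c *\<^sub>C x) = c * \<phi> x"
    and bound: "\<And>x. cmod (\<phi> x) \<le> K * norm x"
  obtains y where "\<And>x. \<phi> x = cinner x y"
proof (cases "\<forall>x. \<phi> x = 0")
  case True
  then show ?thesis by (intro that[of 0]) (simp add: cinner.zero_right)
next
  case False
  then obtain x0 where x0: "\<phi> x0 \<noteq> 0" by blast
  have "bounded_linear \<phi>"
    by (rule bounded_linear_intro[of _ K])
      (simp_all add: add scaleR_scaleC scale scaleR_conv_of_real mult.commute[of _ K] bound)
  then have cont: "continuous_on UNIV \<phi>" by (rule linear_continuous_on)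
  have N: "hilbert_carrier (\<phi> -` {0})"
    unfolding hilbert_carrier_def
    using continuous_closed_vimage[of "{0}" \<phi>] cont scale[of 0 0]
    by (auto simp: add scale continuous_on_eq_continuous_at scaleC.zero_left)
  obtain p where p: "p \<in> \<phi> -` {0}" "\<And>s. s \<in> \<phi> -` {0} \<Longrightarrow> cinner (x0 - p) s = 0"
    using projection_exists[OF N, of x0] by blast
  \<comment> \<open>\<open>w\<close> spans the complement of the kernel: every \<open>x\<close> is a
    multiple of \<open>w\<close> plus a vector on which \<phi> vanishes.\<close>
  define w where "w = x0 - p"
  have diff: "\<phi> (x - y) = \<phi> x - \<phi> y" for x y
    using add[of "x - y" y] by simp
  have w: "\<phi> w \<noteq> 0" using x0 p(1) by (simp add: w_def diff)
  then have w0: "w \<noteq> 0" using scale[of 0 0] by (auto simp: scaleC.zero_left)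
  define a where "a = \<phi> w / of_real ((norm w)\<^sup>2)"
  show ?thesis
  proof (rule that[of "cnj a *\<^sub>C w"])
    fix x
    have "x - (\<phi> x / \<phi> w) *\<^sub>C w \<in> \<phi> -` {0}" using w by (simp add: diff scale)
    then have "cinner w (x - (\<phi> x / \<phi> w) *\<^sub>C w) = 0" using p(2) by (simp add: w_def)
    then have "cinner (x - (\<phi> x / \<phi> w) *\<^sub>C w) w = 0"
      by (subst cinner_commute) simp
    then have "cinner x w = \<phi> x / \<phi> w * of_real ((norm w)\<^sup>2)"
      by (simp add: cinner_diff_left cinner_scaleC_left cinner_self)
    then show "\<phi> x = cinner x (cnj a *\<^sub>C w)"
      using w w0 by (simp add: cinner_scaleC_right a_def)
  qed
qed

text \<open>\<open>adj\<close> is a definite description. A candidate in \<open>A\<close> that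
  satisfies the defining identity settles existence and uniqueness together, which is how the
  explicit adjoints below are computed.\<close>

lemma adj_eqI:
  assumes "hilbert_carrier A" "x \<in> A" "\<And>u. u \<in> A \<Longrightarrow> cinner (X u) y = cinner u x"
  shows "adj A X y = x"
  unfolding adj_def
proof (rule the_equality)
  show "x \<in> A \<and> (\<forall>u\<in>A. cinner (X u) y = cinner u x)" using assms by blast
  fix x' assume x': "x' \<in> A \<and> (\<forall>u\<in>A. cinner (X u) y = cinner u x')"
  have "x' - x \<in> A" using x' assms hilbert_carrierD(5) by blast
  then have "cinner (x' - x) (x' - x) = 0"
    using assms(3) x' by (simp add: cinner_diff_right)
  then show "x' = x" by (simp add: cinner_eq_0_norm)
qed

text \<open>Serves the boundary values of the inner function: they are limits, so no explicit
  candidate for the adjoint is at hand and the Riesz theorem has to provide it.\<close>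

lemma adj_existing:
  fixes X :: "'a::complex_hilbert \<Rightarrow> 'b::complex_hilbert"
  assumes "bounded_op UNIV UNIV X"
  shows "cinner (X u) y = cinner u (adj UNIV X y)"
proof -
  obtain K where K: "\<And>x. norm (X x) \<le> K * norm x" using assms unfolding bounded_op_def by blast
  obtain z where z: "\<And>x. cinner (X x) y = cinner x z"
  proof (rule riesz[of "\<lambda>x. cinner (X x) y" "K * norm y"])
    show "cmod (cinner (X x) y) \<le> K * norm y * norm x" for x
    proof -
      have "cmod (cinner (X x) y) \<le> norm (X x) * norm y" by (rule cinner_cauchy_schwarz)
      also have "\<dots> \<le> (K * norm x) * norm y" by (intro mult_right_mono K) auto
      finally show ?thesis by (simp add: algebra_simps)
    qed
  qed (use assms in \<open>auto simp: bounded_op_def cinner_add_left cinner_scaleC_left\<close>)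
  have "adj UNIV X y = z" by (rule adj_eqI) (auto simp: z hilbert_carrier_UNIV)
  with z show ?thesis by simp
qed

lemma bounded_opD:
  assumes "bounded_op A B X"
  shows "x \<in> A \<Longrightarrow> X x \<in> B" "x \<in> A \<Longrightarrow> y \<in> A \<Longrightarrow> X (x + y) = X x + X y"
    "x \<in> A \<Longrightarrow> X (c *\<^sub>C x) = c *\<^sub>C X x"
  using assms unfolding bounded_op_def by auto

lemma bounded_op_diff:
  assumes "bounded_op A B X" "hilbert_carrier A" "x \<in> A" "y \<in> A"
  shows "X (x - y) = X x - X y"
  using bounded_opD(2)[OF assms(1) hilbert_carrierD(5)[OF assms(2-4)] assms(4)] by simp

lemma bounded_op_bound:
  assumes "bounded_op A B X"
  obtains K where "K > 0" "\<And>x. x \<in> A \<Longrightarrow> norm (X x) \<le> K * norm x"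
proof -
  obtain K where K: "\<And>x. x \<in> A \<Longrightarrow> norm (X x) \<le> K * norm x" using assms unfolding bounded_op_def by blast
  show ?thesis
  proof (rule that[of "max K 1"])
    fix x assume "x \<in> A"
    from K[OF this] show "norm (X x) \<le> max K 1 * norm x"
      by (rule order_trans) (intro mult_right_mono; simp)
  qed simp
qed

lemma bounded_op_tendsto:
  assumes X: "bounded_op A B X" "hilbert_carrier A"
    and f: "\<And>n. f n \<in> A" "f \<longlonglongrightarrow> x" "x \<in> A"
  shows "(\<lambda>n. X (f n)) \<longlonglongrightarrow> X x"
proof -
  obtain K where K: "K > 0" "\<And>x. x \<in> A \<Longrightarrow> norm (X x) \<le> K * norm x"
    by (rule bounded_op_bound[OF X(1)]) blast
  have le: "norm (X (f n) - X x) \<le> K * norm (f n - x)" for n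
    using K(2)[OF hilbert_carrierD(5)[OF X(2) f(1)[of n] f(3)]] bounded_op_diff[OF X f(1)[of n] f(3)] by simp
  have "(\<lambda>n. K * norm (f n - x)) \<longlonglongrightarrow> K * 0"
    using f(2) by (intro tendsto_mult tendsto_const tendsto_norm_zero LIM_zero)
  then have "(\<lambda>n. K * norm (f n - x)) \<longlonglongrightarrow> 0" by simp
  then have "(\<lambda>n. X (f n) - X x) \<longlonglongrightarrow> 0"
    by (rule Lim_null_comparison[rotated]) (simp add: le)
  then show ?thesis by (rule LIM_zero_cancel)
qed

text \<open>Polarisation of a real-valued quadratic form: its values at \<open>x + y\<close> give
  the sum of the two identities for (x, y) and (y, x), those at x + i y give their
  difference.\<close>

lemma nonneg_op_symmetric:
  assumes R: "nonneg_op H R" "hilbert_carrier H" and "x \<in> H" "y \<in> H"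
  shows "cinner (R x) y = cinner x (R y)"
proof -
  have B: "bounded_op H H R" using R(1) by (simp add: nonneg_op_def)
  have real: "cinner (R u) u = cinner u (R u)" if "u \<in> H" for u
  proof -
    have "cinner (R u) u \<in> \<real>\<^sub>\<ge>\<^sub>0" using R(1) that by (simp add: nonneg_op_def)
    then have "cnj (cinner (R u) u) = cinner (R u) u"
      by (metis nonneg_Reals_subset_Reals subsetD Reals_cnj_iff)
    then show ?thesis by (metis cinner_commute)
  qed
  have key: "cinner (R a) b + cinner (R b) a = cinner a (R b) + cinner b (R a)"
    if "a \<in> H" "b \<in> H" for a b
  proof -
    have "cinner (R a + R b) (a + b) = cinner (a + b) (R a + R b)"
      using real[OF hilbert_carrierD(2)[OF R(2) that]] bounded_opD(2)[OF B that] by simp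
    moreover have "u + v + (w + z) = u + v' + (w' + z) \<Longrightarrow> w + v = v' + w'" for u v w z v' w' :: complex
      by (simp add: algebra_simps)
    ultimately show ?thesis
      using real[OF that(1)] real[OF that(2)] unfolding cinner_add_left cinner_add_right
      by (metis (no_types) add.commute)
  qed
  have iy: "\<i> *\<^sub>C y \<in> H" using hilbert_carrierD(3)[OF R(2)] assms(4) by blast
  note 1 = key[OF assms(3,4)]
  have "cinner (R x) (\<i> *\<^sub>C y) + cinner (R (\<i> *\<^sub>C y)) x = cinner x (R (\<i> *\<^sub>C y)) + cinner (\<i> *\<^sub>C y) (R x)"
    by (rule key[OF assms(3) iy])
  then have 2: "\<i> * (cinner (R y) x - cinner (R x) y) = \<i> * (cinner y (R x) - cinner x (R y))"
    unfolding bounded_opD(3)[OF B assms(4)] by (simp add: cinner_scaleC_left cinner_scaleC_right algebra_simps)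
  then have 2: "cinner (R y) x - cinner (R x) y = cinner y (R x) - cinner x (R y)" by simp
  have "cinner (R x) y + cinner (R y) x - (cinner (R y) x - cinner (R x) y) =
    cinner x (R y) + cinner y (R x) - (cinner y (R x) - cinner x (R y))" using 1 2 by simp
  then show ?thesis by simp
qed


section \<open>Square roots of Gram operators\<close>

lemma carrier_ext:
  assumes "hilbert_carrier H" "u \<in> H" "v \<in> H" "\<And>y. y \<in> H \<Longrightarrow> cinner u y = cinner v y"
  shows "u = v"
  using assms(4)[OF hilbert_carrierD(5)[OF assms(1-3)]] cinner_eq_0_norm[of "u - v"]
  by (simp add: cinner_diff_left)

text \<open>
  The square root of \<open>I - X\<close> with \<open>\<parallel>X\<parallel> \<le> 1\<close> is \<open>I - Y\<close>, where \<open>Y\<close> is the limit of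
  \<open>Y\<^sub>0 = 0\<close>, \<open>Y\<^sub>n\<^sub>+\<^sub>1 = (X + Y\<^sub>n\<^sup>2) / 2\<close>; the increments are dominated by those of the scalar
  iteration for \<open>X = 1\<close>.
\<close>

lemma sqrt_one_minus_contraction:
  assumes H: "hilbert_carrier H"
    and XH: "\<And>x. x \<in> H \<Longrightarrow> X x \<in> H"
    and Xadd: "\<And>x y. x \<in> H \<Longrightarrow> y \<in> H \<Longrightarrow> X (x + y) = X x + X y"
    and Xscale: "\<And>c x. x \<in> H \<Longrightarrow> X (c *\<^sub>C x) = c *\<^sub>C X x"
    and Xsym: "\<And>x y. x \<in> H \<Longrightarrow> y \<in> H \<Longrightarrow> cinner (X x) y = cinner x (X y)"
    and Xnorm: "\<And>x. x \<in> H \<Longrightarrow> norm (X x) \<le> norm x"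
  obtains Y where "bounded_op H H Y" "\<And>x. x \<in> H \<Longrightarrow> norm (Y x) \<le> norm x"
    "\<And>x. x \<in> H \<Longrightarrow> Y x = (1/2) *\<^sub>R (X x + Y (Y x))"
    "\<And>x y. x \<in> H \<Longrightarrow> y \<in> H \<Longrightarrow> cinner (Y x) y = cinner x (Y y)"
proof -
  note HD = hilbert_carrierD[OF H]
  define Y where "Y n = ((\<lambda>G x. (1/2) *\<^sub>R (X x + G (G x))) ^^ n) (\<lambda>_. 0)" for n
  define y where "y n = ((\<lambda>t::real. (1 + t\<^sup>2) / 2) ^^ n) 0" for n
  have Y0: "Y 0 x = 0" for x by (simp add: Y_def)
  have YS: "Y (Suc n) x = (1/2) *\<^sub>R (X x + Y n (Y n x))" for n x by (simp add: Y_def)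
  have y0: "y 0 = 0" and yS: "y (Suc n) = (1 + (y n)\<^sup>2) / 2" for n by (simp_all add: y_def)
  have ypos: "0 \<le> y n" for n by (induction n) (simp_all add: y0 yS)
  have yle: "y n \<le> 1" for n
  proof (induction n)
    case (Suc n)
    then have "(y n)\<^sup>2 \<le> 1" using ypos[of n] by (simp add: power_le_one)
    then show ?case by (simp add: yS)
  qed (simp add: y0)
  have YH: "x \<in> H \<Longrightarrow> Y n x \<in> H" for n x
    by (induction n arbitrary: x) (simp_all add: Y0 YS HD XH)
  have Yadd: "x \<in> H \<Longrightarrow> z \<in> H \<Longrightarrow> Y n (x + z) = Y n x + Y n z" for n x z
    by (induction n arbitrary: x z) (simp_all add: Y0 YS YH Xadd HD algebra_simps)
  have Yscale: "x \<in> H \<Longrightarrow> Y n (c *\<^sub>C x) = c *\<^sub>C Y n x" for n x c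
    by (induction n arbitrary: x)
      (simp_all add: Y0 YS YH Xscale scaleC.zero_right scaleC_add_right scaleC.scaleR_right)
  have Ydiff: "Y n (x - z) = Y n x - Y n z" if "x \<in> H" "z \<in> H" for n x z
    using Yadd[OF HD(5)[OF that] that(2), of n] by simp
  have Ysym: "x \<in> H \<Longrightarrow> z \<in> H \<Longrightarrow> cinner (Y n x) z = cinner x (Y n z)" for n x z
    by (induction n arbitrary: x z)
      (simp_all add: Y0 YS YH Xsym cinner_add_left cinner_add_right cinner_scaleR_left cinner_scaleR_right
        cinner.zero_left cinner.zero_right)
  have Ynorm: "x \<in> H \<Longrightarrow> norm (Y n x) \<le> y n * norm x" for n x
  proof (induction n arbitrary: x)
    case (Suc n)
    have "norm (Y (Suc n) x) \<le> (1/2) * (norm (X x) + norm (Y n (Y n x)))"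
      unfolding YS norm_scaleR by (simp add: norm_triangle_ineq)
    also have "norm (Y n (Y n x)) \<le> y n * (y n * norm x)"
      by (rule order_trans[OF Suc.IH[OF YH[OF Suc.prems]]]) (intro mult_left_mono Suc ypos)
    finally show ?case using Xnorm[OF Suc.prems] by (simp add: yS power2_eq_square algebra_simps)
  qed (simp add: Y0 y0)
  \<comment> \<open>Whatever commutes with \<open>X\<close> commutes with every iterate. Taking
    \<open>X\<close> and then \<open>Y m\<close> for \<open>B\<close> makes the iterates commute
    with each other, so that the difference of two squares factors in the estimate of the
    increments.\<close>
  have comm: "B (Y n x) = Y n (B x)"
    if x: "x \<in> H" and B: "\<And>x. x \<in> H \<Longrightarrow> B x \<in> H" "\<And>x y. x \<in> H \<Longrightarrow> y \<in> H \<Longrightarrow> B (x + y) = B x + B y"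
      "\<And>c x. x \<in> H \<Longrightarrow> B (c *\<^sub>C x) = c *\<^sub>C B x" "\<And>x. x \<in> H \<Longrightarrow> B (X x) = X (B x)" for B n x
    using x
  proof (induction n arbitrary: x)
    case 0
    show ?case using B(3)[OF HD(1), of 0] by (simp add: Y0 scaleC.zero_left)
  next
    case (Suc n)
    have "B ((1/2) *\<^sub>R (X x + Y n (Y n x))) = (1/2) *\<^sub>R (B (X x) + B (Y n (Y n x)))"
      unfolding scaleR_scaleC by (simp add: B Suc.prems YH XH HD)
    then show ?case by (simp add: YS Suc YH B)
  qed
  have YX: "Y n (X x) = X (Y n x)" if "x \<in> H" for n x
    using comm[of x X] that by (simp add: XH Xadd Xscale)
  have YY: "Y m (Y n x) = Y n (Y m x)" if "x \<in> H" for n m x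
    using comm[of x "Y m"] that by (simp add: YH Yadd Yscale YX)
  have incr: "norm (Y (Suc n) x - Y n x) \<le> (y (Suc n) - y n) * norm x" if "x \<in> H" for n x
    using that
  proof (induction n arbitrary: x)
    case 0
    then show ?case using Xnorm[of x] by (simp add: YS Y0 y0 yS)
  next
    case (Suc n)
    define d where "d = Y (Suc n) x - Y n x"
    have dH: "d \<in> H" unfolding d_def by (intro HD YH Suc.prems)
    have "Y (Suc (Suc n)) x - Y (Suc n) x = (1/2) *\<^sub>R (Y (Suc n) (Y (Suc n) x) - Y n (Y n x))"
      unfolding YS[of "Suc n"] YS[of n x] by (simp add: algebra_simps)
    also have "Y (Suc n) (Y (Suc n) x) - Y n (Y n x) = Y (Suc n) d + Y n d"
      unfolding d_def using Suc.prems by (simp add: Ydiff YH YY[of x n "Suc n"])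
    finally have "norm (Y (Suc (Suc n)) x - Y (Suc n) x) \<le> (1/2) * (norm (Y (Suc n) d) + norm (Y n d))"
      by (simp add: norm_triangle_ineq)
    also have "\<dots> \<le> (1/2) * (y (Suc n) * norm d + y n * norm d)"
      using Ynorm[OF dH, of n] Ynorm[OF dH, of "Suc n"] by simp
    also have "\<dots> = (1/2) * (y (Suc n) + y n) * norm d" by (simp add: algebra_simps)
    also have "\<dots> \<le> (1/2) * (y (Suc n) + y n) * ((y (Suc n) - y n) * norm x)"
      unfolding d_def using ypos[of n] ypos[of "Suc n"] by (intro mult_left_mono Suc) auto
    also have "\<dots> = (y (Suc (Suc n)) - y (Suc n)) * norm x"
    proof -
      have "y (Suc n) * y (Suc n) - y n * y n = 2 * (y (Suc (Suc n)) - y (Suc n))"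
      proof -
        have "y k * y k = 2 * y (Suc k) - 1" for k by (simp add: yS power2_eq_square add_divide_distrib)
        from this[of n] this[of "Suc n"] show ?thesis by simp
      qed
      moreover have "(1/2) * (y (Suc n) + y n) * ((y (Suc n) - y n) * norm x) =
          (1/2) * (y (Suc n) * y (Suc n) - y n * y n) * norm x"
        by (simp add: algebra_simps)
      ultimately have "(1/2) * (y (Suc n) + y n) * ((y (Suc n) - y n) * norm x) = (1/2) * (2 * (y (Suc (Suc n)) - y (Suc n))) * norm x" by (simp only:)
      then show ?thesis by (simp only: mult.assoc[symmetric])
    qed
    finally show ?case .
  qed
  have ymono: "y n \<le> y (Suc n)" for n
    using zero_le_power2[of "1 - y n"] by (simp add: yS power2_eq_square algebra_simps)
  then have ymono: "mono y" by (intro incseq_SucI)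
  have dist: "norm (Y (n + k) x - Y n x) \<le> (y (n + k) - y n) * norm x" if "x \<in> H" for n k x
  proof (induction k)
    case (Suc k)
    have "norm (Y (n + Suc k) x - Y n x) \<le> norm (Y (Suc (n + k)) x - Y (n + k) x) + norm (Y (n + k) x - Y n x)"
      using norm_triangle_ineq[of "Y (Suc (n + k)) x - Y (n + k) x" "Y (n + k) x - Y n x"] by simp
    with incr[OF that, of "n + k"] Suc show ?case by (simp add: algebra_simps)
  qed simp
  have "convergent y"
    by (rule Bseq_mono_convergent) (use ypos yle ymono in \<open>auto intro!: BseqI'[of _ 1] simp: monoD\<close>)
  then have yC: "Cauchy y" by (rule convergent_Cauchy)
  have YC: "convergent (\<lambda>n. Y n x)" if x: "x \<in> H" for x
  proof -
    have "Cauchy (\<lambda>n. Y n x)"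
    proof (rule CauchyI')
      fix e :: real assume e: "0 < e"
      have pos: "0 < e / (norm x + 1)" using e by (simp add: add_nonneg_pos)
      then obtain M where M: "\<And>m n. m \<ge> M \<Longrightarrow> n \<ge> M \<Longrightarrow> norm (y m - y n) < e / (norm x + 1)"
        using CauchyD[OF yC pos] by blast
      show "\<exists>M. \<forall>m\<ge>M. \<forall>n>m. dist (Y m x) (Y n x) < e"
      proof (intro exI allI impI)
        fix m n assume mn: "m \<ge> M" "n > m"
        then obtain k where k: "n = m + k" using less_imp_add_positive by blast
        have "norm (Y m x - Y n x) \<le> (y n - y m) * norm x"
          unfolding k using dist[OF x, of m k] by (simp add: norm_minus_commute)
        also have "\<dots> \<le> (y n - y m) * (norm x + 1)"
          using ymono mn by (intro mult_left_mono) (auto simp: monoD)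
        also have "\<dots> < e"
          using M[of n m] mn pos by (simp add: pos_less_divide_eq add_nonneg_pos abs_less_iff)
        finally show "dist (Y m x) (Y n x) < e" by (simp add: dist_norm)
      qed
    qed
    then show ?thesis by (simp add: Cauchy_convergent_iff)
  qed
  define L where "L x = lim (\<lambda>n. Y n x)" for x
  have YL: "(\<lambda>n. Y n x) \<longlonglongrightarrow> L x" if "x \<in> H" for x
    using YC[OF that] by (simp add: L_def convergent_LIMSEQ_iff)
  have LH: "L x \<in> H" if "x \<in> H" for x
    using closed_sequentially[OF HD(4) _ YL[OF that]] YH[OF that] by blast
  have Ladd: "L (x + z) = L x + L z" if "x \<in> H" "z \<in> H" for x z
    using LIMSEQ_unique[OF YL[OF HD(2)[OF that]]] tendsto_add[OF YL[OF that(1)] YL[OF that(2)]]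
    by (simp add: Yadd that)
  have Lscale: "L (c *\<^sub>C x) = c *\<^sub>C L x" if "x \<in> H" for x c
    using LIMSEQ_unique[OF YL[OF HD(3)[OF that]]] scaleC.tendsto[OF tendsto_const YL[OF that]]
    by (simp add: Yscale that)
  have Lsym: "cinner (L x) z = cinner x (L z)" if "x \<in> H" "z \<in> H" for x z
    using LIMSEQ_unique[OF cinner.tendsto[OF YL[OF that(1)] tendsto_const]]
      cinner.tendsto[OF tendsto_const YL[OF that(2)]] by (simp add: Ysym that)
  have Ynorm1: "norm (Y n x) \<le> norm x" if "x \<in> H" for n x
  proof -
    have "norm (Y n x) \<le> y n * norm x" by (rule Ynorm[OF that])
    also have "\<dots> \<le> 1 * norm x" by (intro mult_right_mono yle) auto
    finally show ?thesis by simp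
  qed
  have Lnorm: "norm (L x) \<le> norm x" if "x \<in> H" for x
    by (rule LIMSEQ_le_const2[OF tendsto_norm[OF YL[OF that]]]) (use Ynorm1[OF that] in blast)
  have Leq: "L x = (1/2) *\<^sub>R (X x + L (L x))" if x: "x \<in> H" for x
  proof -
    have "(\<lambda>n. norm (Y n x - L x)) \<longlonglongrightarrow> 0"
      by (intro tendsto_norm_zero LIM_zero YL x)
    moreover have "norm (Y n (Y n x - L x)) \<le> norm (Y n x - L x)" for n
      by (intro Ynorm1 HD YH LH x)
    ultimately have "(\<lambda>n. Y n (Y n x - L x)) \<longlonglongrightarrow> 0"
      using Lim_null_comparison[of "\<lambda>n. Y n (Y n x - L x)" "\<lambda>n. norm (Y n x - L x)" sequentially] by simp
    from tendsto_add[OF this YL[OF LH[OF x]]]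
    have "(\<lambda>n. Y n (Y n x)) \<longlonglongrightarrow> L (L x)" by (simp add: Ydiff YH LH x)
    then have "(\<lambda>n. Y (Suc n) x) \<longlonglongrightarrow> (1/2) *\<^sub>R (X x + L (L x))"
      unfolding YS by (intro tendsto_intros)
    from LIMSEQ_unique[OF LIMSEQ_Suc[OF YL[OF x]] this] show ?thesis .
  qed
  show ?thesis
  proof (rule that[of L])
    show "bounded_op H H L"
      using LH Ladd Lscale Lnorm by (auto simp: bounded_op_def intro!: exI[of _ 1])
  qed (fact Lnorm Leq Lsym)+
qed

text \<open>\<open>op_sqrt\<close> is an arbitrary choice, so only facts shared by all non-negative
  square roots can be used. The Gram identity is such a fact: if \<open>R\<close> is symmetric and
  \<open>R (R x) = A x\<close>, then <R x, R y> = <A x, y>. Most of the proof constructs one square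
  root, which makes the choice meaningful.\<close>

lemma op_sqrt_gram:
  assumes H: "hilbert_carrier H" and C: "bounded_op H B C"
    and AH: "\<And>x. x \<in> H \<Longrightarrow> A x \<in> H"
    and gram: "\<And>x y. x \<in> H \<Longrightarrow> y \<in> H \<Longrightarrow> cinner (A x) y = cinner (C x) (C y)"
  shows "nonneg_op H (op_sqrt H A)"
    and "x \<in> H \<Longrightarrow> op_sqrt H A (op_sqrt H A x) = A x"
    and "x \<in> H \<Longrightarrow> y \<in> H \<Longrightarrow>
      cinner (op_sqrt H A x) (op_sqrt H A y) = cinner (C x) (C y)"
proof -
  note HD = hilbert_carrierD[OF H]
  note CD = bounded_opD[OF C]
  obtain K where K: "K > 0" "\<And>x. x \<in> H \<Longrightarrow> norm (C x) \<le> K * norm x"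
    by (rule bounded_op_bound[OF C]) blast
  have gram': "cinner x (A y) = cinner (C x) (C y)" if "x \<in> H" "y \<in> H" for x y
    using gram[OF that(2,1)] by (metis cinner_commute)
  have Aadd: "A (x + y) = A x + A y" if "x \<in> H" "y \<in> H" for x y
    by (rule carrier_ext[OF H]) (simp_all add: AH HD that gram CD cinner_add_left)
  have Ascale: "A (c *\<^sub>C x) = c *\<^sub>C A x" if "x \<in> H" for x c
    by (rule carrier_ext[OF H]) (simp_all add: AH HD that gram CD cinner_scaleC_left)
  \<comment> \<open>\<open>A\<close> is the adjoint of \<open>C\<close> applied after
    \<open>C\<close>, and that adjoint is bounded by \<open>K\<close> as well.\<close>
  have AC: "norm (A x) \<le> K * norm (C x)" if x: "x \<in> H" for x
  proof (cases "norm (A x) = 0")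
    case False
    have "norm (A x) * norm (A x) = cmod (cinner (A x) (A x))"
      by (simp add: cinner_self power2_eq_square norm_mult)
    also have "\<dots> = cmod (cinner (C x) (C (A x)))" by (simp add: gram x AH)
    also have "\<dots> \<le> norm (C x) * norm (C (A x))" by (rule cinner_cauchy_schwarz)
    also have "\<dots> \<le> norm (C x) * (K * norm (A x))" by (intro mult_left_mono K AH x) auto
    finally show ?thesis using False by (simp add: mult.commute mult.left_commute)
  qed (use K in simp)
  \<comment> \<open>The scaling by \<open>K\<^sup>2\<close>, a bound for \<open>A\<close>, makes
    \<open>X\<close> a contraction: |X x|^2 is at most |x|^2 - |C x|^2 / K^2.\<close>
  define X where "X x = x - (1 / K\<^sup>2) *\<^sub>R A x" for x
  have Xnorm: "norm (X x) \<le> norm x" if x: "x \<in> H" for x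
  proof -
    define k where "k = 1 / K\<^sup>2"
    have "cinner (X x) (X x) = cinner x x - (2 * k) *\<^sub>R cinner (C x) (C x) + (k * k) *\<^sub>R cinner (A x) (A x)"
      unfolding X_def k_def[symmetric] cinner_diff_left cinner_diff_right cinner_scaleR_left cinner_scaleR_right
        gram[OF x x] gram'[OF x x]
      by (simp add: scaleR_conv_of_real algebra_simps)
    from arg_cong[OF this, of Re] have "(norm (X x))\<^sup>2 = (norm x)\<^sup>2 - 2 * k * (norm (C x))\<^sup>2 + k * k * (norm (A x))\<^sup>2"
      by (simp add: Re_cinner_self)
    then have "(norm (X x))\<^sup>2 = (norm x)\<^sup>2 - 2 * ((norm (C x))\<^sup>2 / K\<^sup>2) + (norm (A x))\<^sup>2 / K^4"
      by (simp add: k_def power4_eq_xxxx power2_eq_square)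
    moreover have "(norm (A x))\<^sup>2 / K^4 \<le> (K * norm (C x))\<^sup>2 / K^4"
      using AC[OF x] by (intro divide_right_mono power_mono) auto
    moreover have "(K * norm (C x))\<^sup>2 / K^4 = (norm (C x))\<^sup>2 / K\<^sup>2"
      using K(1) by (simp add: field_simps power2_eq_square power4_eq_xxxx)
    moreover have "0 \<le> (norm (C x))\<^sup>2 / K\<^sup>2" by simp
    ultimately have "(norm (X x))\<^sup>2 \<le> (norm x)\<^sup>2" by linarith
    then show ?thesis by (rule power2_le_imp_le) simp
  qed
  obtain Y where Y: "bounded_op H H Y" "\<And>x. x \<in> H \<Longrightarrow> norm (Y x) \<le> norm x"
    "\<And>x. x \<in> H \<Longrightarrow> Y x = (1/2) *\<^sub>R (X x + Y (Y x))"
    "\<And>x y. x \<in> H \<Longrightarrow> y \<in> H \<Longrightarrow> cinner (Y x) y = cinner x (Y y)"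
  proof (rule sqrt_one_minus_contraction[OF H, of X])
    show "cinner (X x) y = cinner x (X y)" if "x \<in> H" "y \<in> H" for x y
      using that by (simp add: X_def cinner_diff_left cinner_diff_right cinner_scaleR_left cinner_scaleR_right gram gram')
    show "X (c *\<^sub>C x) = c *\<^sub>C X x" if "x \<in> H" for c x
      using that by (simp add: X_def Ascale scaleC.diff_right scaleC.scaleR_right)
  qed (auto simp: X_def HD AH Aadd Xnorm[unfolded X_def] algebra_simps)
  note YD = bounded_opD[OF Y(1)]
  \<comment> \<open>\<open>I - Y\<close> squares to \<open>I - X\<close>, which is \<open>A\<close>
    divided by \<open>K\<^sup>2\<close>; hence the factor \<open>K\<close>.\<close>
  define R where "R x = K *\<^sub>R (x - Y x)" for x
  have RR: "R (R x) = A x" if x: "x \<in> H" for x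
  proof -
    have "Y (K *\<^sub>R (x - Y x)) = K *\<^sub>R (Y x - Y (Y x))"
      unfolding scaleR_scaleC using YD(3) bounded_op_diff[OF Y(1) H] HD(5) x YD(1) by simp
    then have "R (R x) = K *\<^sub>R (K *\<^sub>R (x - Y x) - K *\<^sub>R (Y x - Y (Y x)))"
      by (simp only: R_def)
    also have "\<dots> = (K * K) *\<^sub>R (x - 2 *\<^sub>R Y x + Y (Y x))"
      by (simp add: algebra_simps scaleR_2)
    also have "2 *\<^sub>R Y x = X x + Y (Y x)" by (subst Y(3)[OF x]) simp
    also have "(K * K) *\<^sub>R (x - (X x + Y (Y x)) + Y (Y x)) = A x"
      using K(1) by (simp add: X_def power2_eq_square)
    finally show ?thesis .
  qed
  have "nonneg_op H R"
    unfolding nonneg_op_def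
  proof (intro conjI ballI)
    show "bounded_op H H R"
      unfolding bounded_op_def
    proof (intro conjI ballI allI exI)
      fix x assume x: "x \<in> H"
      have "norm (x - Y x) \<le> 2 * norm x" using norm_triangle_ineq4[of x "Y x"] Y(2)[OF x] by simp
      then show "norm (R x) \<le> (2 * K) * norm x" using K(1) by (simp add: R_def)
      show "R (c *\<^sub>C x) = c *\<^sub>C R x" for c
        using x by (simp add: R_def YD scaleC.diff_right scaleC.scaleR_right)
    qed (auto simp: R_def YD HD algebra_simps)
    fix x assume x: "x \<in> H"
    have "cinner (Y x) x \<in> \<real>"
      using Y(4)[OF x x] by (metis Reals_cnj_iff cinner_commute)
    then have Yr: "cinner (Y x) x = of_real (Re (cinner (Y x) x))" by simp
    have "Re (cinner (Y x) x) \<le> cmod (cinner (Y x) x)" by (rule complex_Re_le_cmod)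
    also have "\<dots> \<le> norm (Y x) * norm x" by (rule cinner_cauchy_schwarz)
    also have "\<dots> \<le> norm x * norm x" by (intro mult_right_mono Y x) auto
    finally have le: "Re (cinner (Y x) x) \<le> (norm x)\<^sup>2" by (simp add: power2_eq_square)
    have "cinner (R x) x = of_real (K * ((norm x)\<^sup>2 - Re (cinner (Y x) x)))"
      unfolding R_def cinner_scaleR_left cinner_diff_left cinner_self
      by (subst Yr) (simp add: scaleR_conv_of_real)
    then show "cinner (R x) x \<in> \<real>\<^sub>\<ge>\<^sub>0" using K(1) le by (simp del: of_real_mult of_real_diff)
  qed
  with RR have "\<exists>R. nonneg_op H R \<and> (\<forall>x\<in>H. R (R x) = A x)" by blast
  from someI_ex[OF this] have sq: "nonneg_op H (op_sqrt H A)" "\<forall>x\<in>H. op_sqrt H A (op_sqrt H A x) = A x"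
    unfolding op_sqrt_def by auto
  then show "nonneg_op H (op_sqrt H A)" and "x \<in> H \<Longrightarrow> op_sqrt H A (op_sqrt H A x) = A x" by auto
  show "cinner (op_sqrt H A x) (op_sqrt H A y) = cinner (C x) (C y)" if xy: "x \<in> H" "y \<in> H"
  proof -
    have "op_sqrt H A x \<in> H" using sq(1) xy by (auto simp: nonneg_op_def bounded_op_def)
    then have "cinner (op_sqrt H A x) (op_sqrt H A y) = cinner (op_sqrt H A (op_sqrt H A x)) y"
      using nonneg_op_symmetric[OF sq(1) H] xy by simp
    then show ?thesis using sq(2) xy gram by simp
  qed
qed

text \<open>Equal Gram forms make the assignment of \<open>C x\<close> to \<open>D x\<close> a
  well-defined isometry. With a chosen square root for \<open>D\<close> and an explicit operator for
  \<open>C\<close>, this identifies an abstract defect space with a concrete subspace.\<close>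

lemma isometry_between_range_closures:
  fixes D :: "'a::complex_hilbert \<Rightarrow> 'b::complex_hilbert" and C :: "'a \<Rightarrow> 'c::complex_hilbert"
  assumes H: "hilbert_carrier H" and D: "bounded_op H B D" and C: "bounded_op H B' C"
    and gram: "\<And>x y. x \<in> H \<Longrightarrow> y \<in> H \<Longrightarrow> cinner (D x) (D y) = cinner (C x) (C y)"
  obtains U V where
    "bounded_op (closure (D ` H)) (closure (C ` H)) U" "bounded_op (closure (C ` H)) (closure (D ` H)) V"
    "\<And>x. x \<in> H \<Longrightarrow> U (D x) = C x" "\<And>x. x \<in> H \<Longrightarrow> V (C x) = D x"
    "\<And>u. u \<in> closure (D ` H) \<Longrightarrow> V (U u) = u" "\<And>v. v \<in> closure (C ` H) \<Longrightarrow> U (V v) = v"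
    "\<And>u v. u \<in> closure (D ` H) \<Longrightarrow> v \<in> closure (C ` H) \<Longrightarrow> cinner (U u) v = cinner u (V v)"
proof -
  note HD = hilbert_carrierD[OF H]
  note CD = bounded_opD[OF C] and DD = bounded_opD[OF D]
  \<comment> \<open>The closure of the graph of that assignment, described by sequences of
    preimages. It is symmetric in \<open>D\<close> and \<open>C\<close>, so one relation yields both
    the extension \<open>U\<close> and its inverse \<open>V\<close>.\<close>
  define rel where "rel u v \<longleftrightarrow> (\<exists>h. (\<forall>n. h n \<in> H) \<and> (\<lambda>n. D (h n)) \<longlonglongrightarrow> u \<and> (\<lambda>n. C (h n)) \<longlonglongrightarrow> v)" for u v
  have relI: "rel (D x) (C x)" if "x \<in> H" for x
    unfolding rel_def using that by (intro exI[of _ "\<lambda>_. x"]) auto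
  have rel_cinner: "cinner u u' = cinner v v'" if r: "rel u v" "rel u' v'" for u u' v v'
  proof -
    obtain h h' where h: "\<And>n. h n \<in> H" "(\<lambda>n. D (h n)) \<longlonglongrightarrow> u" "(\<lambda>n. C (h n)) \<longlonglongrightarrow> v"
      and h': "\<And>n. h' n \<in> H" "(\<lambda>n. D (h' n)) \<longlonglongrightarrow> u'" "(\<lambda>n. C (h' n)) \<longlonglongrightarrow> v'"
      using r unfolding rel_def by blast
    show ?thesis
      using LIMSEQ_unique[OF cinner.tendsto[OF h(2) h'(2)]] cinner.tendsto[OF h(3) h'(3)]
      by (simp add: gram h(1) h'(1))
  qed
  have rel_add: "rel (u + u') (v + v')" if r: "rel u v" "rel u' v'" for u u' v v'
  proof -
    obtain h h' where h: "\<And>n. h n \<in> H" "(\<lambda>n. D (h n)) \<longlonglongrightarrow> u" "(\<lambda>n. C (h n)) \<longlonglongrightarrow> v"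
      and h': "\<And>n. h' n \<in> H" "(\<lambda>n. D (h' n)) \<longlonglongrightarrow> u'" "(\<lambda>n. C (h' n)) \<longlonglongrightarrow> v'"
      using r unfolding rel_def by blast
    show ?thesis unfolding rel_def
      by (intro exI[of _ "\<lambda>n. h n + h' n"])
        (auto simp: h(1) h'(1) HD CD DD intro!: tendsto_add h(2,3) h'(2,3))
  qed
  have rel_scale: "rel (c *\<^sub>C u) (c *\<^sub>C v)" if r: "rel u v" for c u v
  proof -
    obtain h where h: "\<And>n. h n \<in> H" "(\<lambda>n. D (h n)) \<longlonglongrightarrow> u" "(\<lambda>n. C (h n)) \<longlonglongrightarrow> v"
      using r unfolding rel_def by blast
    show ?thesis unfolding rel_def
      by (intro exI[of _ "\<lambda>n. c *\<^sub>C h n"])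
        (auto simp: h(1) HD CD DD intro!: scaleC.tendsto h(2,3))
  qed
  have rel_diff: "rel (u - u') (v - v')" if "rel u v" "rel u' v'" for u u' v v'
    using rel_add[OF that(1) rel_scale[OF that(2), of "-1"]] by (simp add: scaleC_minus_one)
  have rel_zero: "(u = 0) = (v = 0)" if "rel u v" for u v
    using rel_cinner[OF that that] by (metis cinner_eq_0_norm)
  have fun1: "v = v'" if "rel u v" "rel u v'" for u v v'
    using rel_zero[OF rel_diff[OF that]] by simp
  have fun2: "u = u'" if "rel u v" "rel u' v" for u u' v
    using rel_zero[OF rel_diff[OF that]] by simp
  have mem: "u \<in> closure (D ` H) \<and> v \<in> closure (C ` H)" if r: "rel u v" for u v
  proof -
    obtain h where h: "\<And>n. h n \<in> H" "(\<lambda>n. D (h n)) \<longlonglongrightarrow> u" "(\<lambda>n. C (h n)) \<longlonglongrightarrow> v"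
      using r unfolding rel_def by blast
    then show ?thesis unfolding closure_sequential
      by (intro conjI exI[of _ "\<lambda>n. D (h n)"] exI[of _ "\<lambda>n. C (h n)"]) auto
  qed
  have nrm: "norm (D x - D y) = norm (C x - C y)" if "x \<in> H" "y \<in> H" for x y
    using rel_diff[OF relI[OF that(1)] relI[OF that(2)]] rel_cinner norm_eqI_cinner
    by metis
  have ex1: "\<exists>v. rel u v" if u: "u \<in> closure (D ` H)" for u
  proof -
    obtain f where f: "\<And>n. f n \<in> D ` H" "f \<longlonglongrightarrow> u" using u unfolding closure_sequential by blast
    then have "\<forall>n. \<exists>h. h \<in> H \<and> f n = D h" by blast
    then obtain h where h: "\<And>n. h n \<in> H" "\<And>n. f n = D (h n)" by metis
    have "Cauchy f" using f(2) by (auto simp: Cauchy_convergent_iff convergent_def)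
    then have "Cauchy (\<lambda>n. C (h n))" unfolding Cauchy_def h(2) dist_norm by (simp add: nrm h(1))
    then obtain v where "(\<lambda>n. C (h n)) \<longlonglongrightarrow> v" by (auto simp: Cauchy_convergent_iff convergent_def)
    then have "rel u v" unfolding rel_def using h(1) f(2)[unfolded h(2)[abs_def]] by blast
    then show ?thesis by blast
  qed
  have ex2: "\<exists>u. rel u v" if v: "v \<in> closure (C ` H)" for v
  proof -
    obtain f where f: "\<And>n. f n \<in> C ` H" "f \<longlonglongrightarrow> v" using v unfolding closure_sequential by blast
    then have "\<forall>n. \<exists>h. h \<in> H \<and> f n = C h" by blast
    then obtain h where h: "\<And>n. h n \<in> H" "\<And>n. f n = C (h n)" by metis
    have "Cauchy f" using f(2) by (auto simp: Cauchy_convergent_iff convergent_def)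
    then have "Cauchy (\<lambda>n. D (h n))" unfolding Cauchy_def h(2) dist_norm by (simp add: nrm h(1))
    then obtain u where "(\<lambda>n. D (h n)) \<longlonglongrightarrow> u" by (auto simp: Cauchy_convergent_iff convergent_def)
    then have "rel u v" unfolding rel_def using h(1) f(2)[unfolded h(2)[abs_def]] by blast
    then show ?thesis by blast
  qed
  define U where "U u = (SOME v. rel u v)" for u
  define V where "V v = (SOME u. rel u v)" for v
  have U: "rel u (U u)" if "u \<in> closure (D ` H)" for u
    unfolding U_def by (rule someI_ex[OF ex1[OF that]])
  have V: "rel (V v) v" if "v \<in> closure (C ` H)" for v
    unfolding V_def by (rule someI_ex[OF ex2[OF that]])
  have Ueq: "U u = v" if "rel u v" for u v using fun1[OF U that] mem[OF that] by blast
  have Veq: "V v = u" if "rel u v" for u v using fun2[OF V that] mem[OF that] by blast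
  show ?thesis
  proof (rule that[of U V])
    have Un: "norm (U u) = norm u" if "u \<in> closure (D ` H)" for u
      using rel_cinner[OF U U] that norm_eqI_cinner by metis
    have Vn: "norm (V v) = norm v" if "v \<in> closure (C ` H)" for v
      using rel_cinner[OF V V] that norm_eqI_cinner by metis
    show "bounded_op (closure (D ` H)) (closure (C ` H)) U"
      unfolding bounded_op_def
      using mem[OF U] Ueq[OF rel_add[OF U U]] Ueq[OF rel_scale[OF U]] Un by (auto intro!: exI[of _ 1])
    show "bounded_op (closure (C ` H)) (closure (D ` H)) V"
      unfolding bounded_op_def
      using mem[OF V] Veq[OF rel_add[OF V V]] Veq[OF rel_scale[OF V]] Vn by (auto intro!: exI[of _ 1])
    show "U (D x) = C x" "V (C x) = D x" if "x \<in> H" for x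
      using Ueq Veq relI[OF that] by auto
    show "V (U u) = u" if "u \<in> closure (D ` H)" for u using Veq[OF U[OF that]] .
    show "U (V v) = v" if "v \<in> closure (C ` H)" for v using Ueq[OF V[OF that]] .
    show "cinner (U u) v = cinner u (V v)" if "u \<in> closure (D ` H)" "v \<in> closure (C ` H)" for u v
      using rel_cinner[OF U[OF that(1)] V[OF that(2)]] by simp
  qed
qed


section \<open>Adjoint pairs\<close>

text \<open>An operator is carried together with an explicit adjoint. The existence of the adjoint
  already forces linearity, so the pair takes the place of a linearity assumption.\<close>

definition adjoint_pair :: "('a::complex_hilbert \<Rightarrow> 'b::complex_hilbert) \<Rightarrow> ('b \<Rightarrow> 'a) \<Rightarrow> bool"
  where "adjoint_pair X X' \<longleftrightarrow> (\<forall>x y. cinner (X x) y = cinner x (X' y))"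

lemma adjoint_pairD: "adjoint_pair X X' \<Longrightarrow> cinner (X x) y = cinner x (X' y)"
  by (simp add: adjoint_pair_def)

lemma adjoint_pair_sym: "adjoint_pair X X' \<Longrightarrow> adjoint_pair X' X"
  unfolding adjoint_pair_def by (metis cinner_commute)

lemma adjoint_pair_linear:
  assumes "adjoint_pair X X'"
  shows "X (x + y) = X x + X y" "X (x - y) = X x - X y" "X (c *\<^sub>C x) = c *\<^sub>C X x" "X 0 = 0"
    "X (- x) = - X x" "X (r *\<^sub>R x) = r *\<^sub>R X x" "X (sum f I) = (\<Sum>i\<in>I. X (f i))"
proof -
  show add: "X (x + y) = X x + X y" for x y
    by (rule cinner_ext_left) (simp add: adjoint_pairD[OF assms] cinner_add_left)
  show diff: "X (x - y) = X x - X y" for x y using add[of "x - y" y] by simp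
  show scale: "X (c *\<^sub>C x) = c *\<^sub>C X x" for c x
    by (rule cinner_ext_left) (simp add: adjoint_pairD[OF assms] cinner_scaleC_left)
  show zero: "X 0 = 0" using diff[of 0 0] by simp
  show "X (- x) = - X x" using diff[of 0 x] zero by simp
  show "X (r *\<^sub>R x) = r *\<^sub>R X x" by (simp add: scaleR_scaleC scale)
  show "X (sum f I) = (\<Sum>i\<in>I. X (f i))"
    by (induction I rule: infinite_finite_induct) (simp_all add: zero add)
qed

lemma adjoint_pair_comp:
  assumes "adjoint_pair X X'" "adjoint_pair Y Y'"
  shows "adjoint_pair (\<lambda>x. X (Y x)) (\<lambda>y. Y' (X' y))"
  using assms by (simp add: adjoint_pair_def)

lemma adjoint_pair_diff:
  assumes "adjoint_pair X X'" "adjoint_pair Y Y'"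
  shows "adjoint_pair (\<lambda>x. X x - Y x) (\<lambda>y. X' y - Y' y)"
  using assms by (simp add: adjoint_pair_def cinner_diff_left cinner_diff_right)

lemma adjoint_pair_id: "adjoint_pair (\<lambda>x. x) (\<lambda>x. x)"
  by (simp add: adjoint_pair_def)

text \<open>Transfers an identity between adjoints to the operators themselves. Applied to reversed
  pairs, it produces the rules for \<open>Z'\<close> and \<open>M'\<close> from those for
  \<open>Z\<close> and \<open>M\<close>.\<close>

lemma adjoint_pair_eqI:
  assumes "adjoint_pair X X'" "adjoint_pair Y Y'" "\<And>y. X' y = Y' y"
  shows "X x = Y x"
  by (rule cinner_ext_left) (simp add: adjoint_pairD[OF assms(1)] adjoint_pairD[OF assms(2)] assms(3))

lemma adjoint_pair_isometry:
  assumes "adjoint_pair X X'" "\<And>x. X' (X x) = x"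
  shows "norm (X x) = norm x" "norm (X' y) \<le> norm y"
proof -
  show n: "norm (X x) = norm x" for x
    by (rule power2_eq_imp_eq) (simp_all flip: Re_cinner_self add: adjoint_pairD[OF assms(1)] assms(2))
  show "norm (X' y) \<le> norm y"
  proof (cases "X' y = 0")
    case False
    have "norm (X' y) * norm (X' y) = cmod (cinner (X (X' y)) y)"
      by (simp add: adjoint_pairD[OF assms(1)] cinner_self power2_eq_square norm_mult)
    also have "\<dots> \<le> norm (X (X' y)) * norm y" by (rule cinner_cauchy_schwarz)
    finally show ?thesis using False by (simp add: n)
  qed simp
qed

section \<open>Ordered products of operators\<close>

text \<open>\<open>comp_prod\<close> is tied to the sorted list of a set, which offers no induction;
  arbitrary lists do.\<close>

definition list_comp :: "'n list \<Rightarrow> ('n \<Rightarrow> 'b \<Rightarrow> 'b) \<Rightarrow> 'b \<Rightarrow> 'b"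
  where "list_comp xs A = foldr (\<lambda>k B. A k \<circ> B) xs id"

lemma list_comp_simps [simp]:
  "list_comp [] A x = x" "list_comp (k # xs) A x = A k (list_comp xs A x)"
  by (simp_all add: list_comp_def)

lemma comp_prod_list_comp: "comp_prod S A = list_comp (sorted_list_of_set S) A"
  by (simp add: comp_prod_def list_comp_def)

text \<open>The factors agree only on \<open>H\<close>, so membership of each intermediate value in
  \<open>H\<close> has to be carried through the induction.\<close>

lemma list_comp_cong_on:
  assumes "\<And>k x. k \<in> set xs \<Longrightarrow> x \<in> H \<Longrightarrow> A k x = B k x \<and> B k x \<in> H" "x \<in> H"
  shows "list_comp xs A x = list_comp xs B x \<and> list_comp xs B x \<in> H"
  using assms by (induction xs) auto

lemma list_comp_commute:
  assumes "\<And>k x. k \<in> set xs \<Longrightarrow> F (A k x) = A k (F x)"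
  shows "F (list_comp xs A x) = list_comp xs A (F x)"
  using assms by (induction xs) auto

section \<open>Defect operators with vanishing product\<close>

text \<open>Defect operators are known only through their squares, hence the form of the hypothesis.
  For symmetric \<open>S\<close>, |S x|^2 = <S (S x), x>, which strips one of two equal factors on
  the left; passing to adjoints reverses the product, so the other pair can be stripped too.\<close>

lemma nonneg_op_mult_eq_0:
  assumes H: "hilbert_carrier H" and D: "nonneg_op H D" and E: "nonneg_op H E"
    and zero: "\<And>x. x \<in> H \<Longrightarrow> D (D (E (E x))) = 0"
    and x: "x \<in> H"
  shows "D (E x) = 0"
proof -
  have DH: "D x \<in> H" and EH: "E x \<in> H" if "x \<in> H" for x
    using D E that by (auto simp: nonneg_op_def bounded_op_def)
  note Ds = nonneg_op_symmetric[OF D H] and Es = nonneg_op_symmetric[OF E H]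
  have 1: "D (E (E x)) = 0" if x: "x \<in> H" for x
    using Ds[of "D (E (E x))" "E (E x)"] zero[OF x] DH EH x
    by (metis cinner_eq_0_norm cinner.zero_left)
  have 2: "E (E (D x)) = 0" if x: "x \<in> H" for x
  proof -
    have "cinner (E (E (D x))) (E (E (D x))) = cinner x (D (E (E (E (E (D x))))))"
      using x by (simp add: Es Ds DH EH)
    then show ?thesis using 1[of "E (E (D x))"] x DH EH by (simp add: cinner_eq_0_norm cinner.zero_right)
  qed
  have 3: "E (D x) = 0" if x: "x \<in> H" for x
    using Es[of "E (D x)" "D x"] 2[OF x] DH EH x by (metis cinner_eq_0_norm cinner.zero_left)
  have "cinner (D (E x)) (D (E x)) = cinner x (E (D (D (E x))))"
    using x by (simp add: Es Ds DH EH)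
  then show ?thesis using 3[of "D (E x)"] x DH EH by (simp add: cinner_eq_0_norm cinner.zero_right)
qed

section \<open>Subspaces and unitary operators obtained from adjoint pairs\<close>

lemma adjoint_pair_hilbert_carrier:
  assumes "adjoint_pair X X'" "adjoint_pair Y Y'"
  shows "hilbert_carrier {x. X x = Y x}"
proof -
  \<comment> \<open>Tested against every \<open>u\<close>, the equation becomes a family of scalar
    equations continuous in \<open>x\<close>; closedness follows.\<close>
  have "{x. X x = Y x} = (\<Inter>u. {x. cinner x (X' u) = cinner x (Y' u)})"
    using assms unfolding adjoint_pair_def by (auto intro: cinner_ext_left) metis
  moreover have "closed (\<Inter>u. {x. cinner x (X' u) = cinner x (Y' u)})"
    by (intro closed_INT ballI closed_Collect_eq cinner.continuous_on continuous_intros)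
  ultimately have "closed {x. X x = Y x}" by simp
  then show ?thesis
    unfolding hilbert_carrier_def
    using adjoint_pair_linear[OF assms(1)] adjoint_pair_linear[OF assms(2)] by auto
qed

lemma hilbert_carrier_Int: "hilbert_carrier A \<Longrightarrow> hilbert_carrier B \<Longrightarrow> hilbert_carrier (A \<inter> B)"
  unfolding hilbert_carrier_def by auto

lemma hilbert_carrier_Times: "hilbert_carrier A \<Longrightarrow> hilbert_carrier B \<Longrightarrow> hilbert_carrier (A \<times> B)"
  unfolding hilbert_carrier_def by (auto simp: scaleC_prod_def zero_prod_def closed_Times)

lemma adjoint_projection_norm_le:
  assumes "adjoint_pair X X" "\<And>x. X (X x) = X x"
  shows "norm (X x) \<le> norm x"
proof (cases "X x = 0")
  case False
  have "norm (X x) * norm (X x) = cmod (cinner (X x) x)"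
    using adjoint_pairD[OF assms(1), of "X x" x] assms(2)
    by (metis cinner_self norm_of_real power2_eq_square abs_of_nonneg zero_le_power2)
  also have "\<dots> \<le> norm (X x) * norm x" by (rule cinner_cauchy_schwarz)
  finally show ?thesis using False by simp
qed simp

lemma unitary_opI:
  assumes K: "hilbert_carrier K" and SK: "\<And>e. S e \<in> K"
    and adjoint: "\<And>e k. k \<in> K \<Longrightarrow> cinner (S e) k = cinner e (S' k)"
    and inv: "\<And>k. k \<in> K \<Longrightarrow> S (S' k) = k" "\<And>e. S' (S e) = e"
  shows "unitary_op UNIV K S" "k \<in> K \<Longrightarrow> adj UNIV S k = S' k"
proof -
  note KD = hilbert_carrierD[OF K]
  show a: "k \<in> K \<Longrightarrow> adj UNIV S k = S' k" for k
    by (rule adj_eqI) (auto simp: hilbert_carrier_UNIV adjoint)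
  have add: "S (x + y) = S x + S y" for x y
    by (rule carrier_ext[OF K]) (auto simp: SK KD adjoint cinner_add_left)
  have scale: "S (c *\<^sub>C x) = c *\<^sub>C S x" for c x
    by (rule carrier_ext[OF K]) (auto simp: SK KD adjoint cinner_scaleC_left)
  have "norm (S x) = norm x" for x
    by (rule norm_eqI_cinner) (simp add: adjoint SK inv)
  then have "bounded_op UNIV K S"
    unfolding bounded_op_def using SK add scale by (auto intro!: exI[of _ 1])
  then show "unitary_op UNIV K S"
    unfolding unitary_op_def using a inv SK by auto
qed

text \<open>
  The orthogonal decomposition \<open>W = S \<oplus> S\<^sup>\<bottom>\<close>, transported along unitary identifications of the
  whole space with \<open>W\<close>, of \<open>A\<close> with \<open>S\<close>, and of \<open>F\<close> with \<open>S\<^sup>\<bottom>\<close>.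
\<close>

lemma orthogonal_sum_unitary:
  fixes J :: "'e::complex_hilbert \<Rightarrow> 'k::complex_hilbert" and J' :: "'k \<Rightarrow> 'e"
    and U :: "'a::complex_hilbert \<Rightarrow> 'k" and V :: "'k \<Rightarrow> 'a"
    and g :: "'f::complex_hilbert \<Rightarrow> 'k" and g' :: "'k \<Rightarrow> 'f"
  assumes J: "adjoint_pair J J'" "\<And>e. J' (J e) = e" "\<And>e. J e \<in> W" "\<And>x. x \<in> W \<Longrightarrow> J (J' x) = x"
    and W: "hilbert_carrier W" and S: "hilbert_carrier S" "S \<subseteq> W"
    and AF: "hilbert_carrier A" "hilbert_carrier F"
    and U: "\<And>a. a \<in> A \<Longrightarrow> U a \<in> S" "\<And>s. s \<in> S \<Longrightarrow> V s \<in> A" "\<And>a. a \<in> A \<Longrightarrow> V (U a) = a"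
      "\<And>s. s \<in> S \<Longrightarrow> U (V s) = s" "\<And>a s. a \<in> A \<Longrightarrow> s \<in> S \<Longrightarrow> cinner (U a) s = cinner a (V s)"
    and g: "\<And>f. f \<in> F \<Longrightarrow> g f \<in> W" "\<And>f s. f \<in> F \<Longrightarrow> s \<in> S \<Longrightarrow> cinner s (g f) = 0"
      "\<And>x. x \<in> W \<Longrightarrow> (\<And>s. s \<in> S \<Longrightarrow> cinner s x = 0) \<Longrightarrow> g' x \<in> F \<and> g (g' x) = x"
      "\<And>f. f \<in> F \<Longrightarrow> g' (g f) = f" "\<And>f x. f \<in> F \<Longrightarrow> cinner (g f) x = cinner f (g' x)"
  obtains \<sigma> where "unitary_op UNIV (A \<times> F) \<sigma>"
    "\<And>a f. a \<in> A \<Longrightarrow> f \<in> F \<Longrightarrow> adj UNIV \<sigma> (a, f) = J' (U a + g f)"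
    "\<And>e. \<exists>a\<in>A. \<exists>f\<in>F. \<sigma> e = (a, f) \<and> J e = U a + g f"
proof -
  note WD = hilbert_carrierD[OF W] and SD = hilbert_carrierD[OF S(1)]
  have "\<exists>p. \<forall>x. p x \<in> S \<and> (\<forall>s\<in>S. cinner (x - p x) s = 0)"
    by (intro choice allI) (metis projection_exists[OF S(1)])
  then obtain p where p: "\<And>x. p x \<in> S" "\<And>x s. s \<in> S \<Longrightarrow> cinner (x - p x) s = 0" by blast
  have p': "cinner s (x - p x) = 0" if "s \<in> S" for x s
    using p(2)[OF that, of x] by (subst cinner_commute) simp
  have p_eq: "p (s + t) = s" if s: "s \<in> S" and t: "\<And>s. s \<in> S \<Longrightarrow> cinner s t = 0" for s t
  proof -
    have mem: "p (s + t) - s \<in> S" by (intro SD p s)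
    have "p (s + t) - s = t - (s + t - p (s + t))" by simp
    then have "cinner (p (s + t) - s) (p (s + t) - s) = cinner (p (s + t) - s) (t - (s + t - p (s + t)))" by simp
    also have "\<dots> = 0"
      unfolding cinner_diff_right[of _ t] t[OF mem] p'[OF mem] by simp
    finally show ?thesis by (simp add: cinner_eq_0_norm)
  qed
  define \<sigma> where "\<sigma> e = (V (p (J e)), g' (J e - p (J e)))" for e
  have rest: "g' (J e - p (J e)) \<in> F \<and> g (g' (J e - p (J e))) = J e - p (J e)" for e
    using J(3) p S(2) p' by (intro g(3) WD) auto
  define S' where "S' = (\<lambda>(a, f). J' (U a + g f))"
  have memK: "\<sigma> e \<in> A \<times> F" for e
    using rest by (simp add: \<sigma>_def U p)
  have adjoint: "cinner (\<sigma> e) k = cinner e (S' k)" if k: "k \<in> A \<times> F" for e k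
  proof -
    obtain a f where af: "k = (a, f)" "a \<in> A" "f \<in> F" using k by auto
    have Va: "cinner (V s) a = cinner s (U a)" if "s \<in> S" for s
      using U(5)[OF af(2) that] by (metis cinner_commute)
    have gf: "cinner (g' x) f = cinner x (g f)" for x
      using g(5)[OF af(3), of x] by (metis cinner_commute)
    have "cinner (\<sigma> e) k = cinner (p (J e)) (U a) + cinner (J e - p (J e)) (g f)"
      by (simp add: \<sigma>_def af cinner_prod_def Va p gf)
    also have "cinner (p (J e)) (U a) = cinner (J e) (U a)"
      using p(2)[OF U(1)[OF af(2)], of "J e"] by (simp add: cinner_diff_left)
    also have "cinner (J e - p (J e)) (g f) = cinner (J e) (g f)"
      using g(2)[OF af(3) p(1)] by (simp add: cinner_diff_left)
    finally show ?thesis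
      by (simp add: S'_def af adjoint_pairD[OF J(1), symmetric] cinner_add_right)
  qed
  have inv1: "\<sigma> (S' k) = k" if k: "k \<in> A \<times> F" for k
  proof -
    obtain a f where af: "k = (a, f)" "a \<in> A" "f \<in> F" using k by auto
    have "U a + g f \<in> W" using U(1)[OF af(2)] S(2) g(1)[OF af(3)] WD(2) by auto
    then have "J (S' k) = U a + g f" by (simp add: S'_def af J(4))
    moreover have "p (U a + g f) = U a" by (rule p_eq) (simp_all add: U af g(2))
    ultimately show ?thesis by (simp add: \<sigma>_def af U g(4))
  qed
  have inv2: "S' (\<sigma> e) = e" for e
    using rest[of e] by (simp add: S'_def \<sigma>_def U p J(2))
  note un = unitary_opI[OF hilbert_carrier_Times[OF AF] memK adjoint inv1 inv2]
  show ?thesis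
  proof (rule that[of \<sigma>])
    show "unitary_op UNIV (A \<times> F) \<sigma>" by (rule un(1))
    show "adj UNIV \<sigma> (a, f) = J' (U a + g f)" if "a \<in> A" "f \<in> F" for a f
      using un(2)[of "(a, f)"] that by (simp add: S'_def)
    show "\<exists>a\<in>A. \<exists>f\<in>F. \<sigma> e = (a, f) \<and> J e = U a + g f" for e
      using rest[of e] memK[of e] by (auto simp: \<sigma>_def U p)
  qed
qed

section \<open>The model of an inner function\<close>

text \<open>
  \<open>Z\<close> is a doubly commuting tuple of pure isometries, \<open>M\<close> a partial isometry with initial
  projection \<open>R1\<close> that intertwines \<open>Z\<close> with itself, and the reducing projection \<open>R\<close> fixes its
  range. In the application \<open>Z\<close> consists of the coordinate shifts, \<open>R1\<close> and \<open>R\<close> are the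
  projections onto the Hardy spaces of the two coefficient spaces, and \<open>M\<close> is the
  multiplication by the inner function.
\<close>

locale beurling_model =
  fixes Z Z' :: "'n::{finite,linorder} \<Rightarrow> 'k::complex_hilbert \<Rightarrow> 'k" and R R1 M M' :: "'k \<Rightarrow> 'k"
  assumes Z_adj: "adjoint_pair (Z i) (Z' i)"
    and Z_isom: "Z' i (Z i x) = x"
    and Z_comm: "Z i (Z j x) = Z j (Z i x)"
    and Z_dcomm: "i \<noteq> j \<Longrightarrow> Z' i (Z j x) = Z j (Z' i x)"
    and Z'_lim: "(\<lambda>m. (Z' i ^^ m) x) \<longlonglongrightarrow> 0"
    and M_adj: "adjoint_pair M M'"
    and M_Z: "M (Z i x) = Z i (M x)"
    and M'_M: "M' (M x) = R1 x"
    and R1_idem: "R1 (R1 x) = R1 x"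
    and R1_Z: "R1 (Z i x) = Z i (R1 x)"
    and R_adj: "adjoint_pair R R"
    and R_idem: "R (R x) = R x"
    and R_Z: "R (Z i x) = Z i (R x)"
    and R_M: "R (M x) = M x"
begin

section \<open>Adjoint forms of the axioms\<close>

lemmas Z_lin = adjoint_pair_linear[OF Z_adj]
lemmas Z'_lin = adjoint_pair_linear[OF adjoint_pair_sym[OF Z_adj]]
lemmas M_lin = adjoint_pair_linear[OF M_adj]
lemmas M'_lin = adjoint_pair_linear[OF adjoint_pair_sym[OF M_adj]]
lemmas R_lin = adjoint_pair_linear[OF R_adj]

lemma R1_adj: "adjoint_pair R1 R1"
  using adjoint_pair_comp[OF adjoint_pair_sym[OF M_adj] M_adj] unfolding M'_M .

lemmas R1_lin = adjoint_pair_linear[OF R1_adj]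

lemma Z'_comm: "Z' i (Z' j x) = Z' j (Z' i x)"
  by (rule adjoint_pair_eqI[OF adjoint_pair_sym[OF adjoint_pair_comp[OF Z_adj Z_adj]]
        adjoint_pair_sym[OF adjoint_pair_comp[OF Z_adj Z_adj]]]) (rule Z_comm)

lemma M'_Z': "M' (Z' i x) = Z' i (M' x)"
  by (rule adjoint_pair_eqI[OF adjoint_pair_sym[OF adjoint_pair_comp[OF Z_adj M_adj]]
        adjoint_pair_sym[OF adjoint_pair_comp[OF M_adj Z_adj]]]) (simp add: M_Z)

lemma R1_Z': "R1 (Z' i x) = Z' i (R1 x)"
  by (rule adjoint_pair_eqI[OF adjoint_pair_sym[OF adjoint_pair_comp[OF Z_adj R1_adj]]
        adjoint_pair_sym[OF adjoint_pair_comp[OF R1_adj Z_adj]]]) (simp add: R1_Z)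

lemma R_Z': "R (Z' i x) = Z' i (R x)"
  by (rule adjoint_pair_eqI[OF adjoint_pair_sym[OF adjoint_pair_comp[OF Z_adj R_adj]]
        adjoint_pair_sym[OF adjoint_pair_comp[OF R_adj Z_adj]]]) (simp add: R_Z)

lemma M'_R: "M' (R x) = M' x"
  by (rule adjoint_pair_eqI[OF adjoint_pair_sym[OF adjoint_pair_comp[OF R_adj M_adj]]
        adjoint_pair_sym[OF M_adj]]) (simp add: R_M)

text \<open>Since \<open>M' M\<close> is the projection \<open>R1\<close>, the vector
  \<open>x - R1 x\<close> has an image of norm zero.\<close>

lemma M_R1: "M (R1 x) = M x"
proof -
  have "cinner (M (x - R1 x)) (M (x - R1 x)) = 0"
    by (simp add: adjoint_pairD[OF M_adj] M'_M R1_lin R1_idem cinner.zero_right)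
  then show ?thesis by (simp add: cinner_eq_0_norm M_lin)
qed

lemma R1_M': "R1 (M' x) = M' x"
  by (rule adjoint_pair_eqI[OF adjoint_pair_sym[OF adjoint_pair_comp[OF M_adj R1_adj]]
        adjoint_pair_sym[OF M_adj]]) (simp add: M_R1)

lemma M_norm_le: "norm (M x) \<le> norm x"
proof -
  have "cinner (M x) (M x) = cinner (R1 x) (R1 x)"
    by (simp add: adjoint_pairD[OF M_adj] M'_M adjoint_pairD[OF R1_adj] R1_idem)
  then have "norm (M x) = norm (R1 x)" by (rule norm_eqI_cinner)
  with adjoint_projection_norm_le[OF R1_adj R1_idem] show ?thesis by simp
qed

lemma M'_norm_le: "norm (M' x) \<le> norm x"
proof (cases "M' x = 0")
  case False
  have "norm (M' x) * norm (M' x) = cmod (cinner (M (M' x)) x)"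
    by (simp add: adjoint_pairD[OF M_adj] cinner_self power2_eq_square norm_mult)
  also have "\<dots> \<le> norm (M (M' x)) * norm x" by (rule cinner_cauchy_schwarz)
  also have "\<dots> \<le> norm (M' x) * norm x" by (intro mult_right_mono M_norm_le) simp
  finally show ?thesis using False by simp
qed simp

lemma Z_norm: "norm (Z i x) = norm x" and Z'_norm_le: "norm (Z' i x) \<le> norm x"
  by (rule adjoint_pair_isometry[OF Z_adj Z_isom])+

text \<open>\<open>M M'\<close> is the projection onto the range of \<open>M\<close>, which lies in
  that of \<open>R\<close>. So \<open>P\<close> projects onto the orthogonal complement of the range
  of \<open>M\<close> inside the range of \<open>R\<close>.\<close>

definition P where "P x = R x - M (M' x)"

lemma P_adj: "adjoint_pair P P"
  unfolding P_def[abs_def] by (intro adjoint_pair_diff R_adj adjoint_pair_comp[OF M_adj adjoint_pair_sym[OF M_adj]])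

lemmas P_lin = adjoint_pair_linear[OF P_adj]

lemma P_M: "P (M x) = 0"
  by (simp add: P_def R_M M'_M M_R1)

lemma M'_P: "M' (P x) = 0"
  by (simp add: P_def M'_lin M'_R M'_M R1_M')

lemma R_P: "R (P x) = P x"
  by (simp add: P_def R_lin R_idem R_M)

lemma P_R: "P (R x) = P x"
  by (simp add: P_def R_idem M'_R)

lemma P_idem: "P (P x) = P x"
  by (subst P_def) (simp add: R_P M'_P M_lin)

text \<open>The kernel of \<open>P\<close> is invariant under the shifts, because the kernel of
  \<open>R\<close> and the range of \<open>M\<close> are. Hence compressing to \<open>H\<close> is
  multiplicative on products of shifts.\<close>

lemma P_Z_P: "P (Z i (P x)) = P (Z i x)"
  by (subst (2) P_def) (simp add: Z_lin P_lin R_Z[symmetric] P_R M_Z[symmetric] P_M)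

section \<open>The model space and its tuple\<close>

definition H where "H = {x. P x = x}"

lemma hilbert_carrier_H: "hilbert_carrier H"
  unfolding H_def by (rule adjoint_pair_hilbert_carrier[OF P_adj adjoint_pair_id])

lemmas H_carrier = hilbert_carrierD[OF hilbert_carrier_H]

lemma P_H [simp]: "P x \<in> H"
  by (simp add: H_def P_idem)

lemma HD: assumes "x \<in> H" shows "P x = x" "R x = x" "M' x = 0"
  using assms R_P[of x] M'_P[of x] by (auto simp: H_def)

lemma HI: "R x = x \<Longrightarrow> M' x = 0 \<Longrightarrow> x \<in> H"
  by (simp add: H_def P_def M_lin)

lemma Z'_H [simp]: "x \<in> H \<Longrightarrow> Z' i x \<in> H"
  by (rule HI) (simp_all add: R_Z' M'_Z' HD Z'_lin)

definition T where "T i x = P (Z i x)"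

lemma T_H [simp]: "T i x \<in> H"
  by (simp add: T_def)

lemma T_bounded: "bounded_op H H (T i)"
  unfolding bounded_op_def T_def
  using adjoint_projection_norm_le[OF P_adj P_idem] Z_norm
  by (auto simp: Z_lin P_lin intro!: exI[of _ 1]) metis

text \<open>\<open>H\<close> is invariant under the backward shifts, so no projection appears in the
  adjoint of the compression.\<close>

lemma adj_T: "x \<in> H \<Longrightarrow> adj H (T i) x = Z' i x"
  by (rule adj_eqI[OF hilbert_carrier_H])
    (simp_all add: T_def adjoint_pairD[OF P_adj] adjoint_pairD[OF Z_adj] HD)

lemma adj_T_pow: "x \<in> H \<Longrightarrow> (adj H (T i) ^^ m) x = (Z' i ^^ m) x \<and> (Z' i ^^ m) x \<in> H"
  by (induction m) (auto simp: adj_T)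

lemma T_comm: "T i (T j x) = T j (T i x)"
  by (simp add: T_def P_Z_P Z_comm)

lemma commuting_contractions_T: "commuting_contractions H T"
  unfolding commuting_contractions_def contraction_op_def
proof (intro conjI allI ballI)
  show "norm (T i x) \<le> norm x" for i x
    using adjoint_projection_norm_le[OF P_adj P_idem, of "Z i x"] by (simp add: T_def Z_norm)
qed (rule T_bounded T_comm)+

lemma C_dot_0_T: "C_dot_0 H (T i)"
  unfolding C_dot_0_def using Z'_lim by (simp add: adj_T_pow)

section \<open>The defect operators of the single contractions\<close>

definition B where "B j x = M' (Z j x)"
text \<open>The adjoint of the restriction of \<open>B j\<close> to \<open>H\<close>; the outer
  \<open>P\<close> keeps the values in \<open>H\<close>.\<close>

definition Bs where "Bs j g = P (Z' j (M g))"

lemma Bs_H [simp]: "Bs j g \<in> H"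
  by (simp add: Bs_def)

lemma Bs_lin: "Bs j (x + y) = Bs j x + Bs j y" "Bs j (x - y) = Bs j x - Bs j y" "Bs j 0 = 0"
  "Bs j (sum f I) = (\<Sum>i\<in>I. Bs j (f i))"
  by (simp_all add: Bs_def M_lin Z'_lin P_lin)

lemma B_lin: "B j (x + y) = B j x + B j y" "B j (x - y) = B j x - B j y" "B j 0 = 0"
  "B j (c *\<^sub>C x) = c *\<^sub>C B j x" "B j (r *\<^sub>R x) = r *\<^sub>R B j x"
  by (simp_all add: B_def M'_lin Z_lin)

lemma B_adj: "x \<in> H \<Longrightarrow> cinner (Bs j g) x = cinner g (B j x)"
  by (simp add: Bs_def B_def adjoint_pairD[OF P_adj] HD adjoint_pairD[OF adjoint_pair_sym[OF Z_adj]]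
      adjoint_pairD[OF M_adj])

lemma B_adj': "x \<in> H \<Longrightarrow> cinner x (Bs j g) = cinner (B j x) g"
  using B_adj[of x j g] by (metis cinner_commute)

lemma B_norm_le: "norm (B j x) \<le> norm x"
  unfolding B_def using M'_norm_le[of "Z j x"] by (simp add: Z_norm)

text \<open>The commutator of the backward shift with \<open>M\<close>: the part of
  \<open>Z' j (M g)\<close> inside the range of \<open>M\<close> is \<open>M (Z' j g)\<close>, as
  \<open>M' Z' M = Z' R1\<close>.\<close>

lemma Bs_eq: "Bs j g = Z' j (M g) - M (Z' j g)"
  by (simp add: Bs_def P_def R_Z' R_M M'_Z' M'_M R1_Z'[symmetric] M_R1)

text \<open>The backward shift passes through \<open>M'\<close> and cancels \<open>Z j\<close>, and
  \<open>M'\<close> vanishes on \<open>H\<close>. In function terms, \<open>B j x\<close> is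
  independent of the \<open>j\<close>-th variable.\<close>

lemma Z'_B: "x \<in> H \<Longrightarrow> Z' j (B j x) = 0"
  by (simp add: B_def M'_Z'[symmetric] Z_isom HD)

lemma B_Z': "i \<noteq> j \<Longrightarrow> B j (Z' i x) = Z' i (B j x)"
  by (simp add: B_def M'_Z'[symmetric] Z_dcomm)

text \<open>The source of the vanishing products of defect operators. Double commutativity moves
  \<open>Z' j\<close> past \<open>Z i\<close> to the left, \<open>M' M\<close> becomes a projection
  commuting with the shifts, and then \<open>Z' j\<close> meets \<open>g\<close>.\<close>

lemma B_Bs: assumes "i \<noteq> j" "Z' j g = 0" shows "B i (Bs j g) = 0"
proof -
  have "B i (Bs j g) = M' (Z i (Z' j (M g)))" by (simp add: B_def Bs_eq assms(2) M_lin)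
  also have "\<dots> = Z' j (M' (M (Z i g)))"
    using assms(1) by (simp add: Z_dcomm[symmetric] M'_Z' M_Z)
  also have "\<dots> = R1 (Z i (Z' j g))"
    using assms(1) by (simp add: M'_M R1_Z'[symmetric] Z_dcomm)
  finally show ?thesis by (simp add: assms(2) Z_lin R1_lin)
qed

text \<open>The compression loses exactly \<open>M (B i x)\<close> from \<open>Z i x\<close>; pulled
  back by \<open>Z' i\<close>, this is the whole defect, and it equals \<open>Bs i (B i x)\<close>
  because \<open>Z' i\<close> annihilates \<open>B i x\<close>.\<close>

lemma T_defect: assumes "x \<in> H" shows "x - adj H (T i) (T i x) = Bs i (B i x)"
proof -
  have "adj H (T i) (T i x) = Z' i (P (Z i x))" by (simp add: adj_T) (simp add: T_def)
  also have "\<dots> = x - Z' i (M (B i x))"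
    using assms by (simp add: P_def R_Z Z'_lin Z_isom HD B_def)
  finally show ?thesis by (simp add: Bs_eq Z'_B assms M_lin)
qed

lemma bounded_op_B: "bounded_op H UNIV (B j)"
  unfolding bounded_op_def using B_norm_le by (auto simp: B_lin intro!: exI[of _ 1])

lemma
  shows nonneg_op_defect: "nonneg_op H (defect H (T i))"
    and defect_sq: "x \<in> H \<Longrightarrow> defect H (T i) (defect H (T i) x) = Bs i (B i x)"
proof -
  have mem: "x - adj H (T i) (T i x) \<in> H" and gram: "y \<in> H \<Longrightarrow>
    cinner (x - adj H (T i) (T i x)) y = cinner (B i x) (B i y)" if "x \<in> H" for x y
    by (simp_all add: T_defect that B_adj)
  note g = op_sqrt_gram[OF hilbert_carrier_H bounded_op_B mem gram]
  show "nonneg_op H (defect H (T i))" unfolding defect_def by (rule g(1))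
  show "x \<in> H \<Longrightarrow> defect H (T i) (defect H (T i) x) = Bs i (B i x)"
    unfolding defect_def by (simp add: g(2) T_defect)
qed

lemma defect_mult_0:
  assumes "i \<noteq> j" "x \<in> H" shows "defect H (T i) (defect H (T j) x) = 0"
proof (rule nonneg_op_mult_eq_0[OF hilbert_carrier_H nonneg_op_defect nonneg_op_defect _ assms(2)])
  fix y assume "y \<in> H"
  then show "defect H (T i) (defect H (T i) (defect H (T j) (defect H (T j) y))) = 0"
    by (simp add: defect_sq B_Bs assms(1) Z'_B Bs_lin)
qed

subsection \<open>The projection onto the constants\<close>

text \<open>The projection onto the kernel of \<open>Z' i\<close>, that is, onto the functions
  independent of the \<open>i\<close>-th variable.\<close>

definition N where "N i x = x - Z i (Z' i x)"

lemma N_lin: "N i (x + y) = N i x + N i y" "N i (x - y) = N i x - N i y" "N i 0 = 0" "N i (c *\<^sub>C x) = c *\<^sub>C N i x"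
  by (simp_all add: N_def Z_lin Z'_lin scaleC.diff_right)

lemma N_adj: "adjoint_pair (N i) (N i)"
  unfolding N_def[abs_def] by (intro adjoint_pair_diff adjoint_pair_id adjoint_pair_comp[OF Z_adj adjoint_pair_sym[OF Z_adj]])

lemma N_Z': "i \<noteq> j \<Longrightarrow> Z' j (N i x) = N i (Z' j x)"
  by (simp add: N_def Z'_lin Z_dcomm Z'_comm)

lemma N_Z: "i \<noteq> j \<Longrightarrow> Z j (N i x) = N i (Z j x)"
  by (simp add: N_def Z_lin Z_dcomm Z_comm)

lemma Z'_N: "Z' i (N i x) = 0"
  by (simp add: N_def Z'_lin Z_isom)

lemma N_N: "N i (N j x) = N j (N i x)"
  by (cases "i = j") (simp_all add: N_def[of i] N_lin N_Z N_Z')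

lemma N_id: "Z' i x = 0 \<Longrightarrow> N i x = x"
  by (simp add: N_def Z_lin)

lemma Z'_list_N: "k \<in> set xs \<Longrightarrow> Z' k (list_comp xs N x) = 0"
proof (induction xs)
  case (Cons l xs)
  show ?case
  proof (cases "k = l")
    case False
    with Cons show ?thesis by (simp add: N_Z' N_lin)
  qed (simp add: Z'_N)
qed simp

lemma list_N_id: "(\<And>k. k \<in> set xs \<Longrightarrow> Z' k x = 0) \<Longrightarrow> list_comp xs N x = x"
  by (induction xs) (simp_all add: N_id)

lemma list_N_N: "N k (list_comp xs N x) = list_comp xs N (N k x)"
  by (rule list_comp_commute) (rule N_N)

lemma list_N_Z': "k \<notin> set xs \<Longrightarrow> Z' k (list_comp xs N x) = list_comp xs N (Z' k x)"
  by (rule list_comp_commute) (auto intro: N_Z')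

lemma list_N_adj: "adjoint_pair (list_comp xs N) (list_comp xs N)"
proof (induction xs)
  case Nil
  then show ?case by (simp add: adjoint_pair_def)
next
  case (Cons k xs)
  from adjoint_pair_comp[OF N_adj Cons] show ?case
    by (simp add: adjoint_pair_def list_N_N)
qed

definition E0 where "E0 = comp_prod UNIV N"

lemma E0_list: "E0 = list_comp (sorted_list_of_set UNIV) N"
  by (rule ext) (simp add: E0_def comp_prod_list_comp)

lemma E0_adj: "adjoint_pair E0 E0"
  unfolding E0_list by (rule list_N_adj)

lemmas E0_lin = adjoint_pair_linear[OF E0_adj]

lemma Z'_E0 [simp]: "Z' k (E0 x) = 0"
  unfolding E0_list by (rule Z'_list_N) simp

lemma E0_id: "(\<And>k. Z' k x = 0) \<Longrightarrow> E0 x = x"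
  unfolding E0_list by (rule list_N_id) auto

lemma E0_idem [simp]: "E0 (E0 x) = E0 x"
  by (rule E0_id) simp

lemma E0_Z: "E0 (Z k x) = 0"
  by (rule adjoint_pair_eqI[OF adjoint_pair_comp[OF E0_adj Z_adj], of "\<lambda>_. 0" "\<lambda>_. 0"])
    (simp_all add: adjoint_pair_def cinner.zero_left cinner.zero_right)

lemma E0_N: "E0 (N k x) = E0 x"
  by (simp add: N_def E0_lin E0_Z)

lemma E0_list_N: "E0 (list_comp xs N x) = E0 x"
  by (induction xs) (simp_all add: E0_N)

lemma E0_R: "R (E0 x) = E0 (R x)"
  unfolding E0_list by (rule list_comp_commute) (simp add: N_def R_lin R_Z R_Z')

lemma E0_R1: "R1 (E0 x) = E0 (R1 x)"
  unfolding E0_list by (rule list_comp_commute) (simp add: N_def R1_lin R1_Z R1_Z')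

lemma E0_norm_le: "norm (E0 x) \<le> norm x"
  by (rule adjoint_projection_norm_le[OF E0_adj E0_idem])

text \<open>The entries of the joint defect operator contain only the factors with index different
  from \<open>i\<close> and \<open>j\<close>. On vectors independent of the \<open>j\<close>-th
  variable the factor \<open>N j\<close> acts as the identity, and \<open>N i\<close> will be
  absorbed by \<open>Bs i\<close>.\<close>

lemma E0_eq_N_list:
  assumes "Z' j b = 0" "set xs = UNIV - {i, j}"
  shows "E0 b = N i (list_comp xs N b)"
proof -
  define y where "y = list_comp xs N b"
  have y: "Z' k y = 0" if "k \<noteq> i" for k
  proof (cases "k = j")
    case True
    have "Z' j y = list_comp xs N (Z' j b)" unfolding y_def by (rule list_N_Z') (use assms(2) in auto)
    also have "\<dots> = 0" unfolding assms(1) by (rule list_N_id) (simp add: Z'_lin)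
    finally show ?thesis using True by simp
  next
    case False
    then show ?thesis using that assms(2) unfolding y_def by (intro Z'_list_N) auto
  qed
  have "Z' k (N i y) = 0" for k
  proof (cases "k = i")
    case True
    then show ?thesis by (simp add: Z'_N)
  next
    case False
    then show ?thesis using y[of k] by (simp add: N_Z' N_lin)
  qed
  then have "E0 (N i y) = N i y" by (rule E0_id)
  then show ?thesis by (simp add: E0_N E0_list_N y_def)
qed

subsection \<open>The Szego defect operator\<close>

lemma T_pow: "(T i ^^ m) (P w) = P ((Z i ^^ m) w)"
  by (induction m) (simp_all add: T_def P_Z_P)

lemma list_T_pow: "list_comp xs (\<lambda>i. T i ^^ k i) (P w) = P (list_comp xs (\<lambda>i. Z i ^^ k i) w)"
  by (induction xs) (simp_all add: T_pow)

text \<open>All adjoints stand to the right in \<open>szego_inv\<close>. Double commutativity lets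
  each \<open>Z' a\<close> travel left past the other shifts until it meets its own
  \<open>Z a\<close>.\<close>

lemma list_Z_Z':
  fixes k :: "'n \<Rightarrow> nat"
  assumes "distinct xs" "\<And>i. k i \<le> 1"
  shows "list_comp xs (\<lambda>i. Z i ^^ k i) (list_comp xs (\<lambda>i. Z' i ^^ k i) x) =
    list_comp xs (\<lambda>i x. if k i = 1 then Z i (Z' i x) else x) x"
  using assms(1)
proof (induction xs)
  case (Cons a xs)
  show ?case
  proof (cases "k a = 1")
    case True
    have "list_comp xs (\<lambda>i. Z i ^^ k i) (Z' a y) = Z' a (list_comp xs (\<lambda>i. Z i ^^ k i) y)" for y
    proof (rule list_comp_commute[symmetric])
      fix i x assume "i \<in> set xs"
      then have "i \<noteq> a" "k i = 0 \<or> k i = 1" using Cons.prems assms(2)[of i] by auto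
      then show "Z' a ((Z i ^^ k i) x) = (Z i ^^ k i) (Z' a x)" by (auto simp: Z_dcomm)
    qed
    with Cons True show ?thesis by simp
  next
    case False
    then have "k a = 0" using assms(2)[of a] by linarith
    with Cons show ?thesis by simp
  qed
qed simp

lemma list_N_expand:
  "distinct xs \<Longrightarrow> list_comp xs N x =
    (\<Sum>K\<in>Pow (set xs). (-1) ^ card K *\<^sub>R list_comp xs (\<lambda>i x. if i \<in> K then Z i (Z' i x) else x) x)"
proof (induction xs)
  case (Cons a xs)
  define q where "q K ys = list_comp ys (\<lambda>i x. if i \<in> K then Z i (Z' i x) else x) x" for K ys
  have q_insert: "q (insert a K) xs = q K xs" for K
  proof -
    have "list_comp ys (\<lambda>i x. if i \<in> insert a K then Z i (Z' i x) else x) x =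
      list_comp ys (\<lambda>i x. if i \<in> K then Z i (Z' i x) else x) x" if "a \<notin> set ys" for ys
      using that by (induction ys) auto
    then show ?thesis using Cons.prems by (simp add: q_def)
  qed
  let ?s = "\<lambda>K. (-1) ^ card K :: real"
  have IH: "list_comp xs N x = (\<Sum>K\<in>Pow (set xs). ?s K *\<^sub>R q K xs)" using Cons by (simp add: q_def)
  have inj: "inj_on (insert a) (Pow (set xs))" using Cons.prems by (auto simp: inj_on_def)
  have "(\<Sum>K\<in>Pow (set (a # xs)). ?s K *\<^sub>R q K (a # xs)) =
    (\<Sum>K\<in>Pow (set xs). ?s K *\<^sub>R q K (a # xs)) + (\<Sum>K\<in>insert a ` Pow (set xs). ?s K *\<^sub>R q K (a # xs))"
    unfolding list.set Pow_insert by (rule sum.union_disjoint) (use Cons.prems in auto)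
  also have "(\<Sum>K\<in>Pow (set xs). ?s K *\<^sub>R q K (a # xs)) = (\<Sum>K\<in>Pow (set xs). ?s K *\<^sub>R q K xs)"
    by (rule sum.cong) (use Cons.prems in \<open>auto simp: q_def\<close>)
  also have "(\<Sum>K\<in>insert a ` Pow (set xs). ?s K *\<^sub>R q K (a # xs)) =
      (\<Sum>K\<in>Pow (set xs). - (?s K *\<^sub>R Z a (Z' a (q K xs))))"
    unfolding sum.reindex[OF inj] o_def
  proof (rule sum.cong[OF refl])
    fix K assume "K \<in> Pow (set xs)"
    then have "a \<notin> K" "finite K" using Cons.prems by (auto intro: finite_subset)
    then have "?s (insert a K) = - ?s K" by simp
    moreover have "q (insert a K) (a # xs) = Z a (Z' a (q K xs))"
      using q_insert[of K] by (simp add: q_def)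
    ultimately show "?s (insert a K) *\<^sub>R q (insert a K) (a # xs) = - (?s K *\<^sub>R Z a (Z' a (q K xs)))"
      by simp
  qed
  also have "(\<Sum>K\<in>Pow (set xs). ?s K *\<^sub>R q K xs) + (\<Sum>K\<in>Pow (set xs). - (?s K *\<^sub>R Z a (Z' a (q K xs)))) =
      N a (\<Sum>K\<in>Pow (set xs). ?s K *\<^sub>R q K xs)"
    by (simp add: N_def Z_lin Z'_lin sum_negf)
  also have "\<dots> = list_comp (a # xs) N x" by (simp only: IH list_comp_simps)
  finally show ?case by (simp only: q_def)
qed simp

text \<open>On \<open>H\<close> the adjoints are backward shifts, and products of the
  \<open>T i\<close> are compressions of products of shifts. What remains under \<open>P\<close> is
  the expansion of the product of the projections \<open>I - Z i Z' i\<close> over subsets of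
  indices.\<close>

lemma szego_inv_eq: assumes x: "x \<in> H" shows "szego_inv H T x = P (E0 x)"
proof -
  define xs :: "'n list" where "xs = sorted_list_of_set UNIV"
  have xs: "distinct xs" "set xs = UNIV" by (simp_all add: xs_def)
  have "szego_inv H T x = (\<Sum>k | range k \<subseteq> {0, 1::nat}. (-1) ^ (\<Sum>i\<in>UNIV. k i) *\<^sub>R
      P (list_comp xs (\<lambda>i x. if k i = 1 then Z i (Z' i x) else x) x))"
    unfolding szego_inv_def
  proof (rule sum.cong[OF refl])
    fix k :: "'n \<Rightarrow> nat" assume k: "k \<in> {k. range k \<subseteq> {0, 1}}"
    then have "k i \<in> {0, 1}" for i by auto
    then have k1: "k i \<le> 1" for i by (metis empty_iff insert_iff le_refl zero_le)
    have "list_comp xs (\<lambda>i. adj H (T i) ^^ k i) x = list_comp xs (\<lambda>i. Z' i ^^ k i) x \<and>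
      list_comp xs (\<lambda>i. Z' i ^^ k i) x \<in> H"
      by (rule list_comp_cong_on) (simp_all add: adj_T_pow x)
    then have "comp_prod UNIV (\<lambda>i. adj H (T i) ^^ k i) x = P (list_comp xs (\<lambda>i. Z' i ^^ k i) x)"
      by (simp add: comp_prod_list_comp xs_def HD)
    then show "(-1) ^ (\<Sum>i\<in>UNIV. k i) *\<^sub>R
        comp_prod UNIV (\<lambda>i. T i ^^ k i) (comp_prod UNIV (\<lambda>i. adj H (T i) ^^ k i) x) =
      (-1) ^ (\<Sum>i\<in>UNIV. k i) *\<^sub>R P (list_comp xs (\<lambda>i x. if k i = 1 then Z i (Z' i x) else x) x)"
      using list_Z_Z'[OF xs(1) k1, where x = x]
      by (simp add: comp_prod_list_comp xs_def[symmetric] list_T_pow)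
  qed
  also have "\<dots> = (\<Sum>K\<in>Pow UNIV. (-1) ^ card K *\<^sub>R
      P (list_comp xs (\<lambda>i x. if i \<in> K then Z i (Z' i x) else x) x))"
  proof (rule sum.reindex_bij_witness[where j = "\<lambda>k. {i. k i = 1}" and i = "\<lambda>K i. if i \<in> K then 1 else 0"])
    fix k :: "'n \<Rightarrow> nat" assume k: "k \<in> {k. range k \<subseteq> {0, 1}}"
    have k1: "k i = (if k i = 1 then 1 else 0)" for i
    proof -
      have "k i \<in> {0, 1}" using k by auto
      then show ?thesis by auto
    qed
    show "(\<lambda>i. if i \<in> {i. k i = 1} then 1 else 0) = k"
      by (rule ext) (simp only: mem_Collect_eq k1[symmetric])
    have "(\<Sum>i\<in>UNIV. k i) = (\<Sum>i\<in>UNIV. if k i = 1 then 1 else 0)"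
      by (rule sum.cong[OF refl]) (rule k1)
    then have "(\<Sum>i\<in>UNIV. k i) = card {i. k i = 1}" by (simp add: sum.If_cases)
    then show "(-1) ^ card {i. k i = 1} *\<^sub>R
        P (list_comp xs (\<lambda>i x. if i \<in> {i. k i = 1} then Z i (Z' i x) else x) x) =
      (-1) ^ (\<Sum>i\<in>UNIV. k i) *\<^sub>R P (list_comp xs (\<lambda>i x. if k i = 1 then Z i (Z' i x) else x) x)"
      by simp
  qed auto
  also have "\<dots> = P (E0 x)"
    using list_N_expand[OF xs(1), of x] by (simp add: E0_list xs_def[symmetric] P_lin xs(2))
  finally show ?thesis .
qed

lemma bounded_op_E0: "bounded_op A UNIV E0"
  unfolding bounded_op_def using E0_norm_le by (auto simp: E0_lin intro!: exI[of _ 1])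

text \<open>Against vectors of \<open>H\<close> the projection \<open>P\<close> disappears, and
  \<open>E0\<close> is a self-adjoint idempotent; so the Szego operator has the Gram form of
  \<open>E0\<close>, and its square root is identified with evaluation at 0.\<close>

lemma
  shows nonneg_op_szego_inv: "nonneg_op H (szego_inv H T)"
    and nonneg_op_defect_star: "nonneg_op H (defect_star H T)"
    and defect_star_gram: "x \<in> H \<Longrightarrow> y \<in> H \<Longrightarrow>
      cinner (defect_star H T x) (defect_star H T y) = cinner (E0 x) (E0 y)"
proof -
  have gram: "szego_inv H T x \<in> H" "y \<in> H \<Longrightarrow> cinner (szego_inv H T x) y = cinner (E0 x) (E0 y)"
    if "x \<in> H" for x y
    using adjoint_pairD[OF E0_adj, of "E0 x" y]
    by (simp_all add: szego_inv_eq that adjoint_pairD[OF P_adj] HD)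
  note g = op_sqrt_gram[OF hilbert_carrier_H bounded_op_E0 gram]
  show "nonneg_op H (defect_star H T)"
    and "x \<in> H \<Longrightarrow> y \<in> H \<Longrightarrow>
      cinner (defect_star H T x) (defect_star H T y) = cinner (E0 x) (E0 y)"
    unfolding defect_star_def by (rule g; assumption)+
  show "nonneg_op H (szego_inv H T)"
    unfolding nonneg_op_def
  proof
    show "bounded_op H H (szego_inv H T)"
      unfolding bounded_op_def
    proof (intro conjI ballI allI exI)
      fix x assume x: "x \<in> H"
      show "norm (szego_inv H T x) \<le> 1 * norm x"
        using adjoint_projection_norm_le[OF P_adj P_idem, of "E0 x"] E0_norm_le[of x]
        by (simp add: szego_inv_eq x)
    qed (simp_all add: gram szego_inv_eq H_carrier E0_lin P_lin)
  next
    show "\<forall>x\<in>H. cinner (szego_inv H T x) x \<in> \<real>\<^sub>\<ge>\<^sub>0"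
      by (simp add: gram cinner_self)
  qed
qed

theorem beurling_tuple_T: "beurling_tuple H T"
  unfolding beurling_tuple_def szego_tuple_def
  using commuting_contractions_T nonneg_op_szego_inv C_dot_0_T defect_mult_0 by blast

subsection \<open>The joint defect operator\<close>

definition C :: "('k, 'n) vec \<Rightarrow> 'k" where "C h = E0 (\<Sum>j\<in>UNIV. B j (h $ j))"

text \<open>For \<open>k\<close> different from \<open>i\<close> and \<open>j\<close>, conjugating
  \<open>Bs i F (B j)\<close> by \<open>T k\<close> inserts \<open>Z k Z' k\<close> in the middle:
  \<open>T k\<close> passes through \<open>Bs i\<close> as \<open>Z k\<close>, and its adjoint
  through \<open>B j\<close> as \<open>Z' k\<close>. So \<open>I - Delta\<close> inserts
  \<open>N k\<close>.\<close>

lemma list_Delta: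
  assumes "distinct xs" "i \<notin> set xs" "j \<notin> set xs" "\<And>x. x \<in> H \<Longrightarrow> A x = Bs i (B j x)" "x \<in> H"
  shows "list_comp xs (\<lambda>k A x. A x - Delta H (T k) A x) A x = Bs i (list_comp xs N (B j x))"
  using assms
proof (induction xs arbitrary: x)
  case (Cons k xs)
  then have k: "k \<noteq> i" "k \<noteq> j" "k \<notin> set xs" by auto
  define F where "F = list_comp xs N"
  let ?b = "B j x"
  have FZ: "F (Z' k g) = Z' k (F g)" for g unfolding F_def by (rule list_N_Z'[symmetric, OF k(3)])
  have PZ: "P (Z k (Bs i g)) = Bs i (Z k g)" for g
    unfolding Bs_def P_Z_P M_Z using k(1) by (simp add: Z_dcomm)
  have "list_comp (k # xs) (\<lambda>k A x. A x - Delta H (T k) A x) A x =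
     Bs i (F ?b) - T k (Bs i (F (B j (Z' k x))))"
    using Cons by (simp add: F_def Delta_def adj_T)
  also have "T k (Bs i (F (B j (Z' k x)))) = Bs i (Z k (Z' k (F ?b)))"
    using k by (simp add: T_def PZ B_Z' FZ)
  also have "Bs i (F ?b) - \<dots> = Bs i (N k (F ?b))" by (simp add: N_def Bs_lin)
  finally show ?case by (simp add: F_def)
qed simp

text \<open>\<open>Bs i\<close> vanishes on the range of \<open>Z i\<close>, because
  \<open>Z' i M Z i = M\<close> and \<open>P M = 0\<close>.\<close>

lemma Bs_N: "Bs i (N i g) = Bs i g"
  by (simp add: N_def Bs_lin) (simp add: Bs_def M_Z Z_isom P_M)

lemma defect_entry:
  assumes x: "x \<in> H"
  shows "(if i = j then defect_diag_sq H T j else defect_cross H T i j) x = Bs i (E0 (B j x))"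
proof -
  \<comment> \<open>For \<open>i = j\<close> this is the index set of the diagonal entry, so one
    list serves both cases.\<close>
  define xs where "xs = sorted_list_of_set (UNIV - {i, j})"
  have xs: "distinct xs" "set xs = UNIV - {i, j}" by (simp_all add: xs_def)
  have E0: "Bs i (E0 (B j x)) = Bs i (list_comp xs N (B j x))"
    unfolding E0_eq_N_list[OF Z'_B[OF x] xs(2)] Bs_N ..
  show ?thesis
  proof (cases "i = j")
    case True
    have "defect_diag_sq H T j x = list_comp xs (\<lambda>k A x. A x - Delta H (T k) A x)
        (\<lambda>x. defect H (T j) (defect H (T j) x)) x"
      unfolding defect_diag_sq_def comp_prod_list_comp xs_def using True by simp
    also have "\<dots> = Bs i (list_comp xs N (B j x))"
      by (rule list_Delta[OF xs(1)]) (auto simp: xs(2) True defect_sq x)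
    finally show ?thesis using True E0 by simp
  next
    case False
    have "defect_cross H T i j x = list_comp xs (\<lambda>k A x. A x - Delta H (T k) A x)
        (\<lambda>x. T j (adj H (T i) x) - adj H (T i) (T j x)) x"
      unfolding defect_cross_def comp_prod_list_comp xs_def by simp
    also have "\<dots> = Bs i (list_comp xs N (B j x))"
    proof (rule list_Delta[OF xs(1)])
      fix x assume x: "x \<in> H"
      \<comment> \<open>In the commutator the two terms without \<open>M\<close> cancel by double
        commutativity; the rest is the commutator form of \<open>Bs i\<close> applied to
        \<open>B j x\<close>.\<close>
      have "T j (Z' i x) = Z j (Z' i x) - M (Z' i (B j x))"
        by (simp add: T_def P_def R_Z HD(2)[OF Z'_H[OF x]] B_Z'[OF False, symmetric]) (simp add: B_def)
      moreover have "Z' i (T j x) = Z j (Z' i x) - Z' i (M (B j x))"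
        using False by (simp add: T_def P_def R_Z HD(2)[OF x] Z'_lin Z_dcomm B_def)
      ultimately show "T j (adj H (T i) x) - adj H (T i) (T j x) = Bs i (B j x)"
        by (simp add: adj_T x Bs_eq)
    qed (auto simp: xs(2) x)
    finally show ?thesis using False E0 by simp
  qed
qed

lemma Bs_C_sum: "(\<Sum>j\<in>UNIV. Bs i (E0 (B j (h $ j)))) = Bs i (C h)"
  by (simp add: C_def Bs_lin E0_lin)

lemma big_defect_sq_eq:
  assumes "h \<in> power_carrier H"
  shows "big_defect_sq H T h = (\<chi> i. Bs i (C h))"
proof -
  have hH: "h $ j \<in> H" for j using assms by (simp add: power_carrier_def)
  show ?thesis
    unfolding big_defect_sq_def Bs_C_sum[symmetric] by (simp add: defect_entry hH)
qed

lemma hilbert_carrier_pow: "hilbert_carrier (power_carrier H :: ('k, 'n) vec set)"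
  by (rule hilbert_carrier_power[OF hilbert_carrier_H])

lemma C_norm_le: "norm (C h) \<le> real CARD('n) * norm h"
proof -
  have "norm (C h) \<le> norm (\<Sum>j\<in>UNIV. B j (h $ j))" unfolding C_def by (rule E0_norm_le)
  also have "\<dots> \<le> (\<Sum>j\<in>(UNIV::'n set). norm h)"
    by (rule sum_norm_le) (metis B_norm_le Finite_Cartesian_Product.norm_nth_le order_trans)
  finally show ?thesis by simp
qed

lemma bounded_op_C: "bounded_op (power_carrier H) UNIV C"
  unfolding bounded_op_def C_def[abs_def] using C_norm_le
  by (auto simp: B_lin E0_lin sum.distrib scaleC.sum_right[symmetric] scaleC_vec_def C_def intro!: exI[of _ "real CARD('n)"])

lemma C_adj: assumes "h \<in> power_carrier H" shows "cinner (\<Sum>j\<in>UNIV. B j (h $ j)) g = (\<Sum>j\<in>UNIV. cinner (h $ j) (Bs j g))"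
  using assms by (simp add: cinner.sum_left power_carrier_def B_adj')

lemma
  shows nonneg_op_big_defect: "nonneg_op (power_carrier H) (big_defect H T)"
    and big_defect_gram: "x \<in> power_carrier H \<Longrightarrow> y \<in> power_carrier H \<Longrightarrow>
      cinner (big_defect H T x) (big_defect H T y) = cinner (C x) (C y)"
proof -
  have gram: "big_defect_sq H T x \<in> power_carrier H"
    "y \<in> power_carrier H \<Longrightarrow> cinner (big_defect_sq H T x) y = cinner (C x) (C y)"
    if x: "x \<in> power_carrier H" for x y
  proof -
    show "big_defect_sq H T x \<in> power_carrier H"
      by (simp add: big_defect_sq_eq x) (simp add: power_carrier_def)
    assume y: "y \<in> power_carrier H"
    have "cinner y (big_defect_sq H T x) = (\<Sum>j\<in>UNIV. cinner (y $ j) (Bs j (C x)))"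
      by (simp add: big_defect_sq_eq x cinner_vec_def)
    also have "\<dots> = cinner (\<Sum>j\<in>UNIV. B j (y $ j)) (C x)" by (rule C_adj[OF y, symmetric])
    also have "\<dots> = cinner (C y) (C x)"
      by (simp add: C_def adjoint_pairD[OF E0_adj])
    finally show "cinner (big_defect_sq H T x) y = cinner (C x) (C y)"
      by (metis cinner_commute)
  qed
  note g = op_sqrt_gram[OF hilbert_carrier_pow bounded_op_C gram]
  show "nonneg_op (power_carrier H) (big_defect H T)"
    and "x \<in> power_carrier H \<Longrightarrow> y \<in> power_carrier H \<Longrightarrow>
      cinner (big_defect H T x) (big_defect H T y) = cinner (C x) (C y)"
    unfolding big_defect_def by (rule g; assumption)+
qed

subsection \<open>Point evaluations\<close>

text \<open>The resolvent of a backward shift on the whole ambient space, where commutation with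
  \<open>R\<close>, \<open>M'\<close> and the other shifts is available.\<close>

definition G :: "complex \<Rightarrow> 'n \<Rightarrow> 'k \<Rightarrow> 'k" where "G w k y = (THE x. x - w *\<^sub>C Z' k x = y)"

lemma G_unique:
  assumes "cmod w < 1"
  shows "\<exists>!x. x - w *\<^sub>C Z' k x = y"
proof -
  \<comment> \<open>A fixed point of a map that contracts by the factor
    \<open>cmod w\<close>.\<close>
  have "\<exists>!x. y + w *\<^sub>C Z' k x = x"
  proof (rule banach_fix_type)
    show "\<forall>x x'. dist (y + w *\<^sub>C Z' k x) (y + w *\<^sub>C Z' k x') \<le> cmod w * dist x x'"
    proof (intro allI)
      fix x x'
      have "dist (y + w *\<^sub>C Z' k x) (y + w *\<^sub>C Z' k x') = cmod w * norm (Z' k (x - x'))"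
        by (simp add: dist_norm Z'_lin scaleC.diff_right[symmetric] norm_scaleC)
      also have "\<dots> \<le> cmod w * norm (x - x')" by (intro mult_left_mono Z'_norm_le) simp
      finally show "dist (y + w *\<^sub>C Z' k x) (y + w *\<^sub>C Z' k x') \<le> cmod w * dist x x'"
        by (simp add: dist_norm)
    qed
  qed (use assms in simp_all)
  moreover have "x - w *\<^sub>C Z' k x = y \<longleftrightarrow> y + w *\<^sub>C Z' k x = x" for x
    by (auto simp: algebra_simps)
  ultimately show ?thesis by simp
qed

lemma G_eq: "cmod w < 1 \<Longrightarrow> G w k y - w *\<^sub>C Z' k (G w k y) = y"
  unfolding G_def by (rule theI'[OF G_unique])

lemma G_eqI: "cmod w < 1 \<Longrightarrow> x - w *\<^sub>C Z' k x = y \<Longrightarrow> G w k y = x"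
  unfolding G_def by (rule the1_equality[OF G_unique])

lemma G_lin:
  assumes "cmod w < 1"
  shows "G w k (x + y) = G w k x + G w k y" "G w k (c *\<^sub>C x) = c *\<^sub>C G w k x" "G w k 0 = 0"
proof -
  show "G w k (x + y) = G w k x + G w k y"
  proof (rule G_eqI[OF assms])
    have "G w k x + G w k y - w *\<^sub>C Z' k (G w k x + G w k y) =
      (G w k x - w *\<^sub>C Z' k (G w k x)) + (G w k y - w *\<^sub>C Z' k (G w k y))"
      by (simp add: Z'_lin scaleC_add_right)
    then show "G w k x + G w k y - w *\<^sub>C Z' k (G w k x + G w k y) = x + y"
      by (simp only: G_eq[OF assms])
  qed
  show "G w k (c *\<^sub>C x) = c *\<^sub>C G w k x"
  proof (rule G_eqI[OF assms])
    have "c *\<^sub>C G w k x - w *\<^sub>C Z' k (c *\<^sub>C G w k x) = c *\<^sub>C (G w k x - w *\<^sub>C Z' k (G w k x))"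
      by (simp add: Z'_lin scaleC.diff_right scaleC_scaleC mult.commute)
    then show "c *\<^sub>C G w k x - w *\<^sub>C Z' k (c *\<^sub>C G w k x) = c *\<^sub>C x"
      by (simp only: G_eq[OF assms])
  qed
  show "G w k 0 = 0" by (rule G_eqI[OF assms]) (simp add: Z'_lin scaleC.zero_right)
qed

lemma G_norm_le: "cmod w < 1 \<Longrightarrow> norm (G w k y) \<le> norm y / (1 - cmod w)"
proof -
  assume w: "cmod w < 1"
  have "norm (G w k y) - norm (w *\<^sub>C Z' k (G w k y)) \<le> norm y"
    using norm_triangle_ineq2[of "G w k y" "w *\<^sub>C Z' k (G w k y)"] by (simp add: G_eq[OF w])
  moreover have "norm (w *\<^sub>C Z' k (G w k y)) \<le> cmod w * norm (G w k y)"
    unfolding norm_scaleC by (intro mult_left_mono Z'_norm_le) simp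
  ultimately have "(1 - cmod w) * norm (G w k y) \<le> norm y" by (simp add: algebra_simps)
  then show ?thesis using w by (simp add: pos_le_divide_eq mult.commute)
qed

lemma G_commute:
  assumes w: "cmod w < 1"
    and F: "\<And>x y. F (x - y) = F x - F y" "\<And>c x. F (c *\<^sub>C x) = c *\<^sub>C F x" "\<And>x. F (Z' k x) = Z' k (F x)"
  shows "F (G w k y) = G w k (F y)"
proof (rule sym, rule G_eqI[OF w])
  have "F (G w k y) - w *\<^sub>C Z' k (F (G w k y)) = F (G w k y - w *\<^sub>C Z' k (G w k y))"
    by (simp add: F)
  then show "F (G w k y) - w *\<^sub>C Z' k (F (G w k y)) = F y"
    by (simp only: G_eq[OF w])
qed

lemma G_H: assumes w: "cmod w < 1" and y: "y \<in> H" shows "G w k y \<in> H"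
proof (rule HI)
  have "R (G w k y) = G w k (R y)" by (rule G_commute[OF w]) (simp_all add: R_lin R_Z')
  then show "R (G w k y) = G w k y" by (simp add: HD y)
  have "M' (G w k y) = G w k (M' y)" by (rule G_commute[OF w]) (simp_all add: M'_lin M'_Z')
  then show "M' (G w k y) = 0" by (simp add: HD y G_lin w)
qed

lemma G_Z: "cmod w < 1 \<Longrightarrow> G w k (Z k y) = Z k y + w *\<^sub>C G w k y"
proof (rule G_eqI)
  assume w: "cmod w < 1"
  have "Z k y + w *\<^sub>C G w k y - w *\<^sub>C Z' k (Z k y + w *\<^sub>C G w k y) =
    Z k y + w *\<^sub>C (G w k y - w *\<^sub>C Z' k (G w k y)) - w *\<^sub>C y"
    by (simp add: Z'_lin Z_isom scaleC_add_right scaleC.diff_right)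
  then show "Z k y + w *\<^sub>C G w k y - w *\<^sub>C Z' k (Z k y + w *\<^sub>C G w k y) = Z k y"
    by (simp only: G_eq[OF w]) simp
qed

text \<open>Point evaluation: expanding the resolvents as geometric series gives the sum of z^k
  times the backward shifts by \<open>k\<close>, and \<open>E0\<close> picks the constant term of
  each, the \<open>k\<close>-th Taylor coefficient. The value is returned as a constant
  function.\<close>

definition ev :: "(complex, 'n) vec \<Rightarrow> 'k \<Rightarrow> 'k"
  where "ev z x = E0 (comp_prod UNIV (\<lambda>k. G (z $ k) k) x)"

lemma bounded_op_list_G:
  assumes w: "\<And>k. cmod (w k) < 1"
  shows "bounded_op UNIV UNIV (list_comp xs (\<lambda>k. G (w k) k))"
proof (induction xs)
  case Nil
  then show ?case by (auto simp: bounded_op_def intro!: exI[of _ 1])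
next
  case (Cons k xs)
  obtain K where K: "\<And>x. norm (list_comp xs (\<lambda>k. G (w k) k) x) \<le> K * norm x"
    using Cons unfolding bounded_op_def by blast
  have "norm (list_comp (k # xs) (\<lambda>k. G (w k) k) x) \<le> (K / (1 - cmod (w k))) * norm x" for x
  proof -
    have "norm (list_comp (k # xs) (\<lambda>k. G (w k) k) x) \<le> norm (list_comp xs (\<lambda>k. G (w k) k) x) / (1 - cmod (w k))"
      by (simp add: G_norm_le[OF w])
    also have "\<dots> \<le> (K * norm x) / (1 - cmod (w k))"
      using w[of k] by (intro divide_right_mono K) simp
    finally show ?thesis by simp
  qed
  then show ?case
    using Cons unfolding bounded_op_def
    by (intro conjI exI[of _ "K / (1 - cmod (w k))"]) (auto simp: G_lin[OF w])
qed

text \<open>Since \<open>(I - w Z' k) Z k\<close> equals \<open>Z k - w\<close>, the resolvent turns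
  \<open>Z k\<close> into multiplication by \<open>w\<close> up to a vector in the range of
  \<open>Z k\<close>. Such a remainder \<open>Z j u\<close> is annihilated by
  \<open>E0\<close>.\<close>

lemma list_G_Z:
  assumes w: "\<And>k. cmod (w k) < 1" and "distinct xs" "j \<in> set xs"
  shows "\<exists>u. list_comp xs (\<lambda>k. G (w k) k) (Z j x) = Z j u + w j *\<^sub>C list_comp xs (\<lambda>k. G (w k) k) x"
  using assms(2,3)
proof (induction xs)
  case (Cons k xs)
  have comm: "G (w k) k (Z i y) = Z i (G (w k) k y)" if "i \<noteq> k" for i k y
    by (rule G_commute[OF w, symmetric]) (use that in \<open>simp_all add: Z_lin Z_dcomm\<close>)
  show ?case
  proof (cases "j = k")
    case True
    then have "list_comp xs (\<lambda>k. G (w k) k) (Z j x) = Z j (list_comp xs (\<lambda>k. G (w k) k) x)"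
    proof (intro list_comp_commute[symmetric])
      fix i x assume "i \<in> set xs"
      then have "j \<noteq> i" using Cons.prems True by auto
      then show "Z j (G (w i) i x) = G (w i) i (Z j x)" by (rule comm[symmetric])
    qed
    then show ?thesis using True by (auto simp: G_Z[OF w])
  next
    case False
    then obtain u where "list_comp xs (\<lambda>k. G (w k) k) (Z j x) = Z j u + w j *\<^sub>C list_comp xs (\<lambda>k. G (w k) k) x"
      using Cons by auto
    then show ?thesis using False by (auto simp: G_lin[OF w] comm)
  qed
qed simp

lemma ev_list: "ev z x = E0 (list_comp (sorted_list_of_set UNIV) (\<lambda>k. G (z $ k) k) x)"
  by (simp add: ev_def comp_prod_list_comp)

context
  fixes z :: "(complex, 'n) vec"
  assumes z: "z \<in> polydisc"
begin

lemma zk: "cmod (z $ k) < 1"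
  using z by (simp add: polydisc_def)

lemma bounded_op_ev: "bounded_op UNIV UNIV (ev z)"
proof -
  note b = bounded_op_list_G[of "\<lambda>k. z $ k" "sorted_list_of_set UNIV", OF zk]
  obtain K where K: "\<And>x. norm (list_comp (sorted_list_of_set UNIV) (\<lambda>k. G (z $ k) k) x) \<le> K * norm x"
    using b unfolding bounded_op_def by blast
  have "norm (ev z x) \<le> K * norm x" for x
    unfolding ev_list by (rule order_trans[OF E0_norm_le K])
  then show ?thesis
    using b unfolding bounded_op_def ev_list[abs_def] by (auto simp: E0_lin)
qed

lemma ev_lin: "ev z (x + y) = ev z x + ev z y" "ev z (x - y) = ev z x - ev z y" "ev z (c *\<^sub>C x) = c *\<^sub>C ev z x"
  "ev z (sum f I) = (\<Sum>i\<in>I. ev z (f i))"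
proof -
  show add: "ev z (x + y) = ev z x + ev z y" for x y using bounded_opD(2)[OF bounded_op_ev] by simp
  show scale: "ev z (c *\<^sub>C x) = c *\<^sub>C ev z x" for c x using bounded_opD(3)[OF bounded_op_ev] by simp
  show "ev z (x - y) = ev z x - ev z y" using add[of "x - y" y] by simp
  have "ev z 0 = 0" using add[of 0 0] by simp
  then show "ev z (sum f I) = (\<Sum>i\<in>I. ev z (f i))"
    by (induction I rule: infinite_finite_induct) (simp_all add: add)
qed

lemma ev_Z: "ev z (Z j x) = (z $ j) *\<^sub>C ev z x"
proof -
  obtain u where "list_comp (sorted_list_of_set UNIV) (\<lambda>k. G (z $ k) k) (Z j x) =
    Z j u + (z $ j) *\<^sub>C list_comp (sorted_list_of_set UNIV) (\<lambda>k. G (z $ k) k) x"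
    using list_G_Z[of "\<lambda>k. z $ k" "sorted_list_of_set UNIV" j x] zk by auto
  then show ?thesis by (simp add: ev_list E0_lin E0_Z)
qed

lemma ev_const: assumes "E0 x = x" shows "ev z x = x"
proof -
  have "Z' k x = 0" for k using Z'_E0[of k x] assms by simp
  then have "G (z $ k) k x = x" for k by (intro G_eqI zk) (simp add: scaleC.zero_right)
  then have "list_comp xs (\<lambda>k. G (z $ k) k) x = x" for xs by (induction xs) simp_all
  then show ?thesis by (simp add: ev_list assms)
qed

text \<open>The inverses in \<open>char_fun\<close> are taken on \<open>H\<close> alone;
  \<open>G\<close> leaves \<open>H\<close> invariant and solves the same uniquely solvable
  equation.\<close>

lemma comp_inv_into:
  assumes "y \<in> H"
  shows "comp_prod UNIV (\<lambda>k. inv_into H (\<lambda>x. x - (z $ k) *\<^sub>C adj H (T k) x)) y =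
      comp_prod UNIV (\<lambda>k. G (z $ k) k) y \<and> comp_prod UNIV (\<lambda>k. G (z $ k) k) y \<in> H"
  unfolding comp_prod_list_comp
proof (rule list_comp_cong_on[OF _ assms], rule conjI)
  fix k y assume y: "y \<in> H"
  show G: "G (z $ k) k y \<in> H" by (rule G_H[OF zk y])
  show "inv_into H (\<lambda>x. x - (z $ k) *\<^sub>C adj H (T k) x) y = G (z $ k) k y"
  proof (rule inv_into_f_eq[OF _ G])
    show "inj_on (\<lambda>x. x - (z $ k) *\<^sub>C adj H (T k) x) H"
    proof (rule inj_onI)
      fix x x' assume x: "x \<in> H" "x' \<in> H" "x - (z $ k) *\<^sub>C adj H (T k) x = x' - (z $ k) *\<^sub>C adj H (T k) x'"
      then have "G (z $ k) k (x' - (z $ k) *\<^sub>C Z' k x') = x" by (intro G_eqI zk) (simp add: adj_T)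
      moreover have "G (z $ k) k (x' - (z $ k) *\<^sub>C Z' k x') = x'" by (intro G_eqI zk) simp
      ultimately show "x = x'" by simp
    qed
    show "G (z $ k) k y - (z $ k) *\<^sub>C adj H (T k) (G (z $ k) k y) = y"
      by (simp add: adj_T G G_eq zk)
  qed
qed

lemma list_D_G:
  "list_comp xs (\<lambda>i x. x - (z $ i) *\<^sub>C Z' i x) (list_comp xs (\<lambda>k. G (z $ k) k) y) = y"
proof (induction xs)
  case (Cons k xs)
  let ?D = "\<lambda>i x. x - (z $ i) *\<^sub>C Z' i x"
  have "G (z $ k) k (list_comp xs ?D x) = list_comp xs ?D (G (z $ k) k x)" for x
  proof (rule list_comp_commute)
    fix i x
    show "G (z $ k) k (?D i x) = ?D i (G (z $ k) k x)"
      by (rule G_commute[OF zk, symmetric])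
        (simp_all add: Z'_lin Z'_comm scaleC.diff_right scaleC_scaleC mult.commute algebra_simps)
  qed
  then have "list_comp (k # xs) ?D (list_comp (k # xs) (\<lambda>k. G (z $ k) k) y) =
      ?D k (G (z $ k) k (list_comp xs ?D (list_comp xs (\<lambda>k. G (z $ k) k) y)))"
    by simp
  then show ?case by (simp only: Cons G_eq[OF zk])
qed simp

text \<open>The hypothesis exchanges only the outermost factor. After each exchange
  \<open>N k\<close> is commuted to the inside, where it becomes part of the argument and exposes
  the next factor.\<close>

lemma list_D_eq_list_N:
  assumes "distinct xs" and step: "\<And>k y. \<phi> (y - (z $ k) *\<^sub>C Z' k y) = \<phi> (N k y)"
  shows "\<phi> (list_comp xs (\<lambda>i x. x - (z $ i) *\<^sub>C Z' i x) x) = \<phi> (list_comp xs N x)"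
  using assms(1)
proof (induction xs arbitrary: x)
  case (Cons k xs)
  let ?D = "\<lambda>i x. x - (z $ i) *\<^sub>C Z' i x"
  have comm: "N k (list_comp xs ?D y) = list_comp xs ?D (N k y)" for y
  proof (rule list_comp_commute)
    fix l x assume "l \<in> set xs"
    then have "l \<noteq> k" using Cons.prems by auto
    then show "N k (?D l x) = ?D l (N k x)" by (simp add: N_lin N_Z')
  qed
  have "\<phi> (list_comp (k # xs) ?D x) = \<phi> (list_comp xs ?D (N k x))"
    by (simp only: list_comp_simps step comm)
  also have "\<dots> = \<phi> (list_comp (k # xs) N x)"
    using Cons by (simp add: list_N_N)
  finally show ?case .
qed simp

text \<open>A functional that turns \<open>Z i\<close> into multiplication by \<open>z $ i\<close> cannot distinguish
  \<open>I - z $ i * Z' i\<close> from \<open>I - Z i * Z' i\<close>.\<close>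

lemma functional_ev:
  assumes "\<And>k y. \<phi> (y - (z $ k) *\<^sub>C Z' k y) = \<phi> (N k y)"
  shows "\<phi> y = \<phi> (ev z y)"
  using list_D_eq_list_N[of "sorted_list_of_set UNIV" \<phi> "list_comp (sorted_list_of_set UNIV) (\<lambda>k. G (z $ k) k) y"] assms
  by (simp add: list_D_G ev_list E0_list)

lemma ev_M_list:
  assumes "distinct xs"
  shows "ev z (M (list_comp xs (\<lambda>i x. x - (z $ i) *\<^sub>C Z' i x) x)) = ev z (M (list_comp xs N x))"
  by (rule list_D_eq_list_N[OF assms, of "\<lambda>x. ev z (M x)"]) (simp add: N_def M_lin ev_lin M_Z ev_Z)

text \<open>Evaluation annihilates \<open>z $ j - Z j\<close>, so from each summand only the part
  removed by the compression survives, \<open>M (B j u)\<close>. The factors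
  \<open>I - z $ i * Z' i\<close> pass through \<open>B j\<close>, are exchanged for
  \<open>N i\<close> under the evaluation, and on \<open>B j (h $ j)\<close>, which is independent
  of the \<open>j\<close>-th variable, they multiply to \<open>E0\<close>.\<close>

lemma
  assumes h: "h \<in> power_carrier H"
  defines "y \<equiv> (\<Sum>j\<in>UNIV. (\<lambda>x. (z $ j) *\<^sub>C x - T j x)
              (comp_prod (UNIV - {j}) (\<lambda>i x. x - (z $ i) *\<^sub>C adj H (T i) x) (h $ j)))"
  shows char_sum_mem: "y \<in> H" and char_sum_ev: "ev z y = ev z (M (C h))"
proof -
  have hH: "h $ j \<in> H" for j using h by (simp add: power_carrier_def)
  define D where "D = (\<lambda>i x. x - (z $ i) *\<^sub>C Z' i x)"
  define u where "u j = comp_prod (UNIV - {j}) (\<lambda>i x. x - (z $ i) *\<^sub>C adj H (T i) x) (h $ j)" for j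
  have u: "u j = list_comp (sorted_list_of_set (UNIV - {j})) D (h $ j)
      \<and> list_comp (sorted_list_of_set (UNIV - {j})) D (h $ j) \<in> H" for j
    unfolding u_def comp_prod_list_comp
    by (rule list_comp_cong_on[OF _ hH]) (simp add: D_def adj_T H_carrier)
  have uH: "u j \<in> H" for j using u[of j] by simp
  have y: "y = (\<Sum>j\<in>UNIV. (z $ j) *\<^sub>C u j - T j (u j))" by (simp add: y_def u_def)
  show "y \<in> H" unfolding y by (intro hilbert_carrier_sum[OF hilbert_carrier_H] H_carrier uH T_H)
  have "ev z ((z $ j) *\<^sub>C u j - T j (u j)) = ev z (M (E0 (B j (h $ j))))" for j
  proof -
    have "ev z ((z $ j) *\<^sub>C u j - T j (u j)) = ev z (M (B j (u j)))"
      by (simp add: T_def P_def R_Z HD uH ev_lin ev_Z B_def)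
    also have "B j (u j) = list_comp (sorted_list_of_set (UNIV - {j})) D (B j (h $ j))"
    proof -
      have "B j (list_comp (sorted_list_of_set (UNIV - {j})) D (h $ j)) =
          list_comp (sorted_list_of_set (UNIV - {j})) D (B j (h $ j))"
        by (rule list_comp_commute) (auto simp: D_def B_lin B_Z')
      then show ?thesis using u[of j] by simp
    qed
    also have "ev z (M \<dots>) = ev z (M (list_comp (sorted_list_of_set (UNIV - {j})) N (B j (h $ j))))"
      unfolding D_def by (rule ev_M_list) simp
    also have "list_comp (sorted_list_of_set (UNIV - {j})) N (B j (h $ j)) = E0 (B j (h $ j))"
    proof -
      define v where "v = list_comp (sorted_list_of_set (UNIV - {j})) N (B j (h $ j))"
      have "Z' j v = list_comp (sorted_list_of_set (UNIV - {j})) N 0"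
        unfolding v_def by (subst list_N_Z') (simp_all add: Z'_B hH)
      also have "\<dots> = 0" by (rule list_N_id) (simp add: Z'_lin)
      finally have "N j v = v" by (rule N_id)
      moreover have "E0 (B j (h $ j)) = N j v"
        unfolding v_def by (rule E0_eq_N_list[of j]) (simp_all add: Z'_B hH)
      ultimately show ?thesis by (simp add: v_def)
    qed
    finally show ?thesis .
  qed
  then show "ev z y = ev z (M (C h))"
    by (simp add: y ev_lin C_def E0_lin M_lin)
qed

end

subsection \<open>The characteristic function\<close>

text \<open>Copies of the two coefficient spaces inside the ambient space: the constant functions of
  the source and of the target Hardy space. \<open>F\<close> collects the constants that
  multiplication by the inner function keeps constant.\<close>

definition W1 where "W1 = {x. E0 x = x} \<inter> {x. R1 x = x}"
definition W where "W = {x. E0 x = x} \<inter> {x. R x = x}"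
definition F where "F = W1 \<inter> {x. E0 (M x) = M x}"

lemma hilbert_carrier_W: "hilbert_carrier W" and hilbert_carrier_W1: "hilbert_carrier W1"
  and hilbert_carrier_F: "hilbert_carrier F"
  unfolding W1_def W_def F_def
  by (intro hilbert_carrier_Int adjoint_pair_hilbert_carrier[OF E0_adj adjoint_pair_id]
      adjoint_pair_hilbert_carrier[OF R1_adj adjoint_pair_id]
      adjoint_pair_hilbert_carrier[OF R_adj adjoint_pair_id]
      adjoint_pair_hilbert_carrier[OF adjoint_pair_comp[OF E0_adj M_adj] M_adj])+

lemma C_W1: "h \<in> power_carrier H \<Longrightarrow> C h \<in> W1"
proof -
  have "R1 (\<Sum>j\<in>UNIV. B j (h $ j)) = (\<Sum>j\<in>UNIV. B j (h $ j))"
    by (simp add: R1_lin) (simp add: B_def R1_M')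
  then show ?thesis by (simp add: W1_def C_def E0_R1)
qed

lemma E0_W: "h \<in> H \<Longrightarrow> E0 h \<in> W"
  by (simp add: W_def E0_R HD)

lemma closure_C_W1: "closure (C ` power_carrier H) \<subseteq> W1"
  by (rule closure_minimal) (use C_W1 hilbert_carrierD(4)[OF hilbert_carrier_W1] in auto)

lemma closure_E0_W: "closure (E0 ` H) \<subseteq> W"
  by (rule closure_minimal) (use E0_W hilbert_carrierD(4)[OF hilbert_carrier_W] in auto)

lemma closed_orthogonal: "closed {s. cinner s x = 0}"
  by (intro closed_Collect_eq cinner.continuous_on continuous_intros)

lemma orthogonal_closure:
  assumes "\<And>a. a \<in> A \<Longrightarrow> cinner a x = 0" "s \<in> closure A"
  shows "cinner s x = 0"
proof -
  have "closure A \<subseteq> {s. cinner s x = 0}"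
    by (rule closure_minimal) (use assms(1) closed_orthogonal in auto)
  then show ?thesis using assms(2) by blast
qed

lemma Bs_F: assumes "x \<in> F" shows "Bs j x = 0"
proof -
  have x: "E0 x = x" "E0 (M x) = M x" using assms by (auto simp: F_def W1_def)
  have "Z' j x = 0" "Z' j (M x) = 0" using Z'_E0[of j x] Z'_E0[of j "M x"] x by simp_all
  then show ?thesis by (simp add: Bs_eq M_lin)
qed

lemma F_orthogonal: assumes "x \<in> F" "s \<in> closure (C ` power_carrier H)" shows "cinner s x = 0"
proof (rule orthogonal_closure[OF _ assms(2)])
  fix a assume "a \<in> C ` power_carrier H"
  then obtain h where h: "h \<in> power_carrier H" "a = C h" by blast
  have "cinner a x = cinner (\<Sum>j\<in>UNIV. B j (h $ j)) x"
    using assms(1) by (simp add: h C_def adjoint_pairD[OF E0_adj] F_def W1_def)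
  also have "\<dots> = 0" by (simp add: C_adj[OF h(1)] Bs_F[OF assms(1)] cinner.zero_right)
  finally show "cinner a x = 0" .
qed

text \<open>Tuples with a single nonzero entry \<open>y\<close> turn orthogonality to the range of
  \<open>C\<close> into orthogonality of \<open>Bs j x\<close> to all of \<open>H\<close>. As
  \<open>Bs j x\<close> lies in \<open>H\<close>, it vanishes; for constant \<open>x\<close> it
  equals \<open>Z' j (M x)\<close>, so \<open>M x\<close> is constant.\<close>

lemma F_complement:
  assumes x: "x \<in> W1" "\<And>s. s \<in> closure (C ` power_carrier H) \<Longrightarrow> cinner s x = 0"
  shows "x \<in> F"
proof -
  have x1: "E0 x = x" using x(1) by (simp add: W1_def)
  have "Z' j (M x) = 0" for j
  proof -
    have "cinner y (Bs j x) = 0" if y: "y \<in> H" for y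
    proof -
      define h :: "('k, 'n) vec" where "h = (\<chi> i. if i = j then y else 0)"
      have h: "h \<in> power_carrier H" using y by (simp add: h_def power_carrier_def H_carrier)
      have "(\<Sum>i\<in>UNIV. B i (h $ i)) = (\<Sum>i\<in>UNIV. if i = j then B j y else 0)"
        by (rule sum.cong) (auto simp: h_def B_lin)
      then have "C h = E0 (B j y)" by (simp add: C_def)
      moreover have "cinner (C h) x = 0"
        by (rule x(2)) (rule subsetD[OF closure_subset imageI[OF h]])
      ultimately show ?thesis using y by (simp add: B_adj' adjoint_pairD[OF E0_adj] x1)
    qed
    from this[OF Bs_H[of j x]] have "Bs j x = 0" by (simp add: cinner_eq_0_norm)
    moreover have "Z' j x = 0" using Z'_E0[of j x] x1 by simp
    ultimately show ?thesis by (simp add: Bs_eq M_lin)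
  qed
  then have "E0 (M x) = M x" by (rule E0_id)
  then show ?thesis using x(1) by (simp add: F_def)
qed

lemma MF_orthogonal: assumes "x \<in> F" "s \<in> closure (E0 ` H)" shows "cinner s (M x) = 0"
proof (rule orthogonal_closure[OF _ assms(2)])
  fix a assume "a \<in> E0 ` H"
  then obtain h where h: "h \<in> H" "a = E0 h" by blast
  have "cinner a (M x) = cinner h (M x)"
    using assms(1) by (simp add: h adjoint_pairD[OF E0_adj] F_def)
  also have "\<dots> = cinner (M' h) x" by (rule adjoint_pairD[OF adjoint_pair_sym[OF M_adj], symmetric])
  finally show "cinner a (M x) = 0" by (simp add: HD h cinner.zero_left)
qed

text \<open>The test vector is \<open>P w\<close>, an element of \<open>H\<close>: since
  \<open>w\<close> is constant, <P w, w> = <E0 (P w), w> = 0. Hence \<open>P w = 0\<close>, and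
  \<open>w\<close> lies in the range of \<open>M\<close>.\<close>

lemma MF_complement:
  assumes w: "w \<in> W" "\<And>s. s \<in> closure (E0 ` H) \<Longrightarrow> cinner s w = 0"
  shows "M' w \<in> F \<and> M (M' w) = w"
proof -
  have w1: "E0 w = w" "R w = w" using w(1) by (auto simp: W_def)
  have "cinner (P w) (P w) = cinner (P w) w" by (metis P_idem adjoint_pairD[OF P_adj])
  also have "\<dots> = cinner (E0 (P w)) w" by (simp add: adjoint_pairD[OF E0_adj] w1)
  also have "\<dots> = 0" using closure_subset[of "E0 ` H"] by (intro w(2)) auto
  finally have "P w = 0" by (simp add: cinner_eq_0_norm)
  then have MM: "M (M' w) = w" by (simp add: P_def w1)
  have "Z' k w = 0" for k using Z'_E0[of k w] w1 by simp
  then have "E0 (M' w) = M' w" by (intro E0_id) (simp add: M'_Z'[symmetric] M'_lin)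
  then show ?thesis by (simp add: F_def W1_def R1_M' MM w1)
qed

lemma MF_W: "x \<in> F \<Longrightarrow> M x \<in> W"
  by (simp add: F_def W_def R_M)

text \<open>The abstract model meets a concrete function: \<open>J\<close> and \<open>Js\<close>
  embed the coefficient spaces as constants, and the last assumption says that \<open>M\<close>
  multiplies by that function.\<close>

theorem inner_function_model:
  fixes J :: "'e::complex_hilbert \<Rightarrow> 'k" and Js :: "'f::complex_hilbert \<Rightarrow> 'k"
    and \<Theta> :: "(complex, 'n) vec \<Rightarrow> 'e \<Rightarrow> 'f"
  assumes J: "adjoint_pair J J'" "\<And>e. J' (J e) = e" "\<And>e. J e \<in> W1" "\<And>x. x \<in> W1 \<Longrightarrow> J (J' x) = x"
    and Js: "adjoint_pair Js Js'" "\<And>f. Js' (Js f) = f" "\<And>f. Js f \<in> W" "\<And>x. x \<in> W \<Longrightarrow> Js (Js' x) = x"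
    and \<Theta>: "\<And>z e. z \<in> polydisc \<Longrightarrow> Js (\<Theta> z e) = ev z (M (J e))"
  obtains \<sigma> \<sigma>s where
    "unitary_op UNIV (big_defect_space H T \<times> F) \<sigma>"
    "unitary_op UNIV (defect_star_space H T \<times> F) \<sigma>s"
    "\<And>z e. z \<in> polydisc \<Longrightarrow> \<Theta> z e = adj UNIV \<sigma>s (map_prod (char_fun H T z) id (\<sigma> e))"
proof -
  let ?pow = "power_carrier H :: ('k, 'n) vec set"
  define SC where "SC = closure (C ` ?pow)"
  define SL where "SL = closure (E0 ` H)"
  define BD where "BD = big_defect_space H T"
  define SD where "SD = defect_star_space H T"
  have bD: "bounded_op ?pow ?pow (big_defect H T)" and bS: "bounded_op H H (defect_star H T)"
    using nonneg_op_big_defect nonneg_op_defect_star by (simp_all add: nonneg_op_def)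
  have carr: "hilbert_carrier SC" "hilbert_carrier SL" "hilbert_carrier BD" "hilbert_carrier SD"
    unfolding SC_def SL_def BD_def SD_def big_defect_space_def defect_star_space_def
    by (rule hilbert_carrier_closure_image[OF hilbert_carrier_pow bounded_op_C]
        hilbert_carrier_closure_image[OF hilbert_carrier_H bounded_op_E0[of H]]
        hilbert_carrier_closure_image[OF hilbert_carrier_pow bD]
        hilbert_carrier_closure_image[OF hilbert_carrier_H bS])+
  obtain U V where UV: "bounded_op BD SC U" "bounded_op SC BD V"
    "\<And>h. h \<in> ?pow \<Longrightarrow> U (big_defect H T h) = C h" "\<And>h. h \<in> ?pow \<Longrightarrow> V (C h) = big_defect H T h"
    "\<And>u. u \<in> BD \<Longrightarrow> V (U u) = u" "\<And>v. v \<in> SC \<Longrightarrow> U (V v) = v"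
    "\<And>u v. u \<in> BD \<Longrightarrow> v \<in> SC \<Longrightarrow> cinner (U u) v = cinner u (V v)"
    unfolding BD_def SC_def big_defect_space_def
    by (rule isometry_between_range_closures[OF hilbert_carrier_pow bD bounded_op_C big_defect_gram]) blast+
  obtain Us Vs where UVs: "bounded_op SD SL Us" "bounded_op SL SD Vs"
    "\<And>h. h \<in> H \<Longrightarrow> Us (defect_star H T h) = E0 h" "\<And>h. h \<in> H \<Longrightarrow> Vs (E0 h) = defect_star H T h"
    "\<And>u. u \<in> SD \<Longrightarrow> Vs (Us u) = u" "\<And>v. v \<in> SL \<Longrightarrow> Us (Vs v) = v"
    "\<And>u v. u \<in> SD \<Longrightarrow> v \<in> SL \<Longrightarrow> cinner (Us u) v = cinner u (Vs v)"
    unfolding SD_def SL_def defect_star_space_def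
    by (rule isometry_between_range_closures[OF hilbert_carrier_H bS bounded_op_E0 defect_star_gram]) blast+
  \<comment> \<open>The same \<open>F\<close> completes both decompositions: it sits in
    \<open>W1\<close> as itself, hence \<open>id\<close> here, and in \<open>W\<close> through
    \<open>M\<close>, hence \<open>M\<close> and \<open>M'\<close> in the second
    application.\<close>
  obtain \<sigma> where \<sigma>: "unitary_op UNIV (BD \<times> F) \<sigma>"
    "\<And>e. \<exists>a\<in>BD. \<exists>f\<in>F. \<sigma> e = (a, f) \<and> J e = U a + id f"
  proof (rule orthogonal_sum_unitary[OF J hilbert_carrier_W1 carr(1) _ carr(3) hilbert_carrier_F,
        of U V id id])
    show "SC \<subseteq> W1" unfolding SC_def by (rule closure_C_W1)
    show "cinner s (id f) = 0" if "f \<in> F" "s \<in> SC" for f s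
      using F_orthogonal that by (simp add: SC_def)
    show "id x \<in> F \<and> id (id x) = x" if "x \<in> W1" "\<And>s. s \<in> SC \<Longrightarrow> cinner s x = 0" for x
      using F_complement that by (simp add: SC_def)
  qed (use bounded_opD(1)[OF UV(1)] bounded_opD(1)[OF UV(2)] UV(5,6,7) in \<open>auto simp: F_def\<close>)
  obtain \<sigma>s where \<sigma>s: "unitary_op UNIV (SD \<times> F) \<sigma>s"
    "\<And>a f. a \<in> SD \<Longrightarrow> f \<in> F \<Longrightarrow> adj UNIV \<sigma>s (a, f) = Js' (Us a + M f)"
  proof (rule orthogonal_sum_unitary[OF Js hilbert_carrier_W carr(2) _ carr(4) hilbert_carrier_F,
        of Us Vs M M'])
    show "SL \<subseteq> W" unfolding SL_def by (rule closure_E0_W)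
    show "cinner s (M f) = 0" if "f \<in> F" "s \<in> SL" for f s
      using MF_orthogonal that by (simp add: SL_def)
    show "M' x \<in> F \<and> M (M' x) = x" if "x \<in> W" "\<And>s. s \<in> SL \<Longrightarrow> cinner s x = 0" for x
      using MF_complement that by (simp add: SL_def)
    show "M' (M f) = f" if "f \<in> F" for f using that by (simp add: M'_M F_def W1_def)
    show "cinner (M f) x = cinner f (M' x)" for f x by (rule adjoint_pairD[OF M_adj])
  qed (use bounded_opD(1)[OF UVs(1)] bounded_opD(1)[OF UVs(2)] UVs(5,6,7) in \<open>auto simp: MF_W\<close>)
  have char: "char_fun H T z a \<in> SD \<and> Us (char_fun H T z a) = ev z (M (U a))"
    if z: "z \<in> polydisc" and a: "a \<in> BD" for z a
  proof -
    note bev = bounded_op_ev[OF z]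
    obtain K where K: "K > 0" "\<And>x. norm (ev z x) \<le> K * norm x"
      by (rule bounded_op_bound[OF bev]) blast
    define y where "y h = (\<Sum>j\<in>UNIV. (\<lambda>x. (z $ j) *\<^sub>C x - T j x)
        (comp_prod (UNIV - {j}) (\<lambda>i x. x - (z $ i) *\<^sub>C adj H (T i) x) (h $ j)))" for h
    define rhs where "rhs h = defect_star H T
        (comp_prod UNIV (\<lambda>k. inv_into H (\<lambda>x. x - (z $ k) *\<^sub>C adj H (T k) x)) (y h))" for h
    have rhs: "rhs h \<in> SD" "rhs h = Vs (ev z (M (C h)))" "Us (rhs h) = ev z (M (C h))" "ev z (M (C h)) \<in> SL"
      if h: "h \<in> ?pow" for h
    proof -
      define g where "g = comp_prod UNIV (\<lambda>k. G (z $ k) k) (y h)"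
      have yH: "y h \<in> H" unfolding y_def by (rule char_sum_mem[OF z h])
      note inv = comp_inv_into[OF z yH]
      have g: "g \<in> H" "rhs h = defect_star H T g" using inv by (simp_all add: g_def rhs_def)
      have E: "E0 g = ev z (M (C h))"
        using char_sum_ev[OF z h] by (simp add: g_def ev_def y_def)
      show "rhs h \<in> SD" unfolding g(2) SD_def defect_star_space_def by (rule subsetD[OF closure_subset imageI[OF g(1)]])
      show "rhs h = Vs (ev z (M (C h)))" using UVs(4)[OF g(1)] g(2) E by simp
      show "Us (rhs h) = ev z (M (C h))" using UVs(3)[OF g(1)] g(2) E by simp
      show "ev z (M (C h)) \<in> SL" unfolding E[symmetric] SL_def by (rule subsetD[OF closure_subset imageI[OF g(1)]])
    qed
    have bevM: "bounded_op UNIV UNIV (\<lambda>x. ev z (M x))"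
      unfolding bounded_op_def
    proof (intro conjI ballI allI exI)
      fix x
      have "norm (ev z (M x)) \<le> K * norm (M x)" by (rule K)
      also have "\<dots> \<le> K * norm x" using K(1) M_norm_le by simp
      finally show "norm (ev z (M x)) \<le> K * norm x" .
    qed (simp_all add: M_lin ev_lin[OF z])
    have evSL: "ev z (M c) \<in> SL" if c: "c \<in> SC" for c
    proof -
      obtain f where f: "\<And>n. f n \<in> C ` ?pow" "f \<longlonglongrightarrow> c"
        using c unfolding SC_def closure_sequential by blast
      have lim: "(\<lambda>n. ev z (M (f n))) \<longlonglongrightarrow> ev z (M c)"
        by (rule bounded_op_tendsto[OF bevM hilbert_carrier_UNIV _ f(2)]) auto
      have "ev z (M (f n)) \<in> SL" for n using f(1)[of n] rhs(4) by auto
      from closed_sequentially[OF hilbert_carrierD(4)[OF carr(2)] this lim] show ?thesis .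
    qed
    obtain KU where KU: "KU > 0" "\<And>a. a \<in> BD \<Longrightarrow> norm (U a) \<le> KU * norm a"
      by (rule bounded_op_bound[OF UV(1)]) blast
    obtain KV where KV: "KV > 0" "\<And>a. a \<in> SL \<Longrightarrow> norm (Vs a) \<le> KV * norm a"
      by (rule bounded_op_bound[OF UVs(2)]) blast
    \<comment> \<open>The witness for the choice in \<open>char_fun\<close>: multiplication followed
      by evaluation at \<open>z\<close>, transported to the defect spaces by the two
      isometries.\<close>
    define Q where "Q a = Vs (ev z (M (U a)))" for a
    have Q1: "bounded_op BD SD Q"
      unfolding bounded_op_def
    proof (intro conjI ballI allI exI)
      note UB = bounded_opD[OF UV(1)] and VB = bounded_opD[OF UVs(2)]
      fix a assume a: "a \<in> BD"
      have s: "ev z (M (U a)) \<in> SL" by (intro evSL UB a)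
      show "Q a \<in> SD" unfolding Q_def by (intro VB s)
      show "Q (c *\<^sub>C a) = c *\<^sub>C Q a" for c
        unfolding Q_def using s by (simp add: UB a M_lin ev_lin[OF z] VB)
      show "Q (a + b) = Q a + Q b" if b: "b \<in> BD" for b
        unfolding Q_def using s evSL[OF UB(1)[OF b]] by (simp add: UB a b M_lin ev_lin[OF z] VB)
      have "norm (Q a) \<le> KV * norm (ev z (M (U a)))" unfolding Q_def by (rule KV(2)[OF s])
      also have "\<dots> \<le> KV * (K * norm (M (U a)))" using KV(1) by (intro mult_left_mono K) simp
      also have "\<dots> \<le> KV * (K * norm (U a))" using KV(1) K(1) by (intro mult_left_mono M_norm_le) simp_all
      also have "\<dots> \<le> KV * (K * (KU * norm a))" using KV(1) K(1) by (intro mult_left_mono KU(2)[OF a]) simp_all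
      finally show "norm (Q a) \<le> KV * (K * KU) * norm a" by (simp add: mult.assoc)
    qed
    have Q2: "Q (big_defect H T h) = rhs h" if "h \<in> ?pow" for h
      using that by (simp add: Q_def UV(3) rhs(2))
    have "\<exists>Q. bounded_op BD SD Q \<and> (\<forall>h\<in>?pow. Q (big_defect H T h) = rhs h)"
      using Q1 Q2 by blast
    from someI_ex[OF this] have ch: "bounded_op BD SD (char_fun H T z)"
      "\<And>h. h \<in> ?pow \<Longrightarrow> char_fun H T z (big_defect H T h) = rhs h"
      unfolding char_fun_def BD_def SD_def rhs_def y_def by blast+
    \<comment> \<open>The chosen operator is prescribed only on the range of the joint defect
      operator. That range is dense in \<open>BD\<close>, so continuity forces agreement with
      \<open>Q\<close> on all of it.\<close>
    obtain f where f: "\<And>n. f n \<in> big_defect H T ` ?pow" "f \<longlonglongrightarrow> a"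
      using a unfolding BD_def big_defect_space_def closure_sequential by blast
    have fB: "f n \<in> BD" for n
      unfolding BD_def big_defect_space_def by (rule subsetD[OF closure_subset f(1)])
    have "(\<lambda>n. char_fun H T z (f n)) \<longlonglongrightarrow> char_fun H T z a"
      by (rule bounded_op_tendsto[OF ch(1) carr(3) fB f(2) a])
    moreover have "(\<lambda>n. Q (f n)) \<longlonglongrightarrow> Q a"
      by (rule bounded_op_tendsto[OF Q1 carr(3) fB f(2) a])
    moreover have "char_fun H T z (f n) = Q (f n)" for n
      using f(1)[of n] ch(2) Q2 by auto
    ultimately have "char_fun H T z a = Q a" by (simp add: LIMSEQ_unique)
    moreover have "ev z (M (U a)) \<in> SL" by (intro evSL bounded_opD(1)[OF UV(1)] a)
    ultimately show ?thesis
      using bounded_opD(1)[OF Q1 a] UVs(6) by (simp add: Q_def)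
  qed
  have eq: "\<Theta> z e = adj UNIV \<sigma>s (map_prod (char_fun H T z) id (\<sigma> e))" if z: "z \<in> polydisc" for z e
  proof -
    obtain a f where af: "a \<in> BD" "f \<in> F" "\<sigma> e = (a, f)" "J e = U a + f" using \<sigma>(2)[of e] by auto
    have "M f = ev z (M f)" using af(2) by (intro ev_const[OF z, symmetric]) (simp add: F_def)
    then have "Us (char_fun H T z a) + M f = ev z (M (J e))"
      using char[OF z af(1)] by (simp add: af(4) M_lin ev_lin[OF z])
    then have "adj UNIV \<sigma>s (char_fun H T z a, f) = Js' (Js (\<Theta> z e))"
      using char[OF z af(1)] by (simp add: \<sigma>s(2) af(2) \<Theta>[OF z])
    then show ?thesis by (simp add: af(3) Js(2))
  qed
  show ?thesis by (rule that[of \<sigma> \<sigma>s]) (use \<sigma>(1) \<sigma>s(1) eq in \<open>simp_all add: BD_def SD_def\<close>)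
qed

end


section \<open>Operators on the sequence space\<close>

lemma ell2_eqI: "(\<And>n. ell2_nth x n = ell2_nth y n) \<Longrightarrow> x = y"
  by (metis ell2_nth_inject ext)

lemma ell2_nth_Abs: "summable (\<lambda>n. (cmod (f n))\<^sup>2) \<Longrightarrow> ell2_nth (Abs_ell2 f) = f"
  by (simp add: Abs_ell2_inverse)

lemma ell2_nth_Abs_on: "(\<lambda>n. (cmod (f n))\<^sup>2) summable_on UNIV \<Longrightarrow> ell2_nth (Abs_ell2 f) = f"
  by (rule ell2_nth_Abs) (simp add: summable_on_UNIV_nonneg_real_iff)

text \<open>Unconditional sums can be reindexed along injections and regrouped over pairs of
  indices, as the shifts and the coding of multi-indices require.\<close>

lemma has_sum_cinner_ell2: "((\<lambda>n. ell2_nth x n * cnj (ell2_nth y n)) has_sum cinner x y) UNIV"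
proof (rule norm_summable_imp_has_sum)
  show "summable (\<lambda>n. norm (ell2_nth x n * cnj (ell2_nth y n)))"
  proof (rule summable_comparison_test')
    show "summable (\<lambda>n. (cmod (ell2_nth x n))\<^sup>2 + (cmod (ell2_nth y n))\<^sup>2)"
      by (intro summable_add summable_ell2)
    show "norm (norm (ell2_nth x n * cnj (ell2_nth y n))) \<le> (cmod (ell2_nth x n))\<^sup>2 + (cmod (ell2_nth y n))\<^sup>2" for n
    proof -
      have "2 * (cmod (ell2_nth x n) * cmod (ell2_nth y n)) \<le> (cmod (ell2_nth x n))\<^sup>2 + (cmod (ell2_nth y n))\<^sup>2"
        using zero_le_power2[of "cmod (ell2_nth x n) - cmod (ell2_nth y n)"]
        by (simp add: power2_eq_square algebra_simps)
      moreover have "0 \<le> cmod (ell2_nth x n) * cmod (ell2_nth y n)" by simp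
      ultimately have "cmod (ell2_nth x n) * cmod (ell2_nth y n) \<le> (cmod (ell2_nth x n))\<^sup>2 + (cmod (ell2_nth y n))\<^sup>2"
        by linarith
      then show ?thesis by (simp add: norm_mult)
    qed
  qed
  show "(\<lambda>n. ell2_nth x n * cnj (ell2_nth y n)) sums cinner x y"
    unfolding cinner_ell2_def by (rule summable_sums[OF summable_cinner_ell2])
qed

lemma has_sum_norm_ell2: "((\<lambda>n. (cmod (ell2_nth x n))\<^sup>2) has_sum (norm x)\<^sup>2) UNIV"
  unfolding norm_ell2_sq
  by (rule norm_summable_imp_has_sum) (auto intro: summable_ell2 summable_sums)

lemma summable_on_ell2: "(\<lambda>n. (cmod (ell2_nth x n))\<^sup>2) summable_on A"
  using has_sum_imp_summable[OF has_sum_norm_ell2] by (rule summable_on_subset_banach) simp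

text \<open>For injective \<tau>, \<open>push\<close> is the isometry that places coordinate
  \<open>n\<close> at position \<open>\<tau> n\<close>, and \<open>pull\<close> is its adjoint. The
  shifts and the embedding of the constants are both of this kind.\<close>

definition pull :: "(nat \<Rightarrow> nat) \<Rightarrow> ell2 \<Rightarrow> ell2"
  where "pull \<tau> x = Abs_ell2 (\<lambda>p. ell2_nth x (\<tau> p))"

definition push :: "(nat \<Rightarrow> nat) \<Rightarrow> ell2 \<Rightarrow> ell2"
  where "push \<tau> x = Abs_ell2 (\<lambda>p. if p \<in> range \<tau> then ell2_nth x (inv \<tau> p) else 0)"

definition coord_proj :: "nat set \<Rightarrow> ell2 \<Rightarrow> ell2"
  where "coord_proj I x = Abs_ell2 (\<lambda>p. if p \<in> I then ell2_nth x p else 0)"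

lemma coord_proj_nth: "ell2_nth (coord_proj I x) p = (if p \<in> I then ell2_nth x p else 0)"
proof -
  have "summable (\<lambda>p. (cmod (if p \<in> I then ell2_nth x p else 0))\<^sup>2)"
    by (rule summable_comparison_test'[OF summable_ell2[of x]]) simp
  then show ?thesis unfolding coord_proj_def by (subst ell2_nth_Abs) simp_all
qed

lemma coord_proj_adj: "adjoint_pair (coord_proj I) (coord_proj I)"
  unfolding adjoint_pair_def
proof (intro allI)
  fix x y
  have "((\<lambda>n. ell2_nth (coord_proj I x) n * cnj (ell2_nth y n)) has_sum cinner (coord_proj I x) y) UNIV"
    by (rule has_sum_cinner_ell2)
  moreover have "((\<lambda>n. ell2_nth x n * cnj (ell2_nth (coord_proj I y) n)) has_sum cinner x (coord_proj I y)) UNIV"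
    by (rule has_sum_cinner_ell2)
  moreover have "(\<lambda>n. ell2_nth (coord_proj I x) n * cnj (ell2_nth y n)) = (\<lambda>n. ell2_nth x n * cnj (ell2_nth (coord_proj I y) n))"
    by (auto simp: coord_proj_nth)
  ultimately show "cinner (coord_proj I x) y = cinner x (coord_proj I y)" by (metis infsumI)
qed

context
  fixes \<tau> :: "nat \<Rightarrow> nat"
  assumes inj: "inj \<tau>"
begin

lemma pull_nth: "ell2_nth (pull \<tau> x) p = ell2_nth x (\<tau> p)"
proof -
  have "(\<lambda>p. (cmod (ell2_nth x (\<tau> p)))\<^sup>2) summable_on UNIV"
    using summable_on_reindex[OF inj, of "\<lambda>n. (cmod (ell2_nth x n))\<^sup>2"] summable_on_ell2[of x "range \<tau>"]
    by (simp add: o_def)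
  then show ?thesis unfolding pull_def by (subst ell2_nth_Abs_on) simp_all
qed

lemma push_nth: "ell2_nth (push \<tau> x) p = (if p \<in> range \<tau> then ell2_nth x (inv \<tau> p) else 0)"
proof -
  let ?f = "\<lambda>p. (cmod (if p \<in> range \<tau> then ell2_nth x (inv \<tau> p) else 0))\<^sup>2"
  have "(?f \<circ> \<tau>) = (\<lambda>n. (cmod (ell2_nth x n))\<^sup>2)" using inj by auto
  then have "?f summable_on range \<tau>"
    using summable_on_reindex[OF inj, of ?f] summable_on_ell2[of x UNIV] by simp
  then have "?f summable_on UNIV"
    by (subst (asm) summable_on_cong_neutral[where T = UNIV and g = ?f]) auto
  then show ?thesis unfolding push_def by (subst ell2_nth_Abs_on) simp_all
qed

lemma push_nth_image [simp]: "ell2_nth (push \<tau> x) (\<tau> n) = ell2_nth x n"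
  using inj by (simp add: push_nth)

lemma push_adj: "adjoint_pair (push \<tau>) (pull \<tau>)"
  unfolding adjoint_pair_def
proof (intro allI)
  fix x y
  let ?f = "\<lambda>n. ell2_nth (push \<tau> x) n * cnj (ell2_nth y n)"
  have "(?f has_sum cinner (push \<tau> x) y) UNIV"
    by (rule has_sum_cinner_ell2)
  then have "(?f has_sum cinner (push \<tau> x) y) (range \<tau>)"
    by (subst has_sum_cong_neutral[where T = UNIV and g = ?f]) (auto simp: push_nth)
  then have "((\<lambda>n. ell2_nth x n * cnj (ell2_nth (pull \<tau> y) n)) has_sum cinner (push \<tau> x) y) UNIV"
    by (subst (asm) has_sum_reindex[OF inj]) (simp add: o_def pull_nth)
  with has_sum_cinner_ell2[of x "pull \<tau> y"] show "cinner (push \<tau> x) y = cinner x (pull \<tau> y)"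
    by (metis infsumI)
qed

lemma pull_push: "pull \<tau> (push \<tau> x) = x"
  by (rule ell2_eqI) (simp add: pull_nth)

lemma push_pull: "push \<tau> (pull \<tau> x) = coord_proj (range \<tau>) x"
  by (rule ell2_eqI) (auto simp: push_nth pull_nth coord_proj_nth f_inv_into_f)

lemma pull_coord_proj:
  assumes "\<And>p. \<tau> p \<in> I \<longleftrightarrow> p \<in> J"
  shows "pull \<tau> (coord_proj I x) = coord_proj J (pull \<tau> x)"
  by (rule ell2_eqI) (simp add: pull_nth coord_proj_nth assms)

lemma push_coord_proj:
  assumes "\<And>p. \<tau> p \<in> I \<longleftrightarrow> p \<in> J"
  shows "coord_proj I (push \<tau> x) = push \<tau> (coord_proj J x)"
  by (rule adjoint_pair_eqI[OF adjoint_pair_comp[OF coord_proj_adj push_adj] adjoint_pair_comp[OF push_adj coord_proj_adj]])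
    (rule pull_coord_proj[OF assms])

lemma pull_power_nth: "ell2_nth ((pull \<tau> ^^ m) x) p = ell2_nth x ((\<tau> ^^ m) p)"
  by (induction m arbitrary: p) (simp_all add: pull_nth funpow_swap1[of \<tau>])

text \<open>The squared norm of the \<open>m\<close>-th power at \<open>x\<close> is the mass of
  \<open>x\<close> on the range of \<open>\<tau> ^^ m\<close>. That range eventually avoids any
  given initial segment, so a tail of a convergent series bounds the norm.\<close>

lemma pull_power_tendsto_0:
  assumes leave: "\<And>n. \<exists>m0. \<forall>m\<ge>m0. n \<notin> range (\<tau> ^^ m)"
  shows "(\<lambda>m. (pull \<tau> ^^ m) x) \<longlonglongrightarrow> 0"
proof (rule metric_LIMSEQ_I)
  fix e :: real assume e: "0 < e"
  let ?g = "\<lambda>n. (cmod (ell2_nth x n))\<^sup>2"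
  obtain N where N: "norm (\<Sum>n. ?g (n + N)) < e\<^sup>2"
    using suminf_exist_split[OF _ summable_ell2[of x], of "e\<^sup>2"] e by auto
  obtain m0 where m0: "\<And>n m. m \<ge> m0 n \<Longrightarrow> n \<notin> range (\<tau> ^^ m)" using leave by metis
  show "\<exists>M. \<forall>m\<ge>M. dist ((pull \<tau> ^^ m) x) 0 < e"
  proof (intro exI allI impI)
    fix m assume m: "m \<ge> Max (m0 ` {..<N} \<union> {0})"
    have far: "range (\<tau> ^^ m) \<subseteq> {N..}"
    proof
      fix n assume n: "n \<in> range (\<tau> ^^ m)"
      show "n \<in> {N..}"
      proof (rule ccontr)
        assume "n \<notin> {N..}"
        then have "m0 n \<le> Max (m0 ` {..<N} \<union> {0})" by (intro Max_ge) auto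
        then have "m0 n \<le> m" using m by (rule order_trans)
        then show False using m0[of n m] n by auto
      qed
    qed
    have injm: "inj (\<tau> ^^ m)" using inj by (rule inj_fn)
    have "((\<lambda>p. (cmod (ell2_nth ((pull \<tau> ^^ m) x) p))\<^sup>2) has_sum (norm ((pull \<tau> ^^ m) x))\<^sup>2) UNIV"
      by (rule has_sum_norm_ell2)
    then have "((?g \<circ> (\<tau> ^^ m)) has_sum (norm ((pull \<tau> ^^ m) x))\<^sup>2) UNIV"
      by (simp add: pull_power_nth o_def)
    then have 1: "(?g has_sum (norm ((pull \<tau> ^^ m) x))\<^sup>2) (range (\<tau> ^^ m))"
      by (subst has_sum_reindex[OF injm])
    have "{N..} = range (\<lambda>n. n + N)"
      by (auto simp: image_iff) (metis le_Suc_ex add.commute)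
    moreover have "((?g \<circ> (\<lambda>n. n + N)) has_sum (\<Sum>n. ?g (n + N))) UNIV"
      unfolding o_def
      by (rule norm_summable_imp_has_sum)
        (use summable_ell2[of x] in \<open>auto simp: summable_iff_shift[of ?g] intro: summable_sums\<close>)
    ultimately have 2: "(?g has_sum (\<Sum>n. ?g (n + N))) {N..}"
      by (simp add: has_sum_reindex)
    have "(norm ((pull \<tau> ^^ m) x))\<^sup>2 \<le> (\<Sum>n. ?g (n + N))"
      by (rule has_sum_mono2[OF 1 2 far]) simp
    also have "\<dots> < e\<^sup>2" using N by (simp add: abs_less_iff)
    finally have "norm ((pull \<tau> ^^ m) x) < e" using e by (auto intro: power2_less_imp_less)
    then show "dist ((pull \<tau> ^^ m) x) 0 < e" by simp
  qed
qed

end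

lemma push_commute:
  assumes "inj \<tau>" "inj \<upsilon>" "\<And>p. \<tau> (\<upsilon> p) = \<upsilon> (\<tau> p)"
  shows "push \<tau> (push \<upsilon> x) = push \<upsilon> (push \<tau> x)"
  by (rule adjoint_pair_eqI[OF adjoint_pair_comp adjoint_pair_comp])
    (rule push_adj assms(1,2) ell2_eqI | simp add: pull_nth assms)+

lemma pull_push_commute:
  assumes "inj \<tau>" "inj \<upsilon>" "\<And>p. \<tau> (\<upsilon> p) = \<upsilon> (\<tau> p)" "\<And>p. \<upsilon> p \<in> range \<tau> \<Longrightarrow> p \<in> range \<tau>"
  shows "pull \<upsilon> (push \<tau> x) = push \<tau> (pull \<upsilon> x)"
proof (rule ell2_eqI)
  fix p
  show "ell2_nth (pull \<upsilon> (push \<tau> x)) p = ell2_nth (push \<tau> (pull \<upsilon> x)) p"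
  proof (cases "p \<in> range \<tau>")
    case True
    then obtain q where "p = \<tau> q" by blast
    then show ?thesis using assms by (simp add: pull_nth assms(3)[symmetric])
  next
    case False
    then show ?thesis using assms by (auto simp: pull_nth push_nth)
  qed
qed

subsection \<open>Orthonormal families\<close>

lemma orthonormal_family:
  fixes u :: "nat \<Rightarrow> 'a::complex_hilbert"
  assumes on: "\<And>p q. cinner (u p) (u q) = (if p = q \<and> p \<in> I then 1 else 0)"
  obtains A A' where "adjoint_pair A A'" "\<And>x p. ell2_nth (A x) p = cinner x (u p)"
    "\<And>c. A (A' c) = coord_proj I c"
proof -
  have sq: "(norm (\<Sum>p\<in>S. c p *\<^sub>C u p))\<^sup>2 = (\<Sum>p\<in>S. if p \<in> I then (cmod (c p))\<^sup>2 else 0)" if S: "finite S" for S c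
  proof -
    have "cinner (\<Sum>p\<in>S. c p *\<^sub>C u p) (\<Sum>p\<in>S. c p *\<^sub>C u p) =
        (\<Sum>p\<in>S. \<Sum>q\<in>S. if p = q then (if p \<in> I then c p * cnj (c p) else 0) else 0)"
      unfolding cinner.sum_left unfolding cinner.sum_right
      by (intro sum.cong refl) (auto simp: cinner_scaleC_left cinner_scaleC_right on)
    also have "\<dots> = (\<Sum>p\<in>S. if p \<in> I then c p * cnj (c p) else 0)"
      using S by (simp add: sum.delta)
    also have "\<dots> = of_real (\<Sum>p\<in>S. if p \<in> I then (cmod (c p))\<^sup>2 else 0)"
      by (auto intro!: sum.cong simp: mult_cnj_eq_norm)
    finally show ?thesis unfolding cinner_self of_real_eq_iff .
  qed
  have u0: "u p = 0" if "p \<notin> I" for p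
    using on[of p p] that by (simp add: cinner_eq_0_norm)
  have bessel: "(\<Sum>p<N. (cmod (cinner x (u p)))\<^sup>2) \<le> (norm x)\<^sup>2" for x N
  proof -
    define s where "s = (\<Sum>p<N. cinner x (u p) *\<^sub>C u p)"
    define b where "b = (\<Sum>p<N. (cmod (cinner x (u p)))\<^sup>2)"
    have ss: "cinner s s = of_real b"
      unfolding cinner_self s_def b_def
      by (subst sq) (auto intro!: sum.cong simp: u0 cinner.zero_right)
    have xs: "cinner x s = of_real b"
      by (simp add: s_def b_def cinner.sum_right cinner_scaleC_right mult_cnj_eq_norm)
    then have sx: "cinner s x = of_real b" by (metis cinner_commute complex_cnj_complex_of_real)
    have "cinner (x - s) (x - s) = cinner x x - of_real b"
      by (simp add: cinner_diff_left cinner_diff_right ss xs sx)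
    from arg_cong[OF this, of Re] have "(norm (x - s))\<^sup>2 = (norm x)\<^sup>2 - b"
      by (simp add: Re_cinner_self)
    then show ?thesis unfolding b_def[symmetric] using zero_le_power2[of "norm (x - s)"] by linarith
  qed
  define A where "A x = Abs_ell2 (\<lambda>p. cinner x (u p))" for x
  have A: "ell2_nth (A x) p = cinner x (u p)" for x p
    unfolding A_def by (subst ell2_nth_Abs) (auto intro: summableI_nonneg_bounded[OF _ bessel])
  have summ: "summable (\<lambda>p. ell2_nth c p *\<^sub>C u p)" for c
    unfolding summable_Cauchy
  proof (intro allI impI)
    fix e :: real assume e: "0 < e"
    then obtain N where N: "\<And>m n. m \<ge> N \<Longrightarrow> norm (\<Sum>p\<in>{m..<n}. (cmod (ell2_nth c p))\<^sup>2) < e\<^sup>2"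
      using summable_ell2[of c, unfolded summable_Cauchy, rule_format, of "e\<^sup>2"] by auto
    show "\<exists>N. \<forall>m\<ge>N. \<forall>n. norm (\<Sum>p\<in>{m..<n}. ell2_nth c p *\<^sub>C u p) < e"
    proof (intro exI allI impI)
      fix m n assume m: "N \<le> m"
      have "(norm (\<Sum>p\<in>{m..<n}. ell2_nth c p *\<^sub>C u p))\<^sup>2 \<le> (\<Sum>p\<in>{m..<n}. (cmod (ell2_nth c p))\<^sup>2)"
        by (subst sq) (auto intro!: sum_mono)
      also have "\<dots> < e\<^sup>2" using N[OF m, of n] by (simp add: abs_less_iff)
      finally show "norm (\<Sum>p\<in>{m..<n}. ell2_nth c p *\<^sub>C u p) < e"
        using e by (auto intro: power2_less_imp_less)
    qed
  qed
  define A' where "A' c = (\<Sum>p. ell2_nth c p *\<^sub>C u p)" for c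
  have A': "cinner x (A' c) = (\<Sum>p. cinner x (ell2_nth c p *\<^sub>C u p))"
    "(\<lambda>p. cinner x (ell2_nth c p *\<^sub>C u p)) sums cinner x (A' c)" for x c
    using bounded_linear.sums[OF cinner.bounded_linear_right summable_sums[OF summ[of c]], of x]
    by (auto simp: A'_def sums_iff)
  have adj: "adjoint_pair A A'"
    unfolding adjoint_pair_def cinner_ell2_def A A'(1)
    by (simp add: cinner_scaleC_right mult.commute)
  have "A (A' c) = coord_proj I c" for c
  proof (rule ell2_eqI)
    fix p
    have "(\<lambda>q. cinner (u p) (ell2_nth c q *\<^sub>C u q)) sums cinner (u p) (A' c)" by (rule A'(2))
    moreover have "(\<lambda>q. cinner (u p) (ell2_nth c q *\<^sub>C u q)) =
        (\<lambda>q. if q = p then (if p \<in> I then cnj (ell2_nth c p) else 0) else 0)"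
      by (auto simp: fun_eq_iff cinner_scaleC_right on)
    ultimately have "cinner (u p) (A' c) = (if p \<in> I then cnj (ell2_nth c p) else 0)"
      using sums_single[of p "\<lambda>_. if p \<in> I then cnj (ell2_nth c p) else 0"] by (simp add: sums_unique2)
    then have "cinner (A' c) (u p) = (if p \<in> I then ell2_nth c p else 0)"
      by (subst cinner_commute) simp
    then show "ell2_nth (A (A' c)) p = ell2_nth (coord_proj I c) p" by (simp add: A coord_proj_nth)
  qed
  with adj A show ?thesis by (rule that)
qed

fun gram_schmidt :: "(nat \<Rightarrow> 'a::complex_hilbert) \<Rightarrow> nat \<Rightarrow> 'a" where
  "gram_schmidt d n = sgn (d n - sum_list (map (\<lambda>i. cinner (d n) (gram_schmidt d i) *\<^sub>C gram_schmidt d i) [0..<n]))"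

declare gram_schmidt.simps [simp del]

text \<open>Since \<open>sgn 0 = 0\<close>, the vectors that depend linearly on their predecessors are replaced by \<open>0\<close>.\<close>

lemma orthonormal_basis:
  obtains b :: "nat \<Rightarrow> 'a::{complex_hilbert,polish_space}" and I
  where "\<And>p q. cinner (b p) (b q) = (if p = q \<and> p \<in> I then 1 else 0)"
    "\<And>x. (\<And>p. cinner x (b p) = 0) \<Longrightarrow> x = 0"
proof -
  obtain D :: "'a set" where D: "countable D" "\<And>X. open X \<Longrightarrow> X \<noteq> {} \<Longrightarrow> \<exists>d\<in>D. d \<in> X"
    using countable_dense_setE by blast
  have "D \<noteq> {}" using D(2)[of UNIV] by auto
  define d where "d = from_nat_into D"
  have rd: "range d = D" unfolding d_def by (rule range_from_nat_into[OF \<open>D \<noteq> {}\<close> D(1)])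
  define b where "b = gram_schmidt d"
  define e where "e n = d n - (\<Sum>i<n. cinner (d n) (b i) *\<^sub>C b i)" for n
  have b: "b n = sgn (e n)" for n
    unfolding b_def e_def
    by (subst gram_schmidt.simps) (simp add: interv_sum_list_conv_sum_set_nat atLeast0LessThan)
  have b1: "cinner (b n) (b n) = (if b n = 0 then 0 else 1)" for n
    by (auto simp: b cinner_self norm_sgn sgn_zero_iff)
  have orth: "cinner (b j) (b n) = 0 \<and> cinner (b n) (b j) = 0" if "j < n" for j n
    using that
  proof (induction n arbitrary: j rule: less_induct)
    case (less n)
    have bij: "cinner (b i) (b j) = 0" if "i < n" "i \<noteq> j" for i
      using less.IH[of i j] less.IH[of j i] that less.prems by (cases i j rule: linorder_cases) auto
    have "(\<Sum>i<n. cinner (d n) (b i) * cinner (b i) (b j)) =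
        (\<Sum>i<n. if i = j then cinner (d n) (b j) * cinner (b j) (b j) else 0)"
      by (rule sum.cong) (auto simp: bij)
    also have "\<dots> = cinner (d n) (b j) * cinner (b j) (b j)" using less.prems by simp
    also have "\<dots> = cinner (d n) (b j)" by (simp add: b1 cinner.zero_right)
    finally have "cinner (e n) (b j) = 0"
      by (simp add: e_def cinner_diff_left cinner.sum_left cinner_scaleC_left)
    then have "cinner (b n) (b j) = 0" unfolding b[of n] sgn_div_norm by (simp add: cinner_scaleR_left)
    then show ?case by (metis cinner_commute complex_cnj_zero)
  qed
  have on: "cinner (b p) (b q) = (if p = q \<and> p \<in> {p. b p \<noteq> 0} then 1 else 0)" for p q
    using orth[of p q] orth[of q p] b1[of p] by (cases p q rule: linorder_cases) auto
  \<comment> \<open>A vector orthogonal to the basis is orthogonal to each \<open>d n\<close>, hence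
    to a dense set, hence to itself.\<close>
  have tot: "x = 0" if x: "\<And>p. cinner x (b p) = 0" for x
  proof -
    have "cinner x (d n) = 0" for n
    proof -
      have "e n = norm (e n) *\<^sub>R b n" by (cases "e n = 0") (simp_all add: b sgn_div_norm)
      then have "cinner x (e n) = 0" by (metis cinner_scaleR_right x scaleR_zero_right)
      then show ?thesis by (simp add: e_def cinner_diff_right cinner.sum_right cinner_scaleC_right x)
    qed
    then have "D \<subseteq> {y. cinner x y = 0}" using rd by auto
    moreover have "closed {y. cinner x y = 0}"
      by (intro closed_Collect_eq cinner.continuous_on continuous_intros)
    ultimately have "closure D \<subseteq> {y. cinner x y = 0}" by (rule closure_minimal)
    moreover have "x \<in> closure D"
    proof (rule ccontr)
      assume "x \<notin> closure D"
      then have "- closure D \<noteq> {}" by auto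
      then obtain y where "y \<in> D" "y \<in> - closure D" using D(2)[of "- closure D"] by auto
      then show False using closure_subset[of D] by auto
    qed
    ultimately show "x = 0" by (auto simp: cinner_eq_0_norm)
  qed
  show ?thesis by (rule that[OF on tot])
qed

lemma orthonormal_coordinates:
  obtains b :: "nat \<Rightarrow> 'a::{complex_hilbert,polish_space}" and I A A'
  where "\<And>p q. cinner (b p) (b q) = (if p = q \<and> p \<in> I then 1 else 0)"
    "adjoint_pair A A'" "\<And>x p. ell2_nth (A x) p = cinner x (b p)"
    "\<And>c. A (A' c) = coord_proj I c" "\<And>x. A' (A x) = x"
proof -
  obtain b :: "nat \<Rightarrow> 'a" and I where b: "\<And>p q. cinner (b p) (b q) = (if p = q \<and> p \<in> I then 1 else 0)"
    "\<And>x. (\<And>p. cinner x (b p) = 0) \<Longrightarrow> x = 0"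
    using orthonormal_basis by blast
  obtain A A' where A: "adjoint_pair A A'" "\<And>x p. ell2_nth (A x) p = cinner x (b p)"
    "\<And>c. A (A' c) = coord_proj I c"
    by (rule orthonormal_family[OF b(1)]) blast
  have b0: "b p = 0" if "p \<notin> I" for p
    using b(1)[of p p] that by (simp add: cinner_eq_0_norm)
  have "A' (A x) = x" for x
  proof -
    have "cinner (A' (A x) - x) (b p) = 0" for p
    proof -
      have "cinner (A' (A x)) (b p) = ell2_nth (A (A' (A x))) p" by (simp add: A(2))
      also have "\<dots> = cinner x (b p)" by (simp add: A(3) coord_proj_nth) (simp add: A(2) b0 cinner.zero_right)
      finally show ?thesis by (simp add: cinner_diff_left)
    qed
    from b(2)[OF this] show ?thesis by simp
  qed
  from that[OF b(1) A this] show ?thesis .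
qed


section \<open>Taylor expansion on the polydisc\<close>

definition monomial :: "('n \<Rightarrow> nat) \<Rightarrow> complex ^ 'n::finite \<Rightarrow> complex"
  where "monomial k z = (\<Prod>i\<in>UNIV. (z $ i) ^ k i)"

definition upd :: "complex ^ 'n \<Rightarrow> 'n \<Rightarrow> complex \<Rightarrow> complex ^ 'n::finite"
  where "upd z j \<zeta> = (\<chi> i. if i = j then \<zeta> else z $ i)"

lemma upd_nth [simp]: "upd z j \<zeta> $ i = (if i = j then \<zeta> else z $ i)"
  by (simp add: upd_def)

lemma upd_polydisc: "z \<in> polydisc \<Longrightarrow> cmod \<zeta> < 1 \<Longrightarrow> upd z j \<zeta> \<in> polydisc"
  by (simp add: polydisc_def)

lemma upd_commute: "i \<noteq> j \<Longrightarrow> upd (upd z i \<xi>) j \<zeta> = upd (upd z j \<zeta>) i \<xi>"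
  by (simp add: vec_eq_iff)

lemma norm_monomial: "cmod (monomial k z) = (\<Prod>i\<in>UNIV. cmod (z $ i) ^ k i)"
  by (simp add: monomial_def norm_power flip: prod_norm)

lemma monomial_scaleR: "monomial k (r *\<^sub>R z) = of_real (r ^ (\<Sum>i\<in>UNIV. k i)) * monomial k z"
proof -
  have "(r *\<^sub>R z) $ i = of_real r * z $ i" for i
    unfolding vector_scaleR_component by (rule scaleR_conv_of_real)
  then show ?thesis by (simp add: monomial_def power_mult_distrib prod.distrib power_sum)
qed

lemma monomial_add: "monomial (\<lambda>i. k i + l i) z = monomial k z * monomial l z"
  by (simp add: monomial_def power_add prod.distrib)

text \<open>A finite set of multi-indices lies in a box, over which the sum factors into partial
  sums of geometric series.\<close>

lemma norm_monomial_summable: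
  fixes z :: "complex ^ 'n::finite"
  assumes z: "z \<in> polydisc"
  shows "(\<lambda>k. cmod (monomial k z)) summable_on A"
proof -
  have lt: "cmod (z $ i) < 1" for i using z by (simp add: polydisc_def)
  have "(\<lambda>k. cmod (monomial k z)) summable_on UNIV"
  proof (rule nonneg_bdd_above_summable_on)
    show "bdd_above (sum (\<lambda>k. cmod (monomial k z)) ` {F. F \<subseteq> UNIV \<and> finite F})"
    proof (rule bdd_aboveI2)
      fix F :: "('n \<Rightarrow> nat) set" assume "F \<in> {F. F \<subseteq> UNIV \<and> finite F}"
      then have F: "finite F" by simp
      define N where "N = Max (insert 0 ((\<lambda>(k, i). k i) ` (F \<times> UNIV)))"
      have "k i \<le> N" if "k \<in> F" for k i
        unfolding N_def using F that by (intro Max_ge) force+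
      then have sub: "F \<subseteq> PiE UNIV (\<lambda>_. {..N})" by (auto simp: PiE_def)
      have fin: "finite (PiE (UNIV :: 'n set) (\<lambda>_. {..N}))" by (intro finite_PiE) auto
      have "(\<Sum>k\<in>F. cmod (monomial k z)) \<le> (\<Sum>k\<in>PiE UNIV (\<lambda>_. {..N}). cmod (monomial k z))"
        by (rule sum_mono2[OF fin sub]) simp
      also have "\<dots> = (\<Prod>i\<in>UNIV. \<Sum>m\<le>N. cmod (z $ i) ^ m)"
        by (simp add: norm_monomial prod_sum_PiE)
      also have "\<dots> \<le> (\<Prod>i\<in>UNIV. 1 / (1 - cmod (z $ i)))"
      proof (rule prod_mono, rule conjI)
        fix i
        show "0 \<le> (\<Sum>m\<le>N. cmod (z $ i) ^ m)" by (intro sum_nonneg) simp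
        have "(\<Sum>m<Suc N. cmod (z $ i) ^ m) \<le> (\<Sum>m. cmod (z $ i) ^ m)"
          by (rule sum_le_suminf) (use lt in \<open>auto intro: summable_geometric\<close>)
        then show "(\<Sum>m\<le>N. cmod (z $ i) ^ m) \<le> 1 / (1 - cmod (z $ i))"
          using lt[of i] by (simp add: suminf_geometric lessThan_Suc_atMost)
      qed
      finally show "(\<Sum>k\<in>F. cmod (monomial k z)) \<le> (\<Prod>i\<in>UNIV. 1 / (1 - cmod (z $ i)))" .
    qed
  qed simp
  then show ?thesis by (rule summable_on_subset_banach) simp
qed

lemma cauchy_estimate_unit:
  assumes hol: "g holomorphic_on ball 0 1" and bd: "\<And>\<zeta>. cmod \<zeta> < 1 \<Longrightarrow> cmod (g \<zeta>) \<le> B"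
  shows "cmod ((deriv ^^ m) g 0 / fact m) \<le> B"
proof -
  have le: "cmod ((deriv ^^ m) g 0 / fact m) \<le> B / (1 - 1 / real (Suc (Suc n))) ^ m" for n
  proof -
    \<comment> \<open>Nothing is known on the unit circle, so the Cauchy inequality is used on
      smaller circles; the double \<open>Suc\<close> keeps \<open>r\<close> positive from the
      start.\<close>
    define r where "r = 1 - 1 / real (Suc (Suc n))"
    have r: "0 < r" "r < 1" by (simp_all add: r_def field_simps)
    have "cmod ((deriv ^^ m) g 0) \<le> fact m * B / r ^ m"
    proof (rule Cauchy_inequality)
      show "g holomorphic_on ball 0 r" by (rule holomorphic_on_subset[OF hol]) (use r in auto)
      show "continuous_on (cball 0 r) g"
        by (rule holomorphic_on_imp_continuous_on[OF holomorphic_on_subset[OF hol]]) (use r in auto)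
      show "cmod (g x) \<le> B" if "cmod (0 - x) = r" for x
        using that r by (intro bd) simp
    qed (rule r)
    then show ?thesis unfolding r_def[symmetric] by (simp add: norm_divide field_simps)
  qed
  have "(\<lambda>n. B / (1 - 1 / real (Suc (Suc n))) ^ m) \<longlonglongrightarrow> B / (1 - 0) ^ m"
    by (intro tendsto_intros LIMSEQ_Suc lim_1_over_n) auto
  then show ?thesis
    using LIMSEQ_le_const[of _ B "cmod ((deriv ^^ m) g 0 / fact m)"] le by auto
qed

text \<open>
  The coefficient of \<open>\<zeta>^m\<close> is the uniform limit, as \<open>\<zeta> \<rightarrow> 0\<close>, of the Taylor remainder
  of order \<open>m\<close> divided by \<open>\<zeta>^m\<close>.
\<close>

lemma taylor_coefficient_holomorphic:
  fixes g :: "complex \<Rightarrow> complex \<Rightarrow> complex"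
  assumes h1: "\<And>\<xi>. cmod \<xi> < 1 \<Longrightarrow> g \<xi> holomorphic_on ball 0 1"
    and h2: "\<And>\<zeta>. cmod \<zeta> < 1 \<Longrightarrow> (\<lambda>\<xi>. g \<xi> \<zeta>) holomorphic_on ball 0 1"
    and bd: "\<And>\<xi> \<zeta>. cmod \<xi> < 1 \<Longrightarrow> cmod \<zeta> < 1 \<Longrightarrow> cmod (g \<xi> \<zeta>) \<le> B"
  shows "(\<lambda>\<xi>. (deriv ^^ m) (g \<xi>) 0 / fact m) holomorphic_on ball 0 1"
proof (induction m rule: less_induct)
  case (less m)
  define b where "b l \<xi> = (deriv ^^ l) (g \<xi>) 0 / fact l" for l \<xi>
  have bB: "cmod (b l \<xi>) \<le> B" if "cmod \<xi> < 1" for l \<xi>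
    unfolding b_def by (rule cauchy_estimate_unit[OF h1[OF that] bd[OF that]])
  have B0: "0 \<le> B" using bB[of 0 0] norm_ge_zero[of "b 0 0"] by (simp del: norm_ge_zero)
  \<comment> \<open>Nonzero points tending to 0, of modulus at most 1/2: the remainder is then
    dominated by a geometric series of ratio 1/2, whose sum is the factor 2 in the estimate.\<close>
  define w :: "nat \<Rightarrow> complex" where "w N = of_real (1 / real (Suc (Suc N)))" for N
  have wn: "cmod (w N) = 1 / real (Suc (Suc N))" for N unfolding w_def norm_of_real by simp
  have w: "w N \<noteq> 0" "cmod (w N) \<le> 1 / 2" "cmod (w N) < 1" for N
  proof -
    have "0 < cmod (w N)" unfolding wn by simp
    then show "w N \<noteq> 0" by auto
    show "cmod (w N) \<le> 1 / 2" unfolding wn by (simp add: field_simps)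
    then show "cmod (w N) < 1" by simp
  qed
  define f where "f N \<xi> = (g \<xi> (w N) - (\<Sum>l<m. b l \<xi> * w N ^ l)) / w N ^ m" for N \<xi>
  have est: "cmod (f N \<xi> - b m \<xi>) \<le> 2 * B * cmod (w N)" if xi: "cmod \<xi> < 1" for N \<xi>
  proof -
    let ?w = "w N"
    have ser: "(\<lambda>n. b n \<xi> * ?w ^ n) sums g \<xi> ?w"
      using holomorphic_power_series[OF h1[OF xi], of ?w] w by (simp add: b_def)
    have eq: "(\<lambda>n. b (n + Suc m) \<xi> * ?w ^ (n + Suc m)) sums (g \<xi> ?w - (\<Sum>l<Suc m. b l \<xi> * ?w ^ l))"
      by (rule sums_split_initial_segment[OF ser])
    have "(\<lambda>n. b (n + Suc m) \<xi> * ?w ^ (n + Suc m) / ?w ^ m) sums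
        ((g \<xi> ?w - (\<Sum>l<Suc m. b l \<xi> * ?w ^ l)) / ?w ^ m)"
      by (rule sums_divide[OF eq])
    moreover have "(g \<xi> ?w - (\<Sum>l<Suc m. b l \<xi> * ?w ^ l)) / ?w ^ m = f N \<xi> - b m \<xi>"
      using w(1)[of N] by (simp add: f_def field_simps)
    moreover have "b (n + Suc m) \<xi> * ?w ^ (n + Suc m) / ?w ^ m = b (n + Suc m) \<xi> * ?w ^ n * ?w" for n
      using w(1)[of N] by (simp add: power_add field_simps)
    ultimately have s: "(\<lambda>n. b (n + Suc m) \<xi> * ?w ^ n * ?w) sums (f N \<xi> - b m \<xi>)" by simp
    have le: "norm (b (n + Suc m) \<xi> * ?w ^ n * ?w) \<le> B * (1/2) ^ n * cmod ?w" for n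
      unfolding norm_mult norm_power using w(2)[of N] B0 bB[OF xi]
      by (intro mult_mono power_mono) auto
    have "summable (\<lambda>n. B * (1/2) ^ n * cmod ?w)"
      by (intro summable_mult summable_mult2 summable_geometric) simp
    then have "norm (\<Sum>n. b (n + Suc m) \<xi> * ?w ^ n * ?w) \<le> (\<Sum>n. B * (1/2) ^ n * cmod ?w)"
      by (rule norm_suminf_le[OF le])
    also have "(\<Sum>n. B * (1/2) ^ n * cmod ?w) = B * (\<Sum>n. (1/2) ^ n) * cmod ?w"
      by (subst suminf_mult2[symmetric], intro summable_mult summable_geometric, simp,
          subst suminf_mult, intro summable_geometric, simp_all)
    also have "(\<Sum>n. (1/2::real) ^ n) = 2" by (subst suminf_geometric) simp_all
    finally show ?thesis using s by (simp add: sums_iff mult.commute mult.left_commute)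
  qed
  have "b m holomorphic_on ball 0 1"
  proof (rule holomorphic_uniform_sequence[of _ f])
    show "f N holomorphic_on ball 0 1" for N
      unfolding f_def using w[of N] less[folded b_def]
      by (intro holomorphic_intros h2 ) auto
    fix x :: complex assume x: "x \<in> ball 0 1"
    then obtain d where d: "0 < d" "cball x d \<subseteq> ball 0 1"
      by (metis open_contains_cball open_ball)
    have "uniform_limit (cball x d) f (b m) sequentially"
    proof (rule uniform_limitI)
      fix e :: real assume e: "0 < e"
      have "(\<lambda>N. 2 * B * (1 / real (Suc (Suc N)))) \<longlonglongrightarrow> 2 * B * 0"
        by (intro tendsto_intros LIMSEQ_Suc lim_1_over_n)
      then have "\<forall>\<^sub>F N in sequentially. 2 * B * (1 / real (Suc (Suc N))) < e"
        using order_tendstoD(2)[of _ "2 * B * 0" sequentially e] e by simp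
      then show "\<forall>\<^sub>F N in sequentially. \<forall>\<xi>\<in>cball x d. dist (f N \<xi>) (b m \<xi>) < e"
      proof eventually_elim
        case (elim N)
        then show ?case using est[of _ N] d(2) by (force simp: dist_norm wn)
      qed
    qed
    with d show "\<exists>d>0. cball x d \<subseteq> ball 0 1 \<and> uniform_limit (cball x d) f (b m) sequentially" by blast
  qed simp
  then show ?case unfolding b_def .
qed

text \<open>One variable is expanded at a time. This can be repeated because taking a coefficient in
  one variable preserves holomorphy in each other variable and the bound.\<close>

theorem polydisc_taylor:
  fixes f :: "complex ^ 'n::finite \<Rightarrow> complex"
  assumes hol: "\<And>z i. z \<in> polydisc \<Longrightarrow> (\<lambda>\<zeta>. f (upd z i \<zeta>)) holomorphic_on ball 0 1"
    and bd: "\<And>z. z \<in> polydisc \<Longrightarrow> cmod (f z) \<le> B"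
  obtains a where "\<And>k. cmod (a k) \<le> B" "\<And>z. z \<in> polydisc \<Longrightarrow> ((\<lambda>k. monomial k z * a k) has_sum f z) UNIV"
proof -
  let ?D = "polydisc :: (complex ^ 'n) set"
  define K :: "'n set \<Rightarrow> ('n \<Rightarrow> nat) set" where "K S = {k. \<forall>i. i \<notin> S \<longrightarrow> k i = 0}" for S
  have B0: "0 \<le> B" using bd[of 0] by (rule order_trans[OF norm_ge_zero]) (simp add: polydisc_def)
  \<comment> \<open>The state after expanding in the variables of \<open>S\<close>: the coefficients
    still depend on the other variables. \<open>B\<close> stays the same at every stage, as the
    Cauchy estimate on the unit disc costs no constant.\<close>
  define Inv :: "'n set \<Rightarrow> (('n \<Rightarrow> nat) \<Rightarrow> complex ^ 'n \<Rightarrow> complex) \<Rightarrow> bool" where "Inv S a \<longleftrightarrow>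
      (\<forall>k i. \<forall>z\<in>?D. (\<lambda>\<zeta>. a k (upd z i \<zeta>)) holomorphic_on ball 0 1) \<and>
      (\<forall>k. \<forall>z\<in>?D. cmod (a k z) \<le> B) \<and>
      (\<forall>k. \<forall>z\<in>?D. \<forall>z'\<in>?D. (\<forall>i. i \<notin> S \<longrightarrow> z $ i = z' $ i) \<longrightarrow> a k z = a k z') \<and>
      (\<forall>z\<in>?D. ((\<lambda>k. monomial k z * a k z) has_sum f z) (K S))" for S a
  have "\<exists>a. Inv S a" if "finite S" for S
    using that
  proof (induction S)
    case empty
    have K0: "K {} = {\<lambda>_. 0}" by (auto simp: K_def)
    have "z = z'" if "\<forall>i. i \<notin> {} \<longrightarrow> z $ i = z' $ i" for z z' :: "complex ^ 'n"
      using that by (simp add: vec_eq_iff)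
    then show ?case
      using hol bd unfolding K0 Inv_def
      by (intro exI[of _ "\<lambda>_. f"]) (auto simp: monomial_def has_sum_finite_iff)
  next
    case (insert j S)
    from insert.IH obtain a where "Inv S a" by blast
    then have
      a1: "z \<in> ?D \<Longrightarrow> (\<lambda>\<zeta>. a k (upd z i \<zeta>)) holomorphic_on ball 0 1" and
      a2: "z \<in> ?D \<Longrightarrow> cmod (a k z) \<le> B" and
      a3: "z \<in> ?D \<Longrightarrow> z' \<in> ?D \<Longrightarrow> (\<And>i. i \<notin> S \<Longrightarrow> z $ i = z' $ i) \<Longrightarrow> a k z = a k z'" and
      a4: "z \<in> ?D \<Longrightarrow> ((\<lambda>k. monomial k z * a k z) has_sum f z) (K S)" for i k z z'
      unfolding Inv_def by blast+
    \<comment> \<open>Arguments outside the disc are sent to 0. Then the bound and the independence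
      of \<open>z\<close> hold for \<open>g\<close> at every argument, so that functions, and with
      them their derivatives at 0, can be equated.\<close>
    define cut :: "complex \<Rightarrow> complex" where "cut \<zeta> = (if cmod \<zeta> < 1 then \<zeta> else 0)" for \<zeta>
    have cut: "cmod (cut \<zeta>) < 1" for \<zeta> by (simp add: cut_def)
    have cut_id: "cmod \<zeta> < 1 \<Longrightarrow> cut \<zeta> = \<zeta>" for \<zeta> by (simp add: cut_def)
    define g where "g k z \<zeta> = a (k(j := 0)) (upd z j (cut \<zeta>))" for k z \<zeta>
    define a' where "a' k z = (deriv ^^ k j) (g k z) 0 / fact (k j)" for k z
    have ghol: "g k z holomorphic_on ball 0 1" if "z \<in> ?D" for k z
      by (rule holomorphic_transform[OF a1[OF that, of "k(j := 0)" j]]) (simp add: g_def cut_id)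
    have gB: "cmod (g k z \<zeta>) \<le> B" if "z \<in> ?D" for k z \<zeta>
      unfolding g_def by (intro a2 upd_polydisc that cut)
    have a'2: "cmod (a' k z) \<le> B" if "z \<in> ?D" for k z
      unfolding a'_def by (rule cauchy_estimate_unit[OF ghol[OF that] gB[OF that]])
    have a'3: "a' k z = a' k z'"
      if z: "z \<in> ?D" "z' \<in> ?D" and eq: "\<And>i. i \<notin> insert j S \<Longrightarrow> z $ i = z' $ i" for k z z'
    proof -
      have "g k z \<zeta> = g k z' \<zeta>" for \<zeta>
        unfolding g_def by (intro a3 upd_polydisc z cut) (use eq in auto)
      then have "g k z = g k z'" by (rule ext)
      then show ?thesis by (simp add: a'_def)
    qed
    have a'1: "(\<lambda>\<xi>. a' k (upd z i \<xi>)) holomorphic_on ball 0 1" if z: "z \<in> ?D" for k i z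
    proof (cases "i = j")
      case True
      have "a' k (upd z j \<xi>) = a' k z" if "\<xi> \<in> ball 0 1" for \<xi>
        by (rule a'3) (use that z in \<open>auto intro: upd_polydisc\<close>)
      then have "(\<lambda>\<xi>. a' k (upd z i \<xi>)) holomorphic_on ball 0 1 \<longleftrightarrow> (\<lambda>\<xi>. a' k z) holomorphic_on ball 0 1"
        using True by (intro holomorphic_cong) auto
      then show ?thesis by simp
    next
      case False
      show ?thesis unfolding a'_def
      proof (rule taylor_coefficient_holomorphic)
        show "g k (upd z i \<xi>) holomorphic_on ball 0 1" if "cmod \<xi> < 1" for \<xi>
          by (intro ghol upd_polydisc z that)
        show "cmod (g k (upd z i \<xi>) \<zeta>) \<le> B" if "cmod \<xi> < 1" for \<xi> \<zeta>
          by (intro gB upd_polydisc z that)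
        show "(\<lambda>\<xi>. g k (upd z i \<xi>) \<zeta>) holomorphic_on ball 0 1" if "cmod \<zeta> < 1" for \<zeta>
          using a1[OF upd_polydisc[OF z that], of "k(j := 0)" j i] False
          by (simp add: g_def cut_id that upd_commute[OF False])
      qed
    qed
    have a'4: "((\<lambda>k. monomial k z * a' k z) has_sum f z) (K (insert j S))" if z: "z \<in> ?D" for z
    proof -
      let ?F = "\<lambda>k. monomial k z * a' k z"
      have "(\<lambda>k. norm (?F k)) summable_on K (insert j S)"
      proof (rule Infinite_Sum.abs_summable_on_comparison_test)
        show "(\<lambda>k. norm (monomial k z * of_real B)) summable_on K (insert j S)"
          unfolding norm_mult by (intro summable_on_cmult_left norm_monomial_summable z)
        show "norm (?F k) \<le> norm (monomial k z * of_real B)" for k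
          using a'2[OF z, of k] B0 by (simp add: norm_mult mult_left_mono)
      qed
      then have "?F summable_on K (insert j S)" by (rule abs_summable_summable)
      then have tot: "(?F has_sum infsum ?F (K (insert j S))) (K (insert j S))" by (rule has_sum_infsum)
      \<comment> \<open>The exponent of the new variable is split off. The full series is known to
        be summable, so its sum may be computed by summing over this exponent first.\<close>
      have bij: "bij_betw (\<lambda>(k, m). k(j := m)) (K S \<times> UNIV) (K (insert j S))"
        by (rule bij_betwI[where g = "\<lambda>k. (k(j := 0), k j)"])
          (use insert.hyps in \<open>auto simp: K_def fun_eq_iff\<close>)
      have tot': "((\<lambda>p. ?F ((\<lambda>(k, m). k(j := m)) p)) has_sum infsum ?F (K (insert j S))) (Sigma (K S) (\<lambda>_. UNIV))"
        by (subst has_sum_reindex_bij_betw[OF bij, of ?F]) (rule tot)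
      have inner: "((\<lambda>m. ?F ((\<lambda>(k, m). k(j := m)) (k, m))) has_sum monomial k z * a k z) UNIV"
        if k: "k \<in> K S" for k
      proof -
        have kj: "k(j := 0) = k" using k insert.hyps by (auto simp: K_def)
        have zj: "cmod (z $ j) < 1" using z by (simp add: polydisc_def)
        have upz: "upd z j (z $ j) = z" by (simp add: vec_eq_iff)
        have gk: "g (k(j := m)) z = g k z" for m by (rule ext) (simp add: g_def)
        have "(\<lambda>m. (deriv ^^ m) (g k z) 0 / fact m * (z $ j - 0) ^ m) sums g k z (z $ j)"
          by (rule holomorphic_power_series[OF ghol[OF z]]) (use zj in simp)
        then have s: "(\<lambda>m. a' (k(j := m)) z * (z $ j) ^ m) sums a k z"
          by (simp add: a'_def gk) (simp add: g_def kj cut_id zj upz)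
        have "((\<lambda>m. a' (k(j := m)) z * (z $ j) ^ m) has_sum a k z) UNIV"
        proof (rule norm_summable_imp_has_sum[OF _ s])
          show "summable (\<lambda>m. norm (a' (k(j := m)) z * (z $ j) ^ m))"
          proof (rule summable_comparison_test')
            show "summable (\<lambda>m. B * cmod (z $ j) ^ m)"
              using zj by (intro summable_mult summable_geometric) simp
            show "norm (norm (a' (k(j := m)) z * (z $ j) ^ m)) \<le> B * cmod (z $ j) ^ m" for m
              using a'2[OF z] by (simp add: norm_mult norm_power mult_right_mono)
          qed
        qed
        then have "((\<lambda>m. monomial k z * (a' (k(j := m)) z * (z $ j) ^ m)) has_sum monomial k z * a k z) UNIV"
          by (rule has_sum_cmult_right)
        moreover have "monomial (k(j := m)) z = monomial k z * (z $ j) ^ m" for m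
        proof -
          have "monomial (k(j := m)) z = (z $ j) ^ m * (\<Prod>i\<in>UNIV - {j}. (z $ i) ^ k i)"
            unfolding monomial_def by (subst prod.remove[of _ j]) (auto intro!: prod.cong)
          moreover have "monomial k z = (z $ j) ^ k j * (\<Prod>i\<in>UNIV - {j}. (z $ i) ^ k i)"
            unfolding monomial_def by (subst prod.remove[of _ j]) auto
          moreover have "k j = 0" using k insert.hyps by (simp add: K_def)
          ultimately show ?thesis by simp
        qed
        ultimately show ?thesis by (simp add: mult_ac)
      qed
      have "((\<lambda>k. monomial k z * a k z) has_sum infsum ?F (K (insert j S))) (K S)"
        by (rule has_sum_SigmaD[OF tot' inner])
      with a4[OF z] have "infsum ?F (K (insert j S)) = f z" by (metis infsumI)
      with tot show ?thesis by simp
    qed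
    show ?case unfolding Inv_def using a'1 a'2 a'3 a'4 by (intro exI[of _ a'] conjI allI ballI impI) blast+
  qed
  from this[OF finite] obtain a where "Inv UNIV a" by blast
  then have a: "\<And>k z. z \<in> ?D \<Longrightarrow> cmod (a k z) \<le> B" "\<And>k z z'. z \<in> ?D \<Longrightarrow> z' \<in> ?D \<Longrightarrow> a k z = a k z'"
    "\<And>z. z \<in> ?D \<Longrightarrow> ((\<lambda>k. monomial k z * a k z) has_sum f z) (K UNIV)"
    unfolding Inv_def by blast+
  have 0: "0 \<in> ?D" by (simp add: polydisc_def)
  have KU: "K UNIV = UNIV" by (auto simp: K_def)
  show ?thesis
  proof (rule that[of "\<lambda>k. a k 0"])
    show "cmod (a k 0) \<le> B" for k by (rule a(1)[OF 0])
    show "((\<lambda>k. monomial k z * a k 0) has_sum f z) UNIV" if z: "z \<in> ?D" for z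
      using a(3)[OF z] a(2)[OF z 0] by (simp add: KU)
  qed
qed


section \<open>Fourier coefficients on the torus\<close>

definition torus_point :: "real ^ 'n::finite \<Rightarrow> complex ^ 'n"
  where "torus_point t = (\<chi> i. cis (t $ i))"

definition angle_box :: "(real ^ 'n::finite) set"
  where "angle_box = {t. \<forall>i. 0 \<le> t $ i \<and> t $ i < 2 * pi}"

definition angle_measure :: "(real ^ 'n::finite) measure"
  where "angle_measure = restrict_space lborel angle_box"

definition torus_volume :: "'n::finite itself \<Rightarrow> real"
  where "torus_volume _ = (2 * pi) ^ CARD('n)"

lemma torus_volume_pos: "torus_volume TYPE('n::finite) > 0"
  by (simp add: torus_volume_def)

lemma angle_box_sets [measurable, simp]: "angle_box \<in> sets borel"
proof -
  have "angle_box = (\<Inter>i. {t :: real ^ 'n. 0 \<le> t $ i}) \<inter> (\<Inter>i. {t. t $ i < 2 * pi})"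
    by (auto simp: angle_box_def)
  also have "\<dots> \<in> sets borel"
    by (intro sets.Int borel_closed borel_open closed_INT open_INT ballI
        closed_Collect_le open_Collect_less continuous_intros) auto
  finally show ?thesis .
qed

lemma measurable_angle_measure [measurable]:
  fixes f :: "real ^ 'n::finite \<Rightarrow> 'b::topological_space"
  assumes "continuous_on UNIV f"
  shows "f \<in> borel_measurable angle_measure"
  unfolding angle_measure_def
  by (rule measurable_restrict_space1) (use assms in \<open>simp add: borel_measurable_continuous_onI\<close>)

lemma finite_angle_measure: "finite_measure (angle_measure :: (real ^ 'n::finite) measure)"
proof
  let ?c = "cbox 0 (\<chi> i. 2 * pi) :: (real ^ 'n) set"
  have "emeasure (angle_measure :: (real ^ 'n) measure) (space angle_measure) = emeasure lborel (angle_box :: (real ^ 'n) set)"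
    unfolding angle_measure_def by (simp add: emeasure_restrict_space space_restrict_space)
  also have "\<dots> \<le> emeasure lborel ?c"
    by (intro emeasure_mono) (auto simp: angle_box_def mem_box_cart less_imp_le)
  also have "\<dots> < \<infinity>" by (simp add: emeasure_lborel_cbox_eq)
  finally show "emeasure (angle_measure :: (real ^ 'n) measure) (space angle_measure) \<noteq> \<infinity>" by simp
qed

lemma integrable_angle_measure:
  fixes f :: "real ^ 'n::finite \<Rightarrow> 'b::{banach,second_countable_topology}"
  assumes "continuous_on UNIV f" "\<And>t. norm (f t) \<le> B"
  shows "integrable angle_measure f"
proof -
  interpret finite_measure "angle_measure :: (real ^ 'n) measure" by (rule finite_angle_measure)
  show ?thesis
    by (rule integrable_const_bound[of _ B]) (use assms in \<open>auto intro: measurable_angle_measure\<close>)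
qed

lemma lborel_integral_prod:
  fixes h :: "'n::finite \<Rightarrow> real \<Rightarrow> complex"
  assumes "\<And>i. integrable lborel (h i)"
  shows "integral\<^sup>L lborel (\<lambda>t :: real ^ 'n. \<Prod>i\<in>UNIV. h i (t $ i)) = (\<Prod>i\<in>UNIV. \<integral>x. h i x \<partial>lborel)"
proof -
  have [measurable]: "h i \<in> borel_measurable borel" for i
    using borel_measurable_integrable[OF assms[of i]] by simp
  \<comment> \<open>\<open>lborel\<close> on vectors is the image of a product measure indexed by
    basis vectors; \<open>ix\<close> recovers the coordinate that a basis vector stands for.\<close>
  define ix :: "real ^ 'n \<Rightarrow> 'n" where "ix = inv (\<lambda>i. axis i 1)"
  have inj: "inj (\<lambda>i :: 'n. axis i (1::real))" by (auto simp: inj_on_def axis_eq_axis)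
  have ix: "ix (axis i 1) = i" for i unfolding ix_def by (rule inv_f_f[OF inj])
  have Basis: "(Basis :: (real ^ 'n) set) = range (\<lambda>i. axis i 1)"
    by (auto simp: Basis_vec_def)
  have prod_Basis: "(\<Prod>b\<in>(Basis :: (real ^ 'n) set). G b) = (\<Prod>i\<in>UNIV. G (axis i 1))" for G :: "real ^ 'n \<Rightarrow> complex"
    unfolding Basis by (subst prod.reindex[OF inj]) simp
  define T where "T f = (\<Sum>b\<in>(Basis :: (real ^ 'n) set). f b *\<^sub>R b)" for f
  have comp: "T f $ i = f (axis i 1)" for f i
  proof -
    have "T f $ i = (\<Sum>b\<in>Basis. f b *\<^sub>R b) \<bullet> axis i 1"
      unfolding T_def by (simp add: inner_axis)
    also have "\<dots> = f (axis i 1)" by (rule inner_sum_left_Basis) (simp add: Basis)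
    finally show ?thesis .
  qed
  define Q where "Q t = (\<Prod>i\<in>UNIV. h i (t $ i))" for t :: "real ^ 'n"
  have T: "T \<in> measurable (\<Pi>\<^sub>M b\<in>Basis. lborel) borel"
    unfolding T_def by measurable
  have nth: "(\<lambda>t :: real ^ 'n. t $ i) \<in> borel_measurable borel" for i
    by (rule borel_measurable_continuous_onI) (intro continuous_intros)
  have Q: "Q \<in> borel_measurable borel"
    unfolding Q_def[abs_def]
  proof (rule borel_measurable_prod)
    show "(\<lambda>t :: real ^ 'n. h i (t $ i)) \<in> borel_measurable borel" for i
      by (rule measurable_compose[OF nth]) measurable
  qed
  have "integral\<^sup>L lborel Q = integral\<^sup>L (distr (\<Pi>\<^sub>M b\<in>Basis. lborel) borel T) Q"
    unfolding T_def by (rule arg_cong[OF lborel_eq])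
  also have "\<dots> = (\<integral>f. Q (T f) \<partial>(\<Pi>\<^sub>M b\<in>Basis. lborel))"
    by (rule integral_distr[OF T Q])
  finally have "integral\<^sup>L lborel (\<lambda>t :: real ^ 'n. \<Prod>i\<in>UNIV. h i (t $ i)) =
    (\<integral>f. (\<Prod>i\<in>UNIV. h i (T f $ i)) \<partial>(\<Pi>\<^sub>M b\<in>Basis. lborel))"
    by (simp only: Q_def[abs_def])
  also have "\<dots> = (\<integral>f. (\<Prod>b\<in>(Basis :: (real ^ 'n) set). h (ix b) (f b)) \<partial>(\<Pi>\<^sub>M b\<in>Basis. lborel))"
    by (simp add: comp prod_Basis ix)
  also have "\<dots> = (\<Prod>b\<in>(Basis :: (real ^ 'n) set). \<integral>x. h (ix b) x \<partial>lborel)"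
  proof -
    interpret product_sigma_finite "\<lambda>_ :: real ^ 'n. lborel :: real measure" ..
    show ?thesis by (rule product_integral_prod) (use assms in auto)
  qed
  finally show ?thesis by (simp add: prod_Basis ix)
qed

lemma integral_cis_multiple:
  fixes m :: int
  shows "(\<integral>x. indicator {0..<2 * pi} x *\<^sub>R cis (of_int m * x) \<partial>lborel) = (if m = 0 then 2 * pi else 0)"
    and "integrable lborel (\<lambda>x. indicator {0..<2 * pi} x *\<^sub>R cis (of_int m * x))"
proof -
  \<comment> \<open>The half-open interval is the one in \<open>angle_box\<close>; the compact one,
    which differs by a null set, is suited to integrability and to the fundamental theorem of
    calculus.\<close>
  have ae: "AE x in lborel. indicator {0..<2 * pi} x *\<^sub>R cis (of_int m * x) = indicator {0..2 * pi} x *\<^sub>R cis (of_int m * x)"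
  proof -
    have "AE x in lborel. x \<noteq> 2 * pi" by (rule AE_lborel_singleton)
    then show ?thesis by eventually_elim (auto simp: indicator_def)
  qed
  have cont: "continuous_on A (\<lambda>x. cis (of_int m * x))" for A by (intro continuous_intros)
  have [measurable]: "(\<lambda>x. cis (of_int m * x)) \<in> borel_measurable borel"
    by (rule borel_measurable_continuous_onI[OF cont])
  have "integrable lborel (\<lambda>x. indicator {0..2 * pi} x *\<^sub>R cis (of_int m * x))"
    by (rule borel_integrable_compact[OF _ cont]) simp
  then show "integrable lborel (\<lambda>x. indicator {0..<2 * pi} x *\<^sub>R cis (of_int m * x))"
    by (subst integrable_cong_AE[OF _ _ ae]) auto
  have "(\<integral>x. indicator {0..<2 * pi} x *\<^sub>R cis (of_int m * x) \<partial>lborel) =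
    (\<integral>x. indicator {0..2 * pi} x *\<^sub>R cis (of_int m * x) \<partial>lborel)"
    by (rule integral_cong_AE[OF _ _ ae]) auto
  also have "\<dots> = (if m = 0 then 2 * pi else 0)"
  proof (cases "m = 0")
    case True
    then show ?thesis by (simp add: scaleR_conv_of_real)
  next
    case False
    define F where "F x = cis (of_int m * x) / (\<i> * of_int m)" for x
    have "(\<integral>x. indicator {0..2 * pi} x *\<^sub>R cis (of_int m * x) \<partial>lborel) = F (2 * pi) - F 0"
    proof (rule integral_FTC_Icc[OF _ _ cont])
      fix x :: real
      define f where "f w = exp (\<i> * of_int m * w) / (\<i> * of_int m)" for w
      have "(f has_field_derivative exp (\<i> * of_int m * of_real x)) (at (of_real x))"
        unfolding f_def using False by (auto intro!: derivative_eq_intros)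
      then have "((\<lambda>x. f (of_real x)) has_vector_derivative exp (\<i> * of_int m * of_real x)) (at x within {0..2 * pi})"
        by (rule has_vector_derivative_real_field)
      moreover have "(\<lambda>x. f (of_real x)) = F"
        by (simp add: fun_eq_iff f_def F_def cis_conv_exp mult.assoc)
      ultimately show "(F has_vector_derivative cis (of_int m * x)) (at x within {0..2 * pi})"
        by (simp add: cis_conv_exp mult.assoc)
    qed simp
    also have "F (2 * pi) = F 0"
      unfolding F_def using cis_multiple_2pi[of "of_int m"] by (simp add: mult.commute mult.left_commute)
    finally show ?thesis using False by simp
  qed
  finally show "(\<integral>x. indicator {0..<2 * pi} x *\<^sub>R cis (of_int m * x) \<partial>lborel) = (if m = 0 then 2 * pi else 0)" .
qed

lemma monomial_torus: "monomial k (torus_point t) = (\<Prod>i\<in>UNIV. cis (real (k i) * t $ i))"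
  by (simp only: monomial_def torus_point_def vec_lambda_beta Complex.DeMoivre)

lemma norm_monomial_torus: "cmod (monomial k (torus_point t)) = 1"
  by (simp add: monomial_torus flip: prod_norm)

lemma monomial_orthogonal:
  fixes k l :: "'n::finite \<Rightarrow> nat"
  shows "(\<integral>t. monomial k (torus_point t) * cnj (monomial l (torus_point t)) \<partial>angle_measure) =
    (if k = l then torus_volume TYPE('n) else 0)"
proof -
  let ?m = "\<lambda>i. int (k i) - int (l i)"
  have "(\<integral>t. monomial k (torus_point t) * cnj (monomial l (torus_point t)) \<partial>angle_measure) =
    (\<integral>t. indicator angle_box t *\<^sub>R (monomial k (torus_point t) * cnj (monomial l (torus_point t))) \<partial>lborel)"
    unfolding angle_measure_def by (rule integral_restrict_space) simp
  also have "\<dots> = integral\<^sup>L lborel (\<lambda>t :: real ^ 'n. \<Prod>i\<in>UNIV. indicator {0..<2 * pi} (t $ i) *\<^sub>R cis (of_int (?m i) * t $ i))"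
  proof (rule Bochner_Integration.integral_cong[OF refl])
    fix t :: "real ^ 'n"
    have "monomial k (torus_point t) * cnj (monomial l (torus_point t)) = (\<Prod>i\<in>UNIV. cis (of_int (?m i) * t $ i))"
      by (simp add: monomial_torus cis_cnj cis_mult algebra_simps flip: prod.distrib)
    moreover have "(indicator angle_box t :: real) = (\<Prod>i\<in>UNIV. indicator {0..<2 * pi} (t $ i))"
      by (auto simp: angle_box_def indicator_def)
    ultimately show "indicator angle_box t *\<^sub>R (monomial k (torus_point t) * cnj (monomial l (torus_point t))) =
        (\<Prod>i\<in>UNIV. indicator {0..<2 * pi} (t $ i) *\<^sub>R cis (of_int (?m i) * t $ i))"
      by (simp add: scaleR_conv_of_real prod.distrib)
  qed
  also have "\<dots> = (\<Prod>i\<in>UNIV. if ?m i = 0 then complex_of_real (2 * pi) else 0)"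
    unfolding lborel_integral_prod[OF integral_cis_multiple(2)] integral_cis_multiple(1) by (auto intro!: prod.cong)
  also have "\<dots> = (if k = l then torus_volume TYPE('n) else 0)"
    by (auto simp: torus_volume_def fun_eq_iff)
  finally show ?thesis .
qed


section \<open>Power series with vector coefficients\<close>

abbreviation total_degree :: "('n::finite \<Rightarrow> nat) \<Rightarrow> nat"
  where "total_degree k \<equiv> (\<Sum>i\<in>UNIV. k i)"

abbreviation radial_point :: "real \<Rightarrow> real ^ 'n::finite \<Rightarrow> complex ^ 'n"
  where "radial_point r t \<equiv> r *\<^sub>R torus_point t"

lemma radial_point_polydisc: "0 \<le> r \<Longrightarrow> r < 1 \<Longrightarrow> radial_point r t \<in> polydisc"
  by (simp add: polydisc_def torus_point_def vector_scaleR_component)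

lemma continuous_torus_point: "continuous_on UNIV (torus_point :: real ^ 'n::finite \<Rightarrow> complex ^ 'n)"
  unfolding torus_point_def[abs_def] by (intro continuous_intros continuous_on_vec_lambda)

lemma continuous_monomial_torus: "continuous_on UNIV (\<lambda>t. monomial k (torus_point t))"
  unfolding monomial_torus by (intro continuous_intros)

lemma continuous_radial:
  assumes "continuous_on polydisc F" "0 \<le> r" "r < 1"
  shows "continuous_on UNIV (\<lambda>t. F (radial_point r t))"
  by (rule continuous_on_compose2[OF assms(1)])
    (use assms(2,3) in \<open>auto intro!: continuous_on_scaleR continuous_on_const continuous_torus_point radial_point_polydisc\<close>)

text \<open>An enumeration of the multi-indices, for the convergence theorems about series over the
  naturals.\<close>

lemma bij_multi_index: "bij_betw (from_nat_into (UNIV :: ('n::finite \<Rightarrow> nat) set)) UNIV UNIV"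
proof (rule bij_betw_from_nat_into)
  have "inj (\<lambda>m (i :: 'n). m :: nat)" by (auto simp: inj_on_def fun_eq_iff)
  then show "infinite (UNIV :: ('n \<Rightarrow> nat) set)"
    by (metis finite_imageD infinite_UNIV_nat finite_subset subset_UNIV)
qed simp

lemma has_sum_angle_integral:
  fixes f :: "('n::finite \<Rightarrow> nat) \<Rightarrow> real ^ 'n \<Rightarrow> complex"
  assumes cont: "\<And>k. continuous_on UNIV (f k)" and bd: "\<And>k t. cmod (f k t) \<le> w k"
    and w: "w summable_on UNIV" and g: "\<And>t. ((\<lambda>k. f k t) has_sum g t) UNIV"
  shows "((\<lambda>k. integral\<^sup>L angle_measure (f k)) has_sum integral\<^sup>L angle_measure g) UNIV"
proof -
  interpret finite_measure "angle_measure :: (real ^ 'n) measure" by (rule finite_angle_measure)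
  define e :: "nat \<Rightarrow> 'n \<Rightarrow> nat" where "e = from_nat_into UNIV"
  have e: "bij_betw e UNIV UNIV" unfolding e_def by (rule bij_multi_index)
  have w0: "0 \<le> w k" for k using bd[of k 0] norm_ge_zero order_trans by blast
  have we: "summable (\<lambda>i. w (e i))"
    using summable_on_reindex_bij_betw[OF e, of w] w summable_on_UNIV_nonneg_real_iff[of "\<lambda>i. w (e i)"] w0 by simp
  have int: "integrable angle_measure (f k)" for k by (rule integrable_angle_measure[OF cont bd])
  have nle: "(\<integral>t. norm (f k t) \<partial>angle_measure) \<le> w k * measure angle_measure (space (angle_measure :: (real ^ 'n) measure))" for k
  proof -
    have "(\<integral>t. norm (f k t) \<partial>angle_measure) \<le> (\<integral>t. w k \<partial>(angle_measure :: (real ^ 'n) measure))"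
      by (rule integral_mono) (use int bd in auto)
    then show ?thesis by (simp add: mult.commute)
  qed
  have sums: "(\<lambda>i. integral\<^sup>L angle_measure (f (e i))) sums (\<integral>t. (\<Sum>i. f (e i) t) \<partial>angle_measure)"
    and snorm: "summable (\<lambda>i. \<integral>t. norm (f (e i) t) \<partial>angle_measure)"
  proof -
    show s: "summable (\<lambda>i. \<integral>t. norm (f (e i) t) \<partial>angle_measure)"
      by (rule summable_comparison_test'[OF summable_mult2[OF we]]) (use nle in auto)
    show "(\<lambda>i. integral\<^sup>L angle_measure (f (e i))) sums (\<integral>t. (\<Sum>i. f (e i) t) \<partial>angle_measure)"
      by (rule sums_integral[OF int _ s])
        (auto intro!: summable_comparison_test'[OF we] bd)
  qed
  have "(\<Sum>i. f (e i) t) = g t" for t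
    using has_sum_imp_sums[OF has_sum_reindex_bij_betw[OF e, of "\<lambda>k. f k t", THEN iffD2, OF g]]
    by (simp add: sums_iff)
  with sums have "(\<lambda>i. integral\<^sup>L angle_measure (f (e i))) sums integral\<^sup>L angle_measure g" by simp
  then have "((\<lambda>i. integral\<^sup>L angle_measure (f (e i))) has_sum integral\<^sup>L angle_measure g) UNIV"
    by (rule norm_summable_imp_has_sum[rotated])
      (rule summable_comparison_test'[OF snorm], simp add: integral_norm_bound)
  then show ?thesis
    using has_sum_reindex_bij_betw[OF e, of "\<lambda>k. integral\<^sup>L angle_measure (f k)"] by simp
qed

lemma summable_radius_power:
  fixes r :: real
  assumes "0 \<le> r" "r < 1"
  shows "(\<lambda>k :: 'n::finite \<Rightarrow> nat. r ^ total_degree k) summable_on UNIV"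
proof -
  have "(\<chi> i. of_real r) \<in> (polydisc :: (complex ^ 'n) set)" using assms by (simp add: polydisc_def)
  from norm_monomial_summable[OF this, of UNIV] show ?thesis
    using assms by (simp add: norm_monomial power_sum)
qed

lemma scalar_coefficient:
  fixes \<phi> :: "complex ^ 'n::finite \<Rightarrow> complex"
  assumes ser: "\<And>z. z \<in> polydisc \<Longrightarrow> ((\<lambda>k. monomial k z * \<alpha> k) has_sum \<phi> z) UNIV"
    and bd: "\<And>k. cmod (\<alpha> k) \<le> B" and r: "0 \<le> r" "r < 1"
  shows "(\<integral>t. cnj (monomial l (torus_point t)) * \<phi> (radial_point r t) \<partial>angle_measure) =
    of_real (torus_volume TYPE('n) * r ^ total_degree l) * \<alpha> l"
proof -
  define f where "f k t = cnj (monomial l (torus_point t)) * (monomial k (radial_point r t) * \<alpha> k)" for k and t :: "real ^ 'n"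
  define X where "X = (\<integral>t. cnj (monomial l (torus_point t)) * \<phi> (radial_point r t) \<partial>angle_measure)"
  have f: "f k t = of_real (r ^ total_degree k) * \<alpha> k * (monomial k (torus_point t) * cnj (monomial l (torus_point t)))" for k t
    by (simp add: f_def monomial_scaleR mult_ac)
  have "((\<lambda>k. integral\<^sup>L angle_measure (f k)) has_sum X) UNIV"
    unfolding X_def
  proof (rule has_sum_angle_integral[where w = "\<lambda>k. r ^ total_degree k * B"])
    show "continuous_on UNIV (f k)" for k
      unfolding f[abs_def] by (intro continuous_intros continuous_monomial_torus)
    show "cmod (f k t) \<le> r ^ total_degree k * B" for k t
      unfolding f norm_mult using r bd[of k]
      by (simp add: norm_monomial_torus norm_power mult_left_mono)
    show "(\<lambda>k :: 'n \<Rightarrow> nat. r ^ total_degree k * B) summable_on UNIV"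
      by (intro summable_on_cmult_left summable_radius_power r)
    show "((\<lambda>k. f k t) has_sum cnj (monomial l (torus_point t)) * \<phi> (radial_point r t)) UNIV" for t
      unfolding f_def by (intro has_sum_cmult_right ser radial_point_polydisc r)
  qed
  moreover have "integral\<^sup>L angle_measure (f k) =
      (if k = l then of_real (torus_volume TYPE('n) * r ^ total_degree l) * \<alpha> l else 0)" for k
    unfolding f[abs_def] integral_mult_right_zero monomial_orthogonal by (simp add: mult_ac)
  ultimately have "((\<lambda>k. if k = l then of_real (torus_volume TYPE('n) * r ^ total_degree l) * \<alpha> l else 0) has_sum X) UNIV"
    by simp
  moreover have "((\<lambda>k. if k = l then of_real (torus_volume TYPE('n) * r ^ total_degree l) * \<alpha> l else 0) has_sum
      of_real (torus_volume TYPE('n) * r ^ total_degree l) * \<alpha> l) UNIV"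
    by (rule has_sum_finite_neutralI[of "{l}"]) auto
  ultimately show ?thesis unfolding X_def[symmetric] by (metis infsumI)
qed

definition power_series_on_polydisc ::
    "(complex ^ 'n::finite \<Rightarrow> 'f::complex_hilbert) \<Rightarrow> (('n \<Rightarrow> nat) \<Rightarrow> 'f) \<Rightarrow> real \<Rightarrow> bool"
  where "power_series_on_polydisc F a B \<longleftrightarrow>
    continuous_on polydisc F \<and> (\<forall>z\<in>polydisc. norm (F z) \<le> B) \<and> (\<forall>k. norm (a k) \<le> B) \<and>
    (\<forall>z\<in>polydisc. ((\<lambda>k. monomial k z *\<^sub>C a k) has_sum F z) UNIV)"

lemma power_series_on_polydiscD:
  assumes "power_series_on_polydisc F a B"
  shows "continuous_on polydisc F" "z \<in> polydisc \<Longrightarrow> norm (F z) \<le> B" "norm (a k) \<le> B"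
    "z \<in> polydisc \<Longrightarrow> ((\<lambda>k. monomial k z *\<^sub>C a k) has_sum F z) UNIV"
  using assms by (auto simp: power_series_on_polydisc_def)

lemma norm_le_if_cinner_le:
  assumes "0 \<le> B" "\<And>v. cmod (cinner x v) \<le> B * norm v"
  shows "norm x \<le> B"
proof (cases "x = 0")
  case False
  have "norm x * norm x = cmod (cinner x x)" by (simp add: cinner_self power2_eq_square norm_mult)
  also have "\<dots> \<le> B * norm x" by (rule assms)
  finally show ?thesis using False by simp
qed (use assms(1) in simp)

text \<open>From weak to strong. The scalar Taylor coefficients of <F, v> are integrals over a
  torus, hence inner products of \<open>v\<close> with one vector-valued integral. Bounding these
  for all \<open>v\<close> bounds the vectors, so the vector series converges absolutely, and its
  sum is identified by pairing with \<open>v\<close> again.\<close>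

lemma power_series_coefficients:
  fixes F :: "complex ^ 'n::finite \<Rightarrow> 'f::{complex_hilbert,polish_space}"
  assumes cont: "continuous_on polydisc F" and bd: "\<And>z. z \<in> polydisc \<Longrightarrow> norm (F z) \<le> B"
    and hol: "\<And>v z i. z \<in> polydisc \<Longrightarrow> (\<lambda>\<zeta>. cinner (F (upd z i \<zeta>)) v) holomorphic_on ball 0 1"
  obtains a where "power_series_on_polydisc F a B"
proof -
  let ?V = "torus_volume TYPE('n)"
  have 0: "0 \<in> (polydisc :: (complex ^ 'n) set)" by (simp add: polydisc_def)
  have B0: "0 \<le> B" by (rule order_trans[OF norm_ge_zero bd[OF 0]])
  \<comment> \<open>The Cauchy formula on the torus of radius 1/2; the scalar undoes the
    unnormalised volume and the powers of the radius.\<close>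
  define a where "a k = (1 / (?V * (1/2) ^ total_degree k)) *\<^sub>R
    (\<integral>t. cnj (monomial k (torus_point t)) *\<^sub>C F (radial_point (1/2) t) \<partial>angle_measure)" for k
  have contF: "continuous_on UNIV (\<lambda>t. cnj (monomial k (torus_point t)) *\<^sub>C F (radial_point (1/2) t))" for k
    by (intro scaleC.continuous_on continuous_intros continuous_monomial_torus continuous_radial[OF cont]) auto
  have intF: "integrable angle_measure (\<lambda>t. cnj (monomial k (torus_point t)) *\<^sub>C F (radial_point (1/2) t))" for k
    by (rule integrable_angle_measure[OF contF, of _ B])
      (simp add: norm_scaleC norm_monomial_torus bd radial_point_polydisc)
  have weak: "cmod (cinner (a k) v) \<le> B * norm v \<and>
      (\<forall>z\<in>polydisc. ((\<lambda>k. monomial k z * cinner (a k) v) has_sum cinner (F z) v) UNIV)" for k v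
  proof -
    obtain \<alpha> where \<alpha>: "\<And>k. cmod (\<alpha> k) \<le> B * norm v"
      "\<And>z. z \<in> polydisc \<Longrightarrow> ((\<lambda>k. monomial k z * \<alpha> k) has_sum cinner (F z) v) UNIV"
    proof (rule polydisc_taylor[of "\<lambda>z. cinner (F z) v" "B * norm v"])
      show "cmod (cinner (F z) v) \<le> B * norm v" if "z \<in> polydisc" for z
        by (rule order_trans[OF cinner_cauchy_schwarz]) (intro mult_right_mono bd that, simp)
    qed (use hol in auto)
    have "cinner (a k) v = \<alpha> k" for k
    proof -
      have "cinner (\<integral>t. cnj (monomial k (torus_point t)) *\<^sub>C F (radial_point (1/2) t) \<partial>angle_measure) v =
        (\<integral>t. cinner (cnj (monomial k (torus_point t)) *\<^sub>C F (radial_point (1/2) t)) v \<partial>angle_measure)"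
        by (rule integral_bounded_linear[OF cinner.bounded_linear_left intF, symmetric])
      also have "\<dots> = of_real (?V * (1/2) ^ total_degree k) * \<alpha> k"
        unfolding cinner_scaleC_left by (rule scalar_coefficient[OF \<alpha>(2,1)]) auto
      finally show ?thesis
        using torus_volume_pos[where 'n = 'n] by (simp add: a_def cinner_scaleR_left scaleR_conv_of_real)
    qed
    with \<alpha> show ?thesis by simp
  qed
  have aB: "norm (a k) \<le> B" for k by (rule norm_le_if_cinner_le[OF B0]) (use weak in blast)
  have "((\<lambda>k. monomial k z *\<^sub>C a k) has_sum F z) UNIV" if z: "z \<in> polydisc" for z
  proof -
    have "(\<lambda>k. norm (monomial k z *\<^sub>C a k)) summable_on UNIV"
    proof (rule Infinite_Sum.abs_summable_on_comparison_test)
      show "(\<lambda>k. norm (monomial k z * of_real B)) summable_on UNIV"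
        unfolding norm_mult by (intro summable_on_cmult_left norm_monomial_summable z)
      show "norm (monomial k z *\<^sub>C a k) \<le> norm (monomial k z * of_real B)" for k
        using aB[of k] B0 by (simp add: norm_scaleC norm_mult mult_left_mono)
    qed
    then have "(\<lambda>k. monomial k z *\<^sub>C a k) summable_on UNIV" by (rule abs_summable_summable)
    then obtain s where s: "((\<lambda>k. monomial k z *\<^sub>C a k) has_sum s) UNIV" by (auto simp: summable_on_def)
    have "cinner s v = cinner (F z) v" for v
    proof -
      have "((\<lambda>k. cinner (monomial k z *\<^sub>C a k) v) has_sum cinner s v) UNIV"
        by (rule has_sum_bounded_linear[OF cinner.bounded_linear_left s])
      then show ?thesis using weak[of _ v] z by (metis (no_types, lifting) cinner_scaleC_left has_sum_cong infsumI)
    qed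
    then have "s = F z" by (rule cinner_ext_left)
    with s show ?thesis by simp
  qed
  then show ?thesis
    using that[of a] cont bd aB unfolding power_series_on_polydisc_def by blast
qed

lemma vector_coefficient:
  fixes F :: "complex ^ 'n::finite \<Rightarrow> 'f::{complex_hilbert,polish_space}"
  assumes F: "power_series_on_polydisc F a B" and r: "0 \<le> r" "r < 1"
  shows "(\<integral>t. cnj (monomial l (torus_point t)) *\<^sub>C F (radial_point r t) \<partial>angle_measure) =
    (torus_volume TYPE('n) * r ^ total_degree l) *\<^sub>R a l"
proof (rule cinner_ext_left)
  fix v
  note FD = power_series_on_polydiscD[OF F]
  have "continuous_on UNIV (\<lambda>t. cnj (monomial l (torus_point t)) *\<^sub>C F (radial_point r t))"
    by (intro scaleC.continuous_on continuous_intros continuous_monomial_torus continuous_radial[OF FD(1)] r)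
  then have int: "integrable angle_measure (\<lambda>t. cnj (monomial l (torus_point t)) *\<^sub>C F (radial_point r t))"
    by (rule integrable_angle_measure[of _ B])
      (simp add: norm_scaleC norm_monomial_torus FD radial_point_polydisc r)
  have "cinner (\<integral>t. cnj (monomial l (torus_point t)) *\<^sub>C F (radial_point r t) \<partial>angle_measure) v =
    (\<integral>t. cinner (cnj (monomial l (torus_point t)) *\<^sub>C F (radial_point r t)) v \<partial>angle_measure)"
    by (rule integral_bounded_linear[OF cinner.bounded_linear_left int, symmetric])
  also have "\<dots> = of_real (torus_volume TYPE('n) * r ^ total_degree l) * cinner (a l) v"
    unfolding cinner_scaleC_left
  proof (rule scalar_coefficient[OF _ _ r])
    show "((\<lambda>k. monomial k z * cinner (a k) v) has_sum cinner (F z) v) UNIV" if "z \<in> polydisc" for z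
      using has_sum_bounded_linear[OF cinner.bounded_linear_left FD(4)[OF that], of v]
      by (simp add: cinner_scaleC_left)
    show "cmod (cinner (a k) v) \<le> B * norm v" for k
      by (rule order_trans[OF cinner_cauchy_schwarz]) (intro mult_right_mono FD, simp)
  qed
  finally show "cinner (\<integral>t. cnj (monomial l (torus_point t)) *\<^sub>C F (radial_point r t) \<partial>angle_measure) v =
      cinner ((torus_volume TYPE('n) * r ^ total_degree l) *\<^sub>R a l) v"
    by (simp add: cinner_scaleR_left scaleR_conv_of_real)
qed

text \<open>Only \<open>F\<close> is expanded. Integrating a single term against \<open>G\<close>
  already produces a coefficient of \<open>G\<close>, so no double series arises.\<close>

lemma parseval_radius:
  fixes F G :: "complex ^ 'n::finite \<Rightarrow> 'f::{complex_hilbert,polish_space}"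
  assumes F: "power_series_on_polydisc F a B" and G: "power_series_on_polydisc G b B'"
    and r: "0 \<le> r" "r < 1"
  shows "((\<lambda>k. of_real (torus_volume TYPE('n) * (r ^ total_degree k)\<^sup>2) * cinner (a k) (b k)) has_sum
    (\<integral>t. cinner (F (radial_point r t)) (G (radial_point r t)) \<partial>angle_measure)) UNIV"
proof -
  note FD = power_series_on_polydiscD[OF F] and GD = power_series_on_polydiscD[OF G]
  note rp = radial_point_polydisc[OF r]
  have B0: "0 \<le> B" "0 \<le> B'" using FD(3) GD(3) norm_ge_zero order_trans by blast+
  define f where "f k t = cinner (monomial k (radial_point r t) *\<^sub>C a k) (G (radial_point r t))" for k and t :: "real ^ 'n"
  have contG: "continuous_on UNIV (\<lambda>t. cnj (monomial k (torus_point t)) *\<^sub>C G (radial_point r t))" for k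
    by (intro scaleC.continuous_on continuous_intros continuous_monomial_torus continuous_radial[OF GD(1)] r)
  have intG: "integrable angle_measure (\<lambda>t. cnj (monomial k (torus_point t)) *\<^sub>C G (radial_point r t))" for k
    by (rule integrable_angle_measure[OF contG, of _ B'])
      (simp add: norm_scaleC norm_monomial_torus GD rp)
  have f: "f k t = of_real (r ^ total_degree k) * cinner (a k) (cnj (monomial k (torus_point t)) *\<^sub>C G (radial_point r t))" for k t
    by (simp add: f_def monomial_scaleR cinner_scaleC_left cinner_scaleC_right mult_ac)
  have "((\<lambda>k. integral\<^sup>L angle_measure (f k)) has_sum
      (\<integral>t. cinner (F (radial_point r t)) (G (radial_point r t)) \<partial>angle_measure)) UNIV"
  proof (rule has_sum_angle_integral[where w = "\<lambda>k. r ^ total_degree k * (B * B')"])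
    show "continuous_on UNIV (f k)" for k
      unfolding f[abs_def] by (intro continuous_intros cinner.continuous_on contG)
    show "cmod (f k t) \<le> r ^ total_degree k * (B * B')" for k t
    proof -
      have "cmod (cinner (a k) (cnj (monomial k (torus_point t)) *\<^sub>C G (radial_point r t))) \<le>
          norm (a k) * norm (cnj (monomial k (torus_point t)) *\<^sub>C G (radial_point r t))"
        by (rule cinner_cauchy_schwarz)
      also have "\<dots> \<le> B * B'"
        using FD(3)[of k] GD(2)[OF rp, of t] B0 by (intro mult_mono) (auto simp: norm_scaleC norm_monomial_torus)
      finally show ?thesis
        unfolding f norm_mult using r by (simp add: norm_power mult_left_mono)
    qed
    show "(\<lambda>k :: 'n \<Rightarrow> nat. r ^ total_degree k * (B * B')) summable_on UNIV"
      by (intro summable_on_cmult_left summable_radius_power r)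
    show "((\<lambda>k. f k t) has_sum cinner (F (radial_point r t)) (G (radial_point r t))) UNIV" for t
      unfolding f_def by (rule has_sum_bounded_linear[OF cinner.bounded_linear_left FD(4)[OF rp]])
  qed
  moreover have "integral\<^sup>L angle_measure (f k) =
      of_real (torus_volume TYPE('n) * (r ^ total_degree k)\<^sup>2) * cinner (a k) (b k)" for k
  proof -
    have "integral\<^sup>L angle_measure (f k) = of_real (r ^ total_degree k) *
        (\<integral>t. cinner (a k) (cnj (monomial k (torus_point t)) *\<^sub>C G (radial_point r t)) \<partial>angle_measure)"
      unfolding f[abs_def] by simp
    also have "(\<integral>t. cinner (a k) (cnj (monomial k (torus_point t)) *\<^sub>C G (radial_point r t)) \<partial>angle_measure) =
        cinner (a k) ((torus_volume TYPE('n) * r ^ total_degree k) *\<^sub>R b k)"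
      unfolding vector_coefficient[OF G r, symmetric]
      by (rule integral_bounded_linear[OF cinner.bounded_linear_right intG])
    finally show ?thesis
      by (simp add: cinner_scaleR_right scaleR_conv_of_real power2_eq_square mult_ac)
  qed
  ultimately show ?thesis by simp
qed

definition radius :: "nat \<Rightarrow> real" where "radius n = 1 - 1 / real (Suc (Suc n))"

lemma radius: "0 \<le> radius n" "radius n < 1" "radius \<longlonglongrightarrow> 1"
proof -
  show "0 \<le> radius n" "radius n < 1" by (simp_all add: radius_def field_simps)
  have "(\<lambda>n. 1 - 1 / real (Suc (Suc n))) \<longlonglongrightarrow> 1 - 0"
    by (intro tendsto_intros LIMSEQ_Suc lim_1_over_n)
  then show "radius \<longlonglongrightarrow> 1" by (simp add: radius_def[abs_def])
qed

lemma radius_at_left: "filterlim radius (at_left 1) sequentially"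
  by (rule tendsto_imp_filterlim_at_left[OF radius(3)]) (simp add: radius(2))

lemma measure_angle: "measure angle_measure (space (angle_measure :: (real ^ 'n::finite) measure)) = torus_volume TYPE('n)"
proof -
  have "complex_of_real (measure angle_measure (space (angle_measure :: (real ^ 'n) measure))) =
      (\<integral>t. 1 \<partial>(angle_measure :: (real ^ 'n) measure))"
    by (simp add: scaleR_conv_of_real)
  also have "\<dots> = (\<integral>t. monomial (\<lambda>_. 0) (torus_point t) * cnj (monomial (\<lambda>_. 0) (torus_point t)) \<partial>(angle_measure :: (real ^ 'n) measure))"
    by (simp add: monomial_def)
  also have "\<dots> = of_real (torus_volume TYPE('n))" unfolding monomial_orthogonal by simp
  finally show ?thesis by (simp only: of_real_eq_iff)
qed

text \<open>Parseval with both functions equal to \<open>F\<close> bounds every finite sum with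
  weights \<open>r\<close> to the power 2|k| by the square of \<open>B\<close>, uniformly in
  \<open>r\<close>; then the weights tend to 1.\<close>

lemma square_summable_coefficients:
  fixes F :: "complex ^ 'n::finite \<Rightarrow> 'f::{complex_hilbert,polish_space}"
  assumes F: "power_series_on_polydisc F a B"
  shows "(\<lambda>k. (norm (a k))\<^sup>2) summable_on UNIV"
proof (rule nonneg_bdd_above_summable_on)
  note FD = power_series_on_polydiscD[OF F]
  interpret finite_measure "angle_measure :: (real ^ 'n) measure" by (rule finite_angle_measure)
  let ?V = "torus_volume TYPE('n)"
  show "bdd_above (sum (\<lambda>k. (norm (a k))\<^sup>2) ` {S. S \<subseteq> UNIV \<and> finite S})"
  proof (rule bdd_aboveI2)
    fix S :: "('n \<Rightarrow> nat) set" assume "S \<in> {S. S \<subseteq> UNIV \<and> finite S}"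
    then have S: "finite S" by simp
    have le: "(\<Sum>k\<in>S. (radius n ^ total_degree k)\<^sup>2 * (norm (a k))\<^sup>2) \<le> B\<^sup>2" for n
    proof -
      let ?r = "radius n"
      note rp = radial_point_polydisc[OF radius(1,2)[of n]]
      have "((\<lambda>k. Re (of_real (?V * (?r ^ total_degree k)\<^sup>2) * cinner (a k) (a k))) has_sum
        Re (\<integral>t. cinner (F (radial_point ?r t)) (F (radial_point ?r t)) \<partial>angle_measure)) UNIV"
        by (rule has_sum_bounded_linear[OF bounded_linear_Re parseval_radius[OF F F radius(1,2)]])
      then have "((\<lambda>k. ?V * ((?r ^ total_degree k)\<^sup>2 * (norm (a k))\<^sup>2)) has_sum
        Re (\<integral>t. cinner (F (radial_point ?r t)) (F (radial_point ?r t)) \<partial>angle_measure)) UNIV"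
        by (simp add: Re_cinner_self mult.assoc del: of_real_mult)
      then have "(\<Sum>k\<in>S. ?V * ((?r ^ total_degree k)\<^sup>2 * (norm (a k))\<^sup>2)) \<le>
          Re (\<integral>t. cinner (F (radial_point ?r t)) (F (radial_point ?r t)) \<partial>angle_measure)"
        by (rule finite_sum_le_has_sum) (use S torus_volume_pos[where 'n = 'n] in auto)
      also have "\<dots> \<le> cmod (\<integral>t. cinner (F (radial_point ?r t)) (F (radial_point ?r t)) \<partial>angle_measure)"
        by (rule complex_Re_le_cmod)
      also have "\<dots> \<le> (\<integral>t. norm (cinner (F (radial_point ?r t)) (F (radial_point ?r t))) \<partial>angle_measure)"
        by (rule integral_norm_bound)
      also have "\<dots> \<le> (\<integral>t. B\<^sup>2 \<partial>(angle_measure :: (real ^ 'n) measure))"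
      proof (rule integral_mono)
        have le: "norm (cinner (F (radial_point ?r t)) (F (radial_point ?r t))) \<le> B\<^sup>2" for t
          using FD(2)[OF rp, of t] by (simp add: cinner_self norm_power power_mono)
        then show "norm (cinner (F (radial_point ?r t)) (F (radial_point ?r t))) \<le> B\<^sup>2" for t .
        show "integrable angle_measure (\<lambda>t. norm (cinner (F (radial_point ?r t)) (F (radial_point ?r t))))"
          by (rule integrable_norm, rule integrable_angle_measure[of _ "B\<^sup>2"])
            (use le in \<open>auto intro!: cinner.continuous_on continuous_radial[OF FD(1)] radius\<close>)
      qed simp
      also have "\<dots> = ?V * B\<^sup>2" by (simp add: measure_angle)
      finally have "?V * (\<Sum>k\<in>S. (?r ^ total_degree k)\<^sup>2 * (norm (a k))\<^sup>2) \<le> ?V * B\<^sup>2"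
        by (simp add: sum_distrib_left)
      then show ?thesis using torus_volume_pos[where 'n = 'n] by simp
    qed
    have "(\<lambda>n. \<Sum>k\<in>S. (radius n ^ total_degree k)\<^sup>2 * (norm (a k))\<^sup>2) \<longlonglongrightarrow> (\<Sum>k\<in>S. (1 ^ total_degree k)\<^sup>2 * (norm (a k))\<^sup>2)"
      by (intro tendsto_intros radius(3))
    then show "(\<Sum>k\<in>S. (norm (a k))\<^sup>2) \<le> B\<^sup>2"
      using LIMSEQ_le_const2[of _ "\<Sum>k\<in>S. (norm (a k))\<^sup>2" "B\<^sup>2"] le by auto
  qed
qed simp

lemma cmod_cinner_le_squares: "cmod (cinner x y) \<le> (norm x)\<^sup>2 + (norm y)\<^sup>2"
proof -
  have "2 * (norm x * norm y) \<le> (norm x)\<^sup>2 + (norm y)\<^sup>2"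
    using zero_le_power2[of "norm x - norm y"] by (simp add: power2_eq_square algebra_simps)
  moreover have "0 \<le> norm x * norm y" by simp
  ultimately show ?thesis using cinner_cauchy_schwarz[of x y] by linarith
qed

text \<open>Parseval at radius \<open>r\<close> is passed to the limit on both sides. The integrals
  converge by dominated convergence, since the values are bounded and boundary limits exist almost
  everywhere; the series converges by Tannery's theorem, since the coefficients are square
  summable.\<close>

theorem parseval_boundary:
  fixes F G :: "complex ^ 'n::finite \<Rightarrow> 'f::{complex_hilbert,polish_space}"
  assumes F: "power_series_on_polydisc F a B" and G: "power_series_on_polydisc G b B'"
    and lim: "AE t in angle_measure. \<exists>y y'.
      ((\<lambda>r::real. F (radial_point r t)) \<longlongrightarrow> y) (at_left 1) \<and> ((\<lambda>r::real. G (radial_point r t)) \<longlongrightarrow> y') (at_left 1) \<and>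
      cinner y y' = monomial l (torus_point t) * cnj (monomial m (torus_point t)) * c"
  shows "((\<lambda>k. cinner (a k) (b k)) has_sum (if l = m then c else 0)) UNIV"
proof -
  note FD = power_series_on_polydiscD[OF F] and GD = power_series_on_polydiscD[OF G]
  let ?V = "torus_volume TYPE('n)"
  have B0: "0 \<le> B" "0 \<le> B'" using FD(3) GD(3) norm_ge_zero order_trans by blast+
  define L where "L n = (\<integral>t. cinner (F (radial_point (radius n) t)) (G (radial_point (radius n) t)) \<partial>angle_measure)" for n
  have "L \<longlonglongrightarrow> (\<integral>t. monomial l (torus_point t) * cnj (monomial m (torus_point t)) * c \<partial>(angle_measure :: (real ^ 'n) measure))"
    unfolding L_def
  proof (rule integral_dominated_convergence[where w = "\<lambda>_. B * B'"])
    show "(\<lambda>t. monomial l (torus_point t) * cnj (monomial m (torus_point t)) * c) \<in> borel_measurable (angle_measure :: (real ^ 'n) measure)"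
      by (intro measurable_angle_measure continuous_intros continuous_monomial_torus)
    show "(\<lambda>t. cinner (F (radial_point (radius n) t)) (G (radial_point (radius n) t))) \<in> borel_measurable angle_measure" for n
      by (intro measurable_angle_measure cinner.continuous_on continuous_radial[OF FD(1)] continuous_radial[OF GD(1)] radius)
    show "integrable (angle_measure :: (real ^ 'n) measure) (\<lambda>_. B * B')"
      by (rule integrable_angle_measure[of _ "norm (B * B')"]) auto
    show "AE t in angle_measure. norm (cinner (F (radial_point (radius n) t)) (G (radial_point (radius n) t))) \<le> B * B'" for n
    proof (rule AE_I2)
      fix t :: "real ^ 'n"
      note rp = radial_point_polydisc[OF radius(1,2)[of n]]
      show "norm (cinner (F (radial_point (radius n) t)) (G (radial_point (radius n) t))) \<le> B * B'"
        by (rule order_trans[OF cinner_cauchy_schwarz]) (intro mult_mono FD GD rp B0 norm_ge_zero)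
    qed
    show "AE t in angle_measure. (\<lambda>n. cinner (F (radial_point (radius n) t)) (G (radial_point (radius n) t)))
        \<longlonglongrightarrow> monomial l (torus_point t) * cnj (monomial m (torus_point t)) * c"
      using lim
    proof eventually_elim
      case (elim t)
      then obtain y y' where y: "((\<lambda>r. F (radial_point r t)) \<longlongrightarrow> y) (at_left 1)" "((\<lambda>r. G (radial_point r t)) \<longlongrightarrow> y') (at_left 1)"
        "cinner y y' = monomial l (torus_point t) * cnj (monomial m (torus_point t)) * c" by blast
      show ?case
        unfolding y(3)[symmetric]
        by (intro cinner.tendsto filterlim_compose[OF y(1) radius_at_left] filterlim_compose[OF y(2) radius_at_left])
    qed
  qed
  also have "(\<integral>t. monomial l (torus_point t) * cnj (monomial m (torus_point t)) * c \<partial>(angle_measure :: (real ^ 'n) measure)) =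
      ?V * (if l = m then c else 0)"
    unfolding integral_mult_left_zero monomial_orthogonal by simp
  finally have L1: "L \<longlonglongrightarrow> ?V * (if l = m then c else 0)" .
  define e :: "nat \<Rightarrow> 'n \<Rightarrow> nat" where "e = from_nat_into UNIV"
  have e: "bij_betw e UNIV UNIV" unfolding e_def by (rule bij_multi_index)
  define w where "w k = (norm (a k))\<^sup>2 + (norm (b k))\<^sup>2" for k
  have "w summable_on UNIV"
    unfolding w_def by (intro summable_on_add square_summable_coefficients[OF F] square_summable_coefficients[OF G])
  then have we: "summable (\<lambda>i. w (e i))"
    using summable_on_reindex_bij_betw[OF e, of w] summable_on_UNIV_nonneg_real_iff[of "\<lambda>i. w (e i)"] by (simp add: w_def)
  have cw: "cmod (cinner (a k) (b k)) \<le> w k" for k unfolding w_def by (rule cmod_cinner_le_squares)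
  define q where "q i n = complex_of_real (?V * (radius n ^ total_degree (e i))\<^sup>2) * cinner (a (e i)) (b (e i))" for i n
  have qL: "(\<Sum>i. q i n) = L n" for n
    using has_sum_imp_sums[OF has_sum_reindex_bij_betw[OF e, THEN iffD2, OF parseval_radius[OF F G radius(1,2)[of n]]]]
    by (simp add: q_def L_def sums_iff)
  have tann: "(\<lambda>n. \<Sum>i. q i n) \<longlonglongrightarrow> (\<Sum>i. complex_of_real ?V * cinner (a (e i)) (b (e i)))"
  proof (rule tannerys_theorem[where M = "\<lambda>i. ?V * w (e i)", THEN conjunct2, THEN conjunct2])
    show "(\<lambda>n. q i n) \<longlonglongrightarrow> complex_of_real ?V * cinner (a (e i)) (b (e i))" for i
    proof -
      have "(\<lambda>n. q i n) \<longlonglongrightarrow> complex_of_real (?V * (1 ^ total_degree (e i))\<^sup>2) * cinner (a (e i)) (b (e i))"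
        unfolding q_def by (intro tendsto_intros radius(3))
      then show ?thesis by simp
    qed
    show "\<forall>\<^sub>F (i, n) in at_top \<times>\<^sub>F sequentially. norm (q i n) \<le> ?V * w (e i)"
    proof (rule always_eventually, clarify)
      fix i n
      have "(radius n ^ total_degree (e i))\<^sup>2 \<le> 1"
        using radius(1,2)[of n] by (simp add: power_le_one)
      then have "?V * (radius n ^ total_degree (e i))\<^sup>2 * cmod (cinner (a (e i)) (b (e i))) \<le> ?V * 1 * w (e i)"
        using torus_volume_pos[where 'n = 'n] cw by (intro mult_mono) (auto simp: w_def)
      then show "norm (q i n) \<le> ?V * w (e i)"
        using torus_volume_pos[where 'n = 'n] by (simp add: q_def norm_mult norm_power abs_of_pos abs_of_nonneg[OF radius(1)])
    qed
    show "summable (\<lambda>i. ?V * w (e i))" by (intro summable_mult we)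
  qed simp
  have norm_summ: "summable (\<lambda>i. norm (cinner (a (e i)) (b (e i))))"
    by (rule summable_comparison_test'[OF we]) (simp add: cw)
  have "(\<Sum>i. complex_of_real ?V * cinner (a (e i)) (b (e i))) = ?V * (if l = m then c else 0)"
    using tann L1 unfolding qL by (rule LIMSEQ_unique)
  moreover have "(\<Sum>i. complex_of_real ?V * cinner (a (e i)) (b (e i))) = ?V * (\<Sum>i. cinner (a (e i)) (b (e i)))"
    by (rule suminf_mult[OF summable_norm_cancel[OF norm_summ]])
  ultimately have "(\<Sum>i. cinner (a (e i)) (b (e i))) = (if l = m then c else 0)"
    using torus_volume_pos[where 'n = 'n] by (simp split: if_splits)
  then have "(\<lambda>i. cinner (a (e i)) (b (e i))) sums (if l = m then c else 0)"
    using summable_sums[OF summable_norm_cancel[OF norm_summ]] by simp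
  then have "((\<lambda>i. cinner (a (e i)) (b (e i))) has_sum (if l = m then c else 0)) UNIV"
    by (rule norm_summable_imp_has_sum[OF norm_summ])
  then show ?thesis
    using has_sum_reindex_bij_betw[OF e, of "\<lambda>k. cinner (a k) (b k)"] by simp
qed

section \<open>The coefficients of an inner function\<close>

text \<open>The coefficients of z^l times the series with coefficients \<open>a\<close>.\<close>

definition shift_coeff :: "('n \<Rightarrow> nat) \<Rightarrow> (('n \<Rightarrow> nat) \<Rightarrow> 'f::zero) \<Rightarrow> ('n \<Rightarrow> nat) \<Rightarrow> 'f"
  where "shift_coeff l a k = (if \<forall>i. l i \<le> k i then a (\<lambda>i. k i - l i) else 0)"

lemma shift_coeff_add: "shift_coeff l a (\<lambda>i. k i + l i) = a k"
  by (simp add: shift_coeff_def)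

lemma shift_coeff_outside: "k \<notin> range (\<lambda>k i. k i + l i) \<Longrightarrow> shift_coeff l a k = 0"
proof -
  assume k: "k \<notin> range (\<lambda>k i. k i + l i)"
  have "\<not> (\<forall>i. l i \<le> k i)"
  proof
    assume le: "\<forall>i. l i \<le> k i"
    have "k \<in> range (\<lambda>k i. k i + l i)"
      by (rule range_eqI[where x = "\<lambda>i. k i - l i"]) (use le in \<open>simp add: fun_eq_iff\<close>)
    with k show False by simp
  qed
  then show ?thesis by (auto simp: shift_coeff_def)
qed

lemma power_series_shift:
  assumes F: "power_series_on_polydisc F a B"
  shows "power_series_on_polydisc (\<lambda>z. monomial l z *\<^sub>C F z) (shift_coeff l a) B"
  unfolding power_series_on_polydisc_def
proof (intro conjI ballI allI)
  note FD = power_series_on_polydiscD[OF F]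
  have B0: "0 \<le> B" using FD(3) norm_ge_zero order_trans by blast
  show "continuous_on polydisc (\<lambda>z. monomial l z *\<^sub>C F z)"
    unfolding monomial_def by (intro scaleC.continuous_on FD(1) continuous_intros)
  show "norm (shift_coeff l a k) \<le> B" for k
    using FD(3) B0 by (simp add: shift_coeff_def)
  fix z :: "complex ^ 'a" assume z: "z \<in> polydisc"
  have "cmod (monomial l z) \<le> 1"
    unfolding norm_monomial using z
    by (intro prod_le_1) (auto simp: polydisc_def power_le_one less_imp_le)
  then have "norm (monomial l z) * norm (F z) \<le> 1 * B"
    using FD(2)[OF z] by (intro mult_mono) auto
  then show "norm (monomial l z *\<^sub>C F z) \<le> B" by (simp add: norm_scaleC)
  let ?s = "\<lambda>k i. k i + l i"
  have inj: "inj ?s" by (auto simp: inj_on_def fun_eq_iff)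
  have "((\<lambda>k. monomial l z *\<^sub>C (monomial k z *\<^sub>C a k)) has_sum monomial l z *\<^sub>C F z) UNIV"
    by (rule has_sum_bounded_linear[OF scaleC.bounded_linear_right FD(4)[OF z]])
  then have "(((\<lambda>k. monomial k z *\<^sub>C shift_coeff l a k) \<circ> ?s) has_sum monomial l z *\<^sub>C F z) UNIV"
    by (simp add: o_def shift_coeff_add monomial_add scaleC_scaleC mult.commute)
  then have "((\<lambda>k. monomial k z *\<^sub>C shift_coeff l a k) has_sum monomial l z *\<^sub>C F z) (range ?s)"
    by (subst has_sum_reindex[OF inj])
  then show "((\<lambda>k. monomial k z *\<^sub>C shift_coeff l a k) has_sum monomial l z *\<^sub>C F z) UNIV"
    by (subst (asm) has_sum_cong_neutral[where T = UNIV and g = "\<lambda>k. monomial k z *\<^sub>C shift_coeff l a k"])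
      (auto simp: shift_coeff_outside scaleC.zero_right)
qed

lemma H_infty_power_series:
  fixes \<Theta> :: "complex ^ 'n::finite \<Rightarrow> 'e::complex_hilbert \<Rightarrow>\<^sub>L 'f::{complex_hilbert,polish_space}"
  assumes H: "H_infty \<Theta>"
  obtains M where "\<And>z. z \<in> polydisc \<Longrightarrow> norm (\<Theta> z) \<le> M"
    "\<And>e. \<exists>a. power_series_on_polydisc (\<lambda>z. blinfun_apply (\<Theta> z) e) a (M * norm e)"
proof -
  obtain M where M: "\<And>z. z \<in> polydisc \<Longrightarrow> norm (\<Theta> z) \<le> M" using H unfolding H_infty_def by blast
  have der: "\<exists>D. (\<Theta> has_derivative D) (at z) \<and> (\<forall>c v x. blinfun_apply (D (c *s v)) x = c *\<^sub>C blinfun_apply (D v) x)"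
    if "z \<in> polydisc" for z using H that by (auto simp: H_infty_def)
  have cont: "continuous_on polydisc \<Theta>"
    by (rule continuous_at_imp_continuous_on) (use der has_derivative_continuous in blast)
  have "\<exists>a. power_series_on_polydisc (\<lambda>z. blinfun_apply (\<Theta> z) e) a (M * norm e)" for e
  proof -
    obtain a where "power_series_on_polydisc (\<lambda>z. blinfun_apply (\<Theta> z) e) a (M * norm e)"
    proof (rule power_series_coefficients[of "\<lambda>z. blinfun_apply (\<Theta> z) e" "M * norm e"])
      show "continuous_on polydisc (\<lambda>z. blinfun_apply (\<Theta> z) e)"
        by (intro blinfun.continuous_on cont continuous_on_const)
      show "norm (blinfun_apply (\<Theta> z) e) \<le> M * norm e" if "z \<in> polydisc" for z
        by (rule order_trans[OF norm_blinfun]) (intro mult_right_mono M that, simp)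
      fix v and z :: "complex ^ 'n" and i assume z: "z \<in> polydisc"
      have "\<exists>c. ((\<lambda>\<zeta>. cinner (blinfun_apply (\<Theta> (upd z i \<zeta>)) e) v) has_field_derivative c) (at \<zeta>)"
        if \<zeta>: "\<zeta> \<in> ball 0 1" for \<zeta>
      proof -
        have "upd z i \<zeta> \<in> polydisc" by (rule upd_polydisc[OF z]) (use \<zeta> in simp)
        then obtain D where D: "(\<Theta> has_derivative D) (at (upd z i \<zeta>))"
          "\<And>c v x. blinfun_apply (D (c *s v)) x = c *\<^sub>C blinfun_apply (D v) x"
          using der by blast
        have "linear (\<lambda>h :: complex. h *s (axis i 1 :: complex ^ 'n))"
          by (rule linearI) (simp_all add: vec_eq_iff algebra_simps)
        then have bl: "bounded_linear (\<lambda>h :: complex. h *s (axis i 1 :: complex ^ 'n))"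
          by (simp add: linear_conv_bounded_linear)
        have "upd z i h = upd z i 0 + h *s axis i 1" for h
          by (auto simp: vec_eq_iff axis_def)
        then have "upd z i = (\<lambda>h. upd z i 0 + h *s axis i 1)" by (rule ext)
        moreover have "((\<lambda>h. upd z i 0 + h *s axis i 1) has_derivative (\<lambda>h. 0 + h *s axis i 1)) (at \<zeta>)"
          by (intro has_derivative_add has_derivative_const bounded_linear_imp_has_derivative bl)
        ultimately have "(upd z i has_derivative (\<lambda>h. h *s axis i 1)) (at \<zeta>)" by simp
        from has_derivative_compose[OF this D(1)]
        have 1: "((\<lambda>\<zeta>. \<Theta> (upd z i \<zeta>)) has_derivative (\<lambda>h. D (h *s axis i 1))) (at \<zeta>)" .
        have "bounded_linear (\<lambda>X :: 'e \<Rightarrow>\<^sub>L 'f. cinner (blinfun_apply X e) v)"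
          by (rule bounded_linear_compose[OF cinner.bounded_linear_left blinfun.bounded_linear_left])
        from bounded_linear.has_derivative[OF this 1]
        have "((\<lambda>\<zeta>. cinner (blinfun_apply (\<Theta> (upd z i \<zeta>)) e) v) has_derivative
            (\<lambda>h. cinner (blinfun_apply (D (h *s axis i 1)) e) v)) (at \<zeta>)" .
        \<comment> \<open>Complex linearity of the Frechet derivative enters here: along a
          coordinate line it becomes multiplication by one complex number.\<close>
        moreover have "(\<lambda>h. cinner (blinfun_apply (D (h *s axis i 1)) e) v) =
            (*) (cinner (blinfun_apply (D (axis i 1)) e) v)"
          by (simp add: fun_eq_iff D(2) cinner_scaleC_left mult.commute)
        ultimately show ?thesis unfolding has_field_derivative_def by auto
      qed
      then show "(\<lambda>\<zeta>. cinner (blinfun_apply (\<Theta> (upd z i \<zeta>)) e) v) holomorphic_on ball 0 1"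
        by (subst holomorphic_on_open) auto
    qed
    then show ?thesis by blast
  qed
  with M show ?thesis by (rule that)
qed

text \<open>The hypothesis on \<open>adj\<close> gives information once \<open>adj\<close> is known
  to be a true adjoint. So the pointwise limit is first shown to be linear and, by the uniform bound
  \<open>M\<close>, bounded; the Riesz theorem does the rest.\<close>

lemma boundary_isometry:
  fixes \<Theta> :: "complex ^ 'n::finite \<Rightarrow> 'e::complex_hilbert \<Rightarrow>\<^sub>L 'f::complex_hilbert"
  assumes lin: "\<And>z. z \<in> polydisc \<Longrightarrow> bounded_op UNIV UNIV (blinfun_apply (\<Theta> z))"
    and M: "\<And>z. z \<in> polydisc \<Longrightarrow> norm (\<Theta> z) \<le> M"
    and \<zeta>: "\<And>r. 0 \<le> r \<Longrightarrow> r < 1 \<Longrightarrow> r *\<^sub>R \<zeta> \<in> polydisc"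
    and lim: "\<And>x. \<exists>y. ((\<lambda>r::real. blinfun_apply (\<Theta> (r *\<^sub>R \<zeta>)) x) \<longlongrightarrow> y) (at_left 1)"
    and iso: "\<And>x. adj UNIV (boundary_value \<Theta> \<zeta>) (boundary_value \<Theta> \<zeta> x) = x"
  shows "((\<lambda>r::real. blinfun_apply (\<Theta> (r *\<^sub>R \<zeta>)) x) \<longlongrightarrow> boundary_value \<Theta> \<zeta> x) (at_left 1)"
    and "cinner (boundary_value \<Theta> \<zeta> x) (boundary_value \<Theta> \<zeta> y) = cinner x y"
proof -
  let ?b = "boundary_value \<Theta> \<zeta>"
  show b: "((\<lambda>r::real. blinfun_apply (\<Theta> (r *\<^sub>R \<zeta>)) x) \<longlongrightarrow> ?b x) (at_left 1)" for x
  proof -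
    obtain y where y: "((\<lambda>r::real. blinfun_apply (\<Theta> (r *\<^sub>R \<zeta>)) x) \<longlongrightarrow> y) (at_left 1)" using lim by blast
    moreover have "?b x = y" unfolding boundary_value_def by (rule tendsto_Lim[OF _ y]) simp
    ultimately show ?thesis by simp
  qed
  have ev: "\<forall>\<^sub>F r in at_left (1::real). r *\<^sub>R \<zeta> \<in> polydisc"
    using eventually_at_left_real[OF zero_less_one[where 'a = real]]
    by (rule eventually_mono) (auto intro: \<zeta>)
  have "bounded_op UNIV UNIV ?b"
    unfolding bounded_op_def
  proof (intro conjI ballI allI exI)
    fix x y c
    have "((\<lambda>r. blinfun_apply (\<Theta> (r *\<^sub>R \<zeta>)) (x + y)) \<longlongrightarrow> ?b x + ?b y) (at_left 1)"
      unfolding blinfun.add_right by (intro tendsto_add b)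
    then show "?b (x + y) = ?b x + ?b y" using tendsto_unique[OF _ b] by force
    have "((\<lambda>r. c *\<^sub>C blinfun_apply (\<Theta> (r *\<^sub>R \<zeta>)) x) \<longlongrightarrow> c *\<^sub>C ?b x) (at_left 1)"
      by (intro scaleC.tendsto tendsto_const b)
    then have "((\<lambda>r. blinfun_apply (\<Theta> (r *\<^sub>R \<zeta>)) (c *\<^sub>C x)) \<longlongrightarrow> c *\<^sub>C ?b x) (at_left 1)"
      by (rule Lim_transform_eventually)
        (use ev in \<open>eventually_elim, simp add: bounded_opD(3)[OF lin]\<close>)
    then show "?b (c *\<^sub>C x) = c *\<^sub>C ?b x" using tendsto_unique[OF _ b] by force
    show "norm (?b x) \<le> M * norm x"
    proof (rule tendsto_upperbound[OF tendsto_norm[OF b]])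
      show "\<forall>\<^sub>F r in at_left 1. norm (blinfun_apply (\<Theta> (r *\<^sub>R \<zeta>)) x) \<le> M * norm x"
        using ev
      proof eventually_elim
        case (elim r)
        show ?case by (rule order_trans[OF norm_blinfun]) (intro mult_right_mono M elim, simp)
      qed
    qed simp
  qed auto
  from adj_existing[OF this, of x "?b y"] show "cinner (?b x) (?b y) = cinner x y"
    by (simp add: iso)
qed

text \<open>The second conclusion is the isometry of multiplication by \<Theta>, tested on the
  functions z^l e. On the torus \<Theta> preserves inner products, so the boundary integrand is a
  product of monomials times <e, e'>, to which Parseval at the boundary applies.\<close>

theorem inner_function_coefficients:
  fixes \<Theta> :: "complex ^ 'n::finite \<Rightarrow> 'e::complex_hilbert \<Rightarrow>\<^sub>L 'f::{complex_hilbert,polish_space}"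
  assumes \<Theta>: "inner_function \<Theta>"
  obtains c :: "'e \<Rightarrow> ('n \<Rightarrow> nat) \<Rightarrow> 'f" where
    "\<And>e z. z \<in> polydisc \<Longrightarrow> ((\<lambda>k. monomial k z *\<^sub>C c e k) has_sum blinfun_apply (\<Theta> z) e) UNIV"
    "\<And>e e' l m. ((\<lambda>k. cinner (shift_coeff l (c e) k) (shift_coeff m (c e') k)) has_sum
      (if l = m then cinner e e' else 0)) UNIV"
proof -
  have H: "H_infty \<Theta>" using \<Theta> by (simp add: inner_function_def)
  obtain M where M: "\<And>z. z \<in> polydisc \<Longrightarrow> norm (\<Theta> z) \<le> M"
    "\<And>e. \<exists>a. power_series_on_polydisc (\<lambda>z. blinfun_apply (\<Theta> z) e) a (M * norm e)"
    by (rule H_infty_power_series[OF H]) blast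
  from M(2) obtain c where c: "\<And>e. power_series_on_polydisc (\<lambda>z. blinfun_apply (\<Theta> z) e) (c e) (M * norm e)"
    by metis
  let ?P = "\<lambda>\<zeta>. (\<forall>x. \<exists>y. ((\<lambda>r::real. blinfun_apply (\<Theta> (r *\<^sub>R \<zeta>)) x) \<longlongrightarrow> y) (at_left 1)) \<and>
      (\<forall>x. adj UNIV (boundary_value \<Theta> \<zeta>) (boundary_value \<Theta> \<zeta> x) = x)"
  have tm: "torus_measure = distr (angle_measure :: (real ^ 'n) measure) borel torus_point"
    by (simp add: torus_measure_def angle_measure_def angle_box_def torus_point_def[abs_def])
  have "AE \<zeta> in distr (angle_measure :: (real ^ 'n) measure) borel torus_point. ?P \<zeta>"
    using \<Theta> unfolding inner_function_def tm by blast
  from AE_distrD[OF measurable_angle_measure[OF continuous_torus_point] this]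
  have ae: "AE t in (angle_measure :: (real ^ 'n) measure). ?P (torus_point t)" .
  show ?thesis
  proof (rule that[of c])
    show "((\<lambda>k. monomial k z *\<^sub>C c e k) has_sum blinfun_apply (\<Theta> z) e) UNIV" if "z \<in> polydisc" for z e
      by (rule power_series_on_polydiscD(4)[OF c that])
    fix e e' l m
    show "((\<lambda>k. cinner (shift_coeff l (c e) k) (shift_coeff m (c e') k)) has_sum
      (if l = m then cinner e e' else 0)) UNIV"
    proof (rule parseval_boundary[OF power_series_shift[OF c] power_series_shift[OF c]])
      show "AE t in angle_measure. \<exists>y y'.
        ((\<lambda>r::real. monomial l (radial_point r t) *\<^sub>C blinfun_apply (\<Theta> (radial_point r t)) e) \<longlongrightarrow> y) (at_left 1) \<and>
        ((\<lambda>r::real. monomial m (radial_point r t) *\<^sub>C blinfun_apply (\<Theta> (radial_point r t)) e') \<longlongrightarrow> y') (at_left 1) \<and>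
        cinner y y' = monomial l (torus_point t) * cnj (monomial m (torus_point t)) * cinner e e'"
        using ae
      proof eventually_elim
        case (elim t)
        let ?b = "boundary_value \<Theta> (torus_point t)"
        have lin: "bounded_op UNIV UNIV (blinfun_apply (\<Theta> z))" if "z \<in> polydisc" for z
          using H that by (simp add: H_infty_def)
        have b: "((\<lambda>r. blinfun_apply (\<Theta> (radial_point r t)) x) \<longlongrightarrow> ?b x) (at_left 1)"
          "cinner (?b x) (?b y) = cinner x y" for x y
          using elim by (intro boundary_isometry[of \<Theta> M "torus_point t"] lin M radial_point_polydisc; simp)+
        have mono: "((\<lambda>r. monomial k (radial_point r t)) \<longlongrightarrow> monomial k (torus_point t)) (at_left 1)" for k
        proof -
          have "((\<lambda>r. of_real (r ^ total_degree k) * monomial k (torus_point t)) \<longlongrightarrow>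
              of_real (1 ^ total_degree k) * monomial k (torus_point t)) (at_left 1)"
            by (intro tendsto_intros)
          then show ?thesis by (simp add: monomial_scaleR)
        qed
        show ?case
          by (intro exI[of _ "monomial l (torus_point t) *\<^sub>C ?b e"] exI[of _ "monomial m (torus_point t) *\<^sub>C ?b e'"]
              conjI scaleC.tendsto mono b)
            (simp add: cinner_scaleC_left cinner_scaleC_right b mult_ac)
      qed
    qed
  qed
qed


section \<open>Hardy space coordinates on the sequence space\<close>

text \<open>The coordinate with number \<open>index_code (k, i)\<close> holds the \<open>i\<close>-th coordinate of the coefficient of \<open>z\<^sup>k\<close>.\<close>

definition index_code :: "('n::finite \<Rightarrow> nat) \<times> nat \<Rightarrow> nat" where "index_code = to_nat_on UNIV"
definition index_decode :: "nat \<Rightarrow> ('n::finite \<Rightarrow> nat) \<times> nat" where "index_decode = inv index_code"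

lemma bij_index_code: "bij (index_code :: ('n::finite \<Rightarrow> nat) \<times> nat \<Rightarrow> nat)"
  unfolding index_code_def
proof (rule to_nat_on_infinite)
  show "infinite (UNIV :: (('n \<Rightarrow> nat) \<times> nat) set)"
    by (simp add: finite_prod)
qed simp

lemma index_decode_code [simp]: "index_decode (index_code p) = p"
  unfolding index_decode_def by (rule inv_f_f) (rule bij_is_inj[OF bij_index_code])

lemma index_code_decode [simp]: "index_code (index_decode q) = q"
  unfolding index_decode_def by (rule surj_f_inv_f) (rule bij_is_surj[OF bij_index_code])

lemma index_code_eq_iff [simp]: "index_code p = index_code q \<longleftrightarrow> p = q"
  by (metis index_decode_code)

text \<open>Multiplication by the \<open>j\<close>-th variable in coordinates: the exponent is
  raised and the position in the coefficient vector is kept.\<close>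

definition step :: "'n::finite \<Rightarrow> nat \<Rightarrow> nat"
  where "step j p = (case index_decode p of (k, i) \<Rightarrow> index_code (k(j := Suc (k j)), i))"

lemma step_code [simp]: "step j (index_code (k, i)) = index_code (k(j := Suc (k j)), i)"
  by (simp add: step_def)

lemma index_code_cases: obtains k i where "p = index_code (k :: 'n::finite \<Rightarrow> nat, i)"
  by (metis index_code_decode surj_pair)

lemma fun_upd_Suc_eq_iff: "k(j := Suc (k j)) = l(j := Suc (l j)) \<longleftrightarrow> k = l"
  by (metis fun_upd_apply fun_upd_idem_iff fun_upd_upd nat.inject)

lemma inj_step: "inj (step (j :: 'n::finite))"
proof (rule injI)
  fix p q assume eq: "step j p = step j q"
  obtain k i where p: "p = index_code (k :: 'n \<Rightarrow> nat, i)" by (rule index_code_cases)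
  obtain l i' where q: "q = index_code (l :: 'n \<Rightarrow> nat, i')" by (rule index_code_cases)
  show "p = q" using eq by (simp add: p q fun_upd_Suc_eq_iff)
qed

lemma step_commute: "step (i :: 'n::finite) (step (j :: 'n) p) = step j (step i p)"
proof -
  obtain k m where p: "p = index_code (k :: 'n \<Rightarrow> nat, m)" by (rule index_code_cases)
  show ?thesis by (cases "i = j") (simp_all add: p fun_upd_twist)
qed

lemma range_step:
  fixes k :: "'n::finite \<Rightarrow> nat"
  shows "index_code (k, i) \<in> range (step j) \<longleftrightarrow> k j \<noteq> 0"
proof
  assume "index_code (k, i) \<in> range (step j)"
  then obtain p where p: "index_code (k, i) = step j p" by blast
  obtain l m where "p = index_code (l :: 'n \<Rightarrow> nat, m)" by (rule index_code_cases)
  with p show "k j \<noteq> 0" by simp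
next
  assume "k j \<noteq> 0"
  then have "index_code (k, i) = step j (index_code (k(j := k j - 1), i))" by simp
  then show "index_code (k, i) \<in> range (step j)" by (rule range_eqI)
qed

lemma step_power: "(step j ^^ m) (index_code (k, i)) = index_code (k(j := k j + m), i)"
  by (induction m) (simp_all add: fun_eq_iff)

text \<open>Every index in the range of the \<open>m\<close>-th power has \<open>j\<close>-th
  exponent at least \<open>m\<close>.\<close>

lemma step_leaves: "\<exists>m0. \<forall>m\<ge>m0. p \<notin> range (step (j :: 'n::finite) ^^ m)"
proof -
  obtain k i where p: "p = index_code (k :: 'n \<Rightarrow> nat, i)" by (rule index_code_cases)
  have "p \<notin> range (step j ^^ m)" if "m \<ge> Suc (k j)" for m
  proof
    assume "p \<in> range (step j ^^ m)"
    then obtain q where q: "p = (step j ^^ m) q" by blast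
    obtain l i' where "q = index_code (l :: 'n \<Rightarrow> nat, i')" by (rule index_code_cases)
    with q p have "k = l(j := l j + m)" by (simp add: step_power)
    then have "k j = l j + m" by (metis fun_upd_same)
    with that show False by simp
  qed
  then show ?thesis by blast
qed

definition const_index :: "'n::finite itself \<Rightarrow> nat \<Rightarrow> nat"
  where "const_index _ i = index_code (\<lambda>_ :: 'n. 0, i)"

lemma inj_const_index: "inj (const_index TYPE('n::finite))"
  by (rule injI) (simp add: const_index_def)

lemma range_const_index: "index_code (k :: 'n::finite \<Rightarrow> nat, i) \<in> range (const_index TYPE('n)) \<longleftrightarrow> k = (\<lambda>_. 0)"
  by (auto simp: const_index_def)

lemma const_index_not_step: "p \<in> range (const_index TYPE('n::finite)) \<longleftrightarrow> (\<forall>j :: 'n. p \<notin> range (step j))"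
proof -
  obtain k i where p: "p = index_code (k :: 'n \<Rightarrow> nat, i)" by (rule index_code_cases)
  show ?thesis by (auto simp: p range_step range_const_index fun_eq_iff)
qed

text \<open>With \<open>I\<close> the set of indices of nonzero basis vectors, these coordinates
  describe the Hardy space of the coefficient space inside \<open>ell2\<close>.\<close>

definition value_index :: "'n::finite itself \<Rightarrow> nat set \<Rightarrow> nat set"
  where "value_index _ I = {p. snd (index_decode p :: ('n \<Rightarrow> nat) \<times> nat) \<in> I}"

lemma value_index_code: "index_code (k :: 'n::finite \<Rightarrow> nat, i) \<in> value_index TYPE('n) I \<longleftrightarrow> i \<in> I"
  by (simp add: value_index_def)

lemma step_value_index: "step (j :: 'n::finite) p \<in> value_index TYPE('n) I \<longleftrightarrow> p \<in> value_index TYPE('n) I"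
proof -
  obtain k i where p: "p = index_code (k :: 'n \<Rightarrow> nat, i)" by (rule index_code_cases)
  show ?thesis by (simp add: p value_index_code)
qed

lemma const_value_index: "const_index TYPE('n::finite) i \<in> value_index TYPE('n) I \<longleftrightarrow> i \<in> I"
  by (simp add: const_index_def value_index_code)

lemma coord_proj_coord_proj: "coord_proj I (coord_proj J x) = coord_proj (I \<inter> J) x"
  by (rule ell2_eqI) (simp add: coord_proj_nth)

lemma shift_coeff_step: "shift_coeff (l(j := Suc (l j))) a (k(j := Suc (k j))) = shift_coeff l a k"
proof -
  have "(\<forall>i. (l(j := Suc (l j))) i \<le> (k(j := Suc (k j))) i) \<longleftrightarrow> (\<forall>i. l i \<le> k i)"
    by (metis Suc_le_mono fun_upd_apply)
  moreover have "(\<lambda>i. (k(j := Suc (k j))) i - (l(j := Suc (l j))) i) = (\<lambda>i. k i - l i)"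
    by auto
  ultimately show ?thesis by (simp only: shift_coeff_def)
qed

lemma shift_coeff_step_0: "k j = 0 \<Longrightarrow> shift_coeff (l(j := Suc (l j))) a k = 0"
  unfolding shift_coeff_def by (metis fun_upd_same le_zero_eq nat.distinct(1))

lemma shift_coeff_0: "shift_coeff (\<lambda>_. 0) a = a"
  by (rule ext) (simp add: shift_coeff_def)

section \<open>Elements of the sequence space given by coefficient families\<close>

lemma coordinates_cinner:
  assumes "adjoint_pair A A'" "\<And>x. A' (A x) = x"
  shows "cinner (A x) (A y) = cinner x y"
  using assms by (simp add: adjoint_pairD)

definition coeff_vector :: "(nat \<Rightarrow> 'f) \<Rightarrow> (('n::finite \<Rightarrow> nat) \<Rightarrow> 'f::complex_hilbert) \<Rightarrow> ell2"
  where "coeff_vector b h = Abs_ell2 (\<lambda>q. case index_decode q of (k, i) \<Rightarrow> cinner (h k) (b i))"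

context
  fixes A :: "'f::complex_hilbert \<Rightarrow> ell2" and A' b
  assumes A: "adjoint_pair A A'" "\<And>x p. ell2_nth (A x) p = cinner x (b p)" "\<And>x. A' (A x) = x"
begin

lemma coeff_vector_nth:
  fixes h :: "('n::finite \<Rightarrow> nat) \<Rightarrow> 'f"
  assumes h: "(\<lambda>k. (norm (h k))\<^sup>2) summable_on UNIV"
  shows "ell2_nth (coeff_vector b h) (index_code (k, i)) = cinner (h k) (b i)"
proof -
  let ?g = "\<lambda>(k, i). (cmod (cinner (h k) (b i)))\<^sup>2"
  have "?g summable_on Sigma UNIV (\<lambda>_. UNIV)"
  proof (rule summable_on_SigmaI[where g = "\<lambda>k. (norm (h k))\<^sup>2"])
    fix k
    have "norm (A (h k)) = norm (h k)" by (rule norm_eqI_cinner) (rule coordinates_cinner[OF A(1,3)])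
    then show "((\<lambda>i. ?g (k, i)) has_sum (norm (h k))\<^sup>2) UNIV"
      using has_sum_norm_ell2[of "A (h k)"] by (simp add: A(2))
  qed (use h in auto)
  then have "?g summable_on UNIV" by simp
  then have "(\<lambda>q. ?g (index_decode q)) summable_on UNIV"
    by (subst summable_on_reindex_bij_betw[of index_decode UNIV UNIV ?g])
      (auto intro!: bij_betwI[where g = index_code])
  then have "ell2_nth (coeff_vector b h) =
      (\<lambda>q. case index_decode q of (k, i) \<Rightarrow> cinner (h k) (b i))"
    unfolding coeff_vector_def by (intro ell2_nth_Abs_on) (simp add: case_prod_unfold)
  then show ?thesis by simp
qed

lemma coeff_vector_cinner:
  fixes h g :: "('n::finite \<Rightarrow> nat) \<Rightarrow> 'f"
  assumes h: "(\<lambda>k. (norm (h k))\<^sup>2) summable_on UNIV" and g: "(\<lambda>k. (norm (g k))\<^sup>2) summable_on UNIV"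
  shows "((\<lambda>k. cinner (h k) (g k)) has_sum cinner (coeff_vector b h) (coeff_vector b g)) UNIV"
proof -
  let ?f = "\<lambda>q. ell2_nth (coeff_vector b h) q * cnj (ell2_nth (coeff_vector b g) q)"
  have "(?f has_sum cinner (coeff_vector b h) (coeff_vector b g)) UNIV" by (rule has_sum_cinner_ell2)
  then have tot: "((\<lambda>p :: ('n \<Rightarrow> nat) \<times> nat. ?f (index_code p)) has_sum cinner (coeff_vector b h) (coeff_vector b g))
      (Sigma UNIV (\<lambda>_. UNIV))"
    using has_sum_reindex_bij_betw[OF bij_index_code[where 'n = 'n], of ?f] by simp
  show ?thesis
  proof (rule has_sum_SigmaD[OF tot])
    fix k :: "'n \<Rightarrow> nat"
    show "((\<lambda>i. ?f (index_code (k, i))) has_sum cinner (h k) (g k)) UNIV"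
      using has_sum_cinner_ell2[of "A (h k)" "A (g k)"]
      by (simp add: coeff_vector_nth h g A(2) coordinates_cinner[OF A(1,3)])
  qed
qed

end

text \<open>Evaluation at \<open>z\<close> of the \<open>i\<close>-th coordinate function of an element of the Hardy space.\<close>

definition eval_coordinate :: "complex ^ 'n::finite \<Rightarrow> nat \<Rightarrow> ell2 \<Rightarrow> complex"
  where "eval_coordinate z i x = (\<Sum>\<^sub>\<infinity>k. monomial k z * ell2_nth x (index_code (k, i)))"

context
  fixes z :: "complex ^ 'n::finite" and i :: nat
  assumes z: "z \<in> polydisc"
begin

lemma eval_coordinate_has_sum:
  "((\<lambda>k. monomial k z * ell2_nth x (index_code (k, i))) has_sum eval_coordinate z i x) UNIV"
proof -
  have "(\<lambda>k. norm (monomial k z * ell2_nth x (index_code (k, i)))) summable_on UNIV"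
  proof (rule Infinite_Sum.abs_summable_on_comparison_test)
    show "(\<lambda>k. norm (monomial k z * of_real (norm x))) summable_on UNIV"
      unfolding norm_mult by (intro summable_on_cmult_left norm_monomial_summable z)
    show "norm (monomial k z * ell2_nth x (index_code (k, i))) \<le> norm (monomial k z * of_real (norm x))" for k
      using norm_ell2_nth_le[of x "index_code (k, i)"] by (simp add: norm_mult mult_left_mono)
  qed
  then show ?thesis unfolding eval_coordinate_def by (rule has_sum_infsum[OF abs_summable_summable])
qed

lemma eval_coordinate_eqI:
  "((\<lambda>k. monomial k z * ell2_nth x (index_code (k, i))) has_sum s) UNIV \<Longrightarrow> eval_coordinate z i x = s"
  using eval_coordinate_has_sum[of x] by (metis infsumI)

lemma eval_coordinate_diff: "eval_coordinate z i (x - y) = eval_coordinate z i x - eval_coordinate z i y"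
  using has_sum_add[OF eval_coordinate_has_sum[of x] has_sum_cmult_right[OF eval_coordinate_has_sum[of y], of "-1"]]
  by (intro eval_coordinate_eqI) (simp add: minus_ell2.rep_eq right_diff_distrib)

lemma eval_coordinate_scaleC: "eval_coordinate z i (c *\<^sub>C x) = c * eval_coordinate z i x"
  using has_sum_cmult_right[OF eval_coordinate_has_sum[of x], of c]
  by (intro eval_coordinate_eqI) (simp add: scaleC_ell2.rep_eq mult.left_commute)

lemma eval_coordinate_push: "eval_coordinate z i (push (step j) x) = z $ j * eval_coordinate z i x"
proof (rule eval_coordinate_eqI)
  let ?s = "\<lambda>k :: 'n \<Rightarrow> nat. k(j := Suc (k j))"
  let ?f = "\<lambda>k. monomial k z * ell2_nth (push (step j) x) (index_code (k, i))"
  have inj: "inj ?s" by (rule injI) (simp add: fun_upd_Suc_eq_iff)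
  have mono: "monomial (?s k) z = z $ j * monomial k z" for k
  proof -
    have "?s k = (\<lambda>i. k i + (if i = j then 1 else 0))" by auto
    moreover have "monomial (\<lambda>i. if i = j then 1 else 0) z = z $ j"
      by (simp add: monomial_def if_distrib[of "\<lambda>n. _ ^ n"] prod.delta cong: if_cong)
    ultimately show ?thesis using monomial_add[of k "\<lambda>i. if i = j then 1 else 0" z] by simp
  qed
  have nth: "ell2_nth (push (step j) x) (index_code (?s k, i)) = ell2_nth x (index_code (k, i))" for k
    using push_nth_image[OF inj_step, of j x "index_code (k, i)"] by simp
  have "((\<lambda>k. z $ j * (monomial k z * ell2_nth x (index_code (k, i)))) has_sum z $ j * eval_coordinate z i x) UNIV"
    by (rule has_sum_cmult_right[OF eval_coordinate_has_sum])
  then have "((?f \<circ> ?s) has_sum z $ j * eval_coordinate z i x) UNIV"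
    unfolding o_def mono nth by (simp add: mult.assoc)
  then have 1: "(?f has_sum z $ j * eval_coordinate z i x) (range ?s)"
    by (subst has_sum_reindex[OF inj])
  have out: "?f k = 0" if "k \<notin> range ?s" for k
  proof -
    have "k j = 0"
    proof (rule ccontr)
      assume "k j \<noteq> 0"
      then have "k \<in> range ?s" by (intro range_eqI[where x = "k(j := k j - 1)"]) simp
      with that show False by simp
    qed
    then show ?thesis by (simp add: push_nth[OF inj_step] range_step)
  qed
  from 1 show "(?f has_sum z $ j * eval_coordinate z i x) UNIV"
    by (subst has_sum_cong_neutral[where T = "range ?s" and g = ?f]) (use out in auto)
qed

lemma eval_coordinate_const: "eval_coordinate z i (coord_proj (range (const_index TYPE('n))) x) = ell2_nth x (const_index TYPE('n) i)"
proof (rule eval_coordinate_eqI, rule has_sum_finite_neutralI[of "{\<lambda>_. 0}"])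
  show "monomial k z * ell2_nth (coord_proj (range (const_index TYPE('n))) x) (index_code (k, i)) = 0"
    if "k \<in> UNIV - {\<lambda>_. 0}" for k
    using that by (simp add: coord_proj_nth range_const_index)
  show "ell2_nth x (const_index TYPE('n) i) =
      (\<Sum>k\<in>{\<lambda>_. 0}. monomial k z * ell2_nth (coord_proj (range (const_index TYPE('n))) x) (index_code (k, i)))"
    by (simp add: coord_proj_nth range_const_index const_index_def monomial_def)
qed auto

end

section \<open>The model of a given inner function on the sequence space\<close>

theorem mainTheorem7:
  fixes \<Theta> :: "complex ^ ('n::{finite,linorder}) \<Rightarrow>
      ('e::{complex_hilbert,polish_space}) \<Rightarrow>\<^sub>L ('f::{complex_hilbert,polish_space})"
  assumes "inner_function \<Theta>"
  shows "\<exists>(H :: ell2 set) (T :: 'n \<Rightarrow> ell2 \<Rightarrow> ell2) (F :: ell2 set)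
      (\<sigma> :: 'e \<Rightarrow> (ell2, 'n) vec \<times> ell2) (\<sigma>s :: 'f \<Rightarrow> ell2 \<times> ell2).
    hilbert_carrier H \<and> beurling_tuple H T \<and> hilbert_carrier F \<and>
    unitary_op UNIV (big_defect_space H T \<times> F) \<sigma> \<and>
    unitary_op UNIV (defect_star_space H T \<times> F) \<sigma>s \<and>
    (\<forall>z\<in>polydisc. \<forall>x.
      blinfun_apply (\<Theta> z) x = adj UNIV \<sigma>s (map_prod (char_fun H T z) id (\<sigma> x)))"
proof -
  obtain be :: "nat \<Rightarrow> 'e" and Ie and Ae :: "'e \<Rightarrow> ell2" and Ae' where
    be: "\<And>p q. cinner (be p) (be q) = (if p = q \<and> p \<in> Ie then 1 else 0)" and
    Ae: "adjoint_pair Ae Ae'" "\<And>x p. ell2_nth (Ae x) p = cinner x (be p)"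
      "\<And>c. Ae (Ae' c) = coord_proj Ie c" "\<And>x. Ae' (Ae x) = x"
    by (rule orthonormal_coordinates[where 'a = 'e]) blast
  obtain bf :: "nat \<Rightarrow> 'f" and If and Af :: "'f \<Rightarrow> ell2" and Af' where
    bf: "\<And>p q. cinner (bf p) (bf q) = (if p = q \<and> p \<in> If then 1 else 0)" and
    Af: "adjoint_pair Af Af'" "\<And>x p. ell2_nth (Af x) p = cinner x (bf p)"
      "\<And>c. Af (Af' c) = coord_proj If c" "\<And>x. Af' (Af x) = x"
    by (rule orthonormal_coordinates[where 'a = 'f]) blast
  have be0: "be p = 0" if "p \<notin> Ie" for p using be[of p p] that by (simp add: cinner_eq_0_norm)
  have bf0: "bf p = 0" if "p \<notin> If" for p using bf[of p p] that by (simp add: cinner_eq_0_norm)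
  obtain c :: "'e \<Rightarrow> ('n \<Rightarrow> nat) \<Rightarrow> 'f" where
    c1: "\<And>e z. z \<in> polydisc \<Longrightarrow> ((\<lambda>k. monomial k z *\<^sub>C c e k) has_sum blinfun_apply (\<Theta> z) e) UNIV" and
    c3: "\<And>e e' l m. ((\<lambda>k. cinner (shift_coeff l (c e) k) (shift_coeff m (c e') k)) has_sum
      (if l = m then cinner e e' else 0)) UNIV"
    by (rule inner_function_coefficients[OF assms]) blast
  have sq: "(\<lambda>k. (norm (shift_coeff l (c e) k))\<^sup>2) summable_on UNIV" for l e
    using has_sum_bounded_linear[OF bounded_linear_Re c3[of l e l e]]
    by (simp add: Re_cinner_self has_sum_imp_summable)
  note V_nth = coeff_vector_nth[OF Af(1,2,4)] and V_cinner = coeff_vector_cinner[OF Af(1,2,4)]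
  define V where "V l e = coeff_vector bf (shift_coeff l (c e))" for l e
  have V_nth: "ell2_nth (V l e) (index_code (k, i)) = cinner (shift_coeff l (c e) k) (bf i)" for l e k i
    unfolding V_def by (rule V_nth[OF sq])
  have V_cinner: "cinner (V l e) (V m e') = (if l = m then cinner e e' else 0)" for l m e e'
    unfolding V_def by (rule has_sum_unique[OF V_cinner[OF sq sq] c3])
  \<comment> \<open>\<open>V l e\<close> holds the coordinates of z^l \<Theta> e. So
    \<open>u\<close> is the image of the standard basis under multiplication by \<Theta>, with zeros
    at the indices outside \<open>?I1\<close>.\<close>
  define u where "u p = (case index_decode p of (l, j) \<Rightarrow> V l (be j))" for p
  have u_code: "u (index_code (l, j)) = V l (be j)" for l j by (simp add: u_def)
  let ?I1 = "value_index TYPE('n) Ie" and ?I2 = "value_index TYPE('n) If"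
  have u_on: "cinner (u p) (u q) = (if p = q \<and> p \<in> ?I1 then 1 else 0)" for p q
  proof -
    obtain k i where p: "p = index_code (k :: 'n \<Rightarrow> nat, i)" by (rule index_code_cases)
    obtain l j where q: "q = index_code (l :: 'n \<Rightarrow> nat, j)" by (rule index_code_cases)
    show ?thesis by (auto simp: p q u_code V_cinner be value_index_code)
  qed
  \<comment> \<open>The synthesis operator of this family is the multiplication, so it is the
    analysis operator that plays the role of \<open>M'\<close>.\<close>
  obtain M' M where M: "adjoint_pair M' M" "\<And>x p. ell2_nth (M' x) p = cinner x (u p)"
    "\<And>x. M' (M x) = coord_proj ?I1 x"
    by (rule orthonormal_family[OF u_on]) blast
  \<comment> \<open>Shifting a member of the family gives another member, which is why
    multiplication by \<Theta> commutes with the shifts.\<close>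
  have push_u: "push (step j) (u p) = u (step j p)" for j :: 'n and p
  proof (rule ell2_eqI)
    fix q
    obtain l m where p: "p = index_code (l :: 'n \<Rightarrow> nat, m)" by (rule index_code_cases)
    obtain k i where q: "q = index_code (k :: 'n \<Rightarrow> nat, i)" by (rule index_code_cases)
    show "ell2_nth (push (step j) (u p)) q = ell2_nth (u (step j p)) q"
    proof (cases "k j = 0")
      case True
      then show ?thesis
        by (simp add: p q push_nth[OF inj_step] range_step u_code V_nth shift_coeff_step_0 cinner.zero_left)
    next
      case False
      define k' where "k' = k(j := k j - 1)"
      have k: "k = k'(j := Suc (k' j))" using False by (simp add: k'_def fun_eq_iff)
      have "ell2_nth (push (step j) (u p)) (step j (index_code (k', i))) = ell2_nth (u p) (index_code (k', i))"
        by (rule push_nth_image[OF inj_step])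
      then show ?thesis by (subst (1 2) q, subst (1 2) k) (simp add: p u_code V_nth shift_coeff_step)
    qed
  qed
  have coord_proj_u: "coord_proj ?I2 (u p) = u p" for p
  proof (rule ell2_eqI)
    fix q
    obtain l m where p: "p = index_code (l :: 'n \<Rightarrow> nat, m)" by (rule index_code_cases)
    obtain k i where q: "q = index_code (k :: 'n \<Rightarrow> nat, i)" by (rule index_code_cases)
    show "ell2_nth (coord_proj ?I2 (u p)) q = ell2_nth (u p) q"
      by (auto simp: coord_proj_nth p q value_index_code u_code V_nth bf0 cinner.zero_right)
  qed
  have M'_pull: "M' (pull (step j) x) = pull (step j) (M' x)" for j :: 'n and x
    by (rule ell2_eqI)
      (simp add: M(2) pull_nth[OF inj_step] push_u[symmetric] adjoint_pairD[OF adjoint_pair_sym[OF push_adj[OF inj_step]]])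
  have M'_coord_proj: "M' (coord_proj ?I2 x) = M' x" for x
    by (rule ell2_eqI) (simp add: M(2) adjoint_pairD[OF coord_proj_adj] coord_proj_u)
  note Mp = adjoint_pair_sym[OF M(1)]
  interpret beurling_model "\<lambda>j :: 'n. push (step j)" "\<lambda>j. pull (step j)" "coord_proj ?I2" "coord_proj ?I1" M M'
  proof
    fix i j :: 'n and x :: ell2
    show "adjoint_pair (push (step i)) (pull (step i))" by (rule push_adj[OF inj_step])
    show "pull (step i) (push (step i) x) = x" by (rule pull_push[OF inj_step])
    show "push (step i) (push (step j) x) = push (step j) (push (step i) x)"
      by (rule push_commute) (rule inj_step step_commute)+
    show "pull (step i) (push (step j) x) = push (step j) (pull (step i) x)" if "i \<noteq> j"
    proof (rule pull_push_commute)
      show "inj (step i)" "inj (step j)" by (rule inj_step)+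
      show "step j (step i p) = step i (step j p)" for p by (rule step_commute)
      fix p assume "step i p \<in> range (step j)"
      moreover obtain k m where "p = index_code (k :: 'n \<Rightarrow> nat, m)" by (rule index_code_cases)
      ultimately show "p \<in> range (step j)" using that by (simp add: range_step)
    qed
    show "(\<lambda>m. (pull (step i) ^^ m) x) \<longlonglongrightarrow> 0"
      by (rule pull_power_tendsto_0[OF inj_step step_leaves])
    show "adjoint_pair M M'" by (rule Mp)
    show "M (push (step i) x) = push (step i) (M x)"
      by (rule adjoint_pair_eqI[OF adjoint_pair_comp[OF Mp push_adj[OF inj_step]]
            adjoint_pair_comp[OF push_adj[OF inj_step] Mp]]) (simp add: M'_pull)
    show "M' (M x) = coord_proj ?I1 x" by (rule M(3))
    show "coord_proj ?I1 (coord_proj ?I1 x) = coord_proj ?I1 x" "coord_proj ?I2 (coord_proj ?I2 x) = coord_proj ?I2 x" by (simp_all add: coord_proj_coord_proj)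
    show "coord_proj ?I1 (push (step i) x) = push (step i) (coord_proj ?I1 x)"
      "coord_proj ?I2 (push (step i) x) = push (step i) (coord_proj ?I2 x)"
      by (rule push_coord_proj[OF inj_step step_value_index])+
    show "adjoint_pair (coord_proj ?I2) (coord_proj ?I2)" by (rule coord_proj_adj)
    show "coord_proj ?I2 (M x) = M x"
      by (rule adjoint_pair_eqI[OF adjoint_pair_comp[OF coord_proj_adj Mp] Mp]) (rule M'_coord_proj)
  qed
  let ?K = "range (const_index TYPE('n))"
  have N_coord_proj: "N j x = coord_proj (- range (step j)) x" for j x
    by (rule ell2_eqI) (simp add: N_def push_pull[OF inj_step] minus_ell2.rep_eq coord_proj_nth)
  have list_N: "list_comp xs N x = coord_proj (\<Inter>j\<in>set xs. - range (step j)) x" for xs x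
  proof (induction xs)
    case Nil
    show ?case by (rule ell2_eqI) (simp add: coord_proj_nth)
  qed (simp add: N_coord_proj coord_proj_coord_proj)
  have E0_coord_proj: "E0 x = coord_proj ?K x" for x
  proof -
    have "(\<Inter>j\<in>UNIV :: 'n set. - range (step j)) = ?K"
      by (rule set_eqI) (simp only: const_index_not_step INT_iff UNIV_I Compl_iff ball_simps simp_thms Ball_def)
    then show ?thesis by (simp add: E0_list list_N)
  qed
  let ?c = "const_index TYPE('n)"
  note ci = inj_const_index[where 'n = 'n]
  have const_nth: "ell2_nth (push ?c y) (?c i) = ell2_nth y i" for y i by (rule push_nth_image[OF ci])
  have push_c: "coord_proj ?K (push ?c y) = push ?c y" for y
    by (rule ell2_eqI) (simp add: coord_proj_nth push_nth[OF ci])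
  have Je: "push ?c (Ae e) \<in> W1" "Ae' (pull ?c (push ?c (Ae e))) = e"
    "x \<in> W1 \<Longrightarrow> push ?c (Ae (Ae' (pull ?c x))) = x" for e x
  proof -
    have "coord_proj Ie (Ae e) = Ae e"
      by (rule ell2_eqI) (simp add: coord_proj_nth Ae(2) be0 cinner.zero_right)
    then show "push ?c (Ae e) \<in> W1"
      by (simp add: W1_def E0_coord_proj push_c push_coord_proj[OF ci const_value_index])
    show "Ae' (pull ?c (push ?c (Ae e))) = e" by (simp add: pull_push[OF ci] Ae(4))
    show "push ?c (Ae (Ae' (pull ?c x))) = x" if "x \<in> W1"
      using that by (simp add: Ae(3) W1_def E0_coord_proj push_coord_proj[OF ci const_value_index, symmetric] push_pull[OF ci])
  qed
  have Jf: "push ?c (Af e) \<in> W" "Af' (pull ?c (push ?c (Af e))) = e"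
    "x \<in> W \<Longrightarrow> push ?c (Af (Af' (pull ?c x))) = x" for e x
  proof -
    have "coord_proj If (Af e) = Af e"
      by (rule ell2_eqI) (simp add: coord_proj_nth Af(2) bf0 cinner.zero_right)
    then show "push ?c (Af e) \<in> W"
      by (simp add: W_def E0_coord_proj push_c push_coord_proj[OF ci const_value_index])
    show "Af' (pull ?c (push ?c (Af e))) = e" by (simp add: pull_push[OF ci] Af(4))
    show "push ?c (Af (Af' (pull ?c x))) = x" if "x \<in> W"
      using that by (simp add: Af(3) W_def E0_coord_proj push_coord_proj[OF ci const_value_index, symmetric] push_pull[OF ci])
  qed
  \<comment> \<open>Only \<open>M'\<close> has explicit coordinates. Once \<open>M' ?v = ?j\<close>
    is known, all inner products among \<open>?v\<close> and \<open>M ?j\<close> equal <e, e>, so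
    their difference has norm zero.\<close>
  have M_J: "M (push ?c (Ae e)) = V (\<lambda>_. 0) e" for e
  proof -
    let ?v = "V (\<lambda>_. 0) e" and ?j = "push ?c (Ae e)"
    have M'v: "M' ?v = ?j"
    proof (rule ell2_eqI)
      fix p
      obtain l j where p: "p = index_code (l :: 'n \<Rightarrow> nat, j)" by (rule index_code_cases)
      show "ell2_nth (M' ?v) p = ell2_nth ?j p"
      proof (cases "l = (\<lambda>_. 0)")
        case True
        have "p = ?c j" by (simp add: p True const_index_def)
        then show ?thesis using True by (simp add: const_nth) (simp add: M(2) u_code V_cinner Ae(2) const_index_def)
      next
        case False
        then have "p \<notin> ?K" by (simp add: p range_const_index)
        with False show ?thesis by (auto simp: push_nth[OF ci] M(2) p u_code V_cinner)
      qed
    qed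
    have jj: "cinner ?j ?j = cinner e e"
      by (simp add: adjoint_pairD[OF push_adj[OF ci]] pull_push[OF ci] coordinates_cinner[OF Ae(1,4)])
    have MM: "M' (M ?j) = ?j" using Je(1)[of e] by (simp add: M(3) W1_def)
    have "cinner ?v ?v = cinner e e" by (simp add: V_cinner)
    moreover have "cinner ?v (M ?j) = cinner e e"
      using adjoint_pairD[OF M(1), of ?v ?j] by (simp add: M'v jj)
    moreover have "cinner (M ?j) ?v = cinner e e" "cinner (M ?j) (M ?j) = cinner e e"
      by (simp_all add: adjoint_pairD[OF Mp] M'v MM jj)
    ultimately have "cinner (?v - M ?j) (?v - M ?j) = 0"
      unfolding cinner_diff_left cinner_diff_right by simp
    then show ?thesis by (simp add: cinner_eq_0_norm)
  qed
  have model: "push ?c (Af (blinfun_apply (\<Theta> z) e)) = ev z (M (push ?c (Ae e)))" if z: "z \<in> polydisc" for z e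
  proof (rule ell2_eqI)
    fix p
    let ?x = "M (push ?c (Ae e))"
    show "ell2_nth (push ?c (Af (blinfun_apply (\<Theta> z) e))) p = ell2_nth (ev z ?x) p"
    proof (cases "p \<in> ?K")
      case True
      then obtain i where i: "p = ?c i" by blast
      \<comment> \<open>Evaluating a coordinate function at \<open>z\<close> turns shifts into
        multiplication, so \<open>functional_ev\<close> applies. It replaces \<open>?x\<close> by
        the constant \<open>ev z ?x\<close>, whose value is read off from a single
        coordinate.\<close>
      have "eval_coordinate z i (y - (z $ k) *\<^sub>C pull (step k) y) = eval_coordinate z i (N k y)" for k y
        by (simp add: N_def eval_coordinate_diff[OF z] eval_coordinate_scaleC[OF z] eval_coordinate_push[OF z])
      from functional_ev[OF z this] have "eval_coordinate z i ?x = eval_coordinate z i (ev z ?x)" .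
      also have "\<dots> = eval_coordinate z i (coord_proj ?K (ev z ?x))"
        by (simp add: E0_coord_proj[symmetric] ev_list)
      also have "\<dots> = ell2_nth (ev z ?x) (?c i)" by (rule eval_coordinate_const[OF z])
      finally have 1: "ell2_nth (ev z ?x) (?c i) = eval_coordinate z i ?x" by simp
      have "((\<lambda>k. monomial k z * ell2_nth ?x (index_code (k, i))) has_sum cinner (blinfun_apply (\<Theta> z) e) (bf i)) UNIV"
        using has_sum_bounded_linear[OF cinner.bounded_linear_left c1[OF z], of e "bf i"]
        by (simp add: M_J V_nth shift_coeff_0 cinner_scaleC_left)
      then have "eval_coordinate z i ?x = cinner (blinfun_apply (\<Theta> z) e) (bf i)"
        by (rule eval_coordinate_eqI[OF z])
      with 1 show ?thesis by (simp add: i const_nth Af(2))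
    next
      case False
      have "ev z ?x = coord_proj ?K (ev z ?x)" by (simp add: E0_coord_proj[symmetric] ev_list)
      then have "ell2_nth (ev z ?x) p = ell2_nth (coord_proj ?K (ev z ?x)) p" by (rule arg_cong)
      with False show ?thesis by (auto simp: push_nth[OF ci] coord_proj_nth)
    qed
  qed
  obtain \<sigma> \<sigma>s where
    "unitary_op UNIV (big_defect_space H T \<times> F) \<sigma>"
    "unitary_op UNIV (defect_star_space H T \<times> F) \<sigma>s"
    "\<And>z e. z \<in> polydisc \<Longrightarrow> blinfun_apply (\<Theta> z) e = adj UNIV \<sigma>s (map_prod (char_fun H T z) id (\<sigma> e))"
    by (rule inner_function_model[OF adjoint_pair_comp[OF push_adj[OF ci] Ae(1)] Je(2,1,3)
          adjoint_pair_comp[OF push_adj[OF ci] Af(1)] Jf(2,1,3) model]) blast+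
  then show ?thesis
    using hilbert_carrier_H beurling_tuple_T hilbert_carrier_F
    by (intro exI[of _ H] exI[of _ T] exI[of _ F] exI[of _ \<sigma>] exI[of _ \<sigma>s]) auto
qed

end
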